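(* Let $M$ be a correspondence over a unital $C^*$-algebra $A$ such that $M$ is essential as a left $A$-module, and let $\{m_j:j\ge 0\}$ be a (finite or countably infinite) Parseval frame for $M$ such that $\langle m_0,m_0\rangle=1$. Define $T_k:M^{\otimes k}\to M^{\otimes(k+1)}$ by $T_kn=m_0\otimes n$ (for $k=0$: $T_0a=m_0\cdot a$ on $M^{\otimes0}=A$), and let $(M_\infty,\iota^k)=\varinjlim(M^{\otimes k},T_k)$. Then $$\{\iota^0(1)\}\cup\Big\{\iota^k\Big(\bigotimes_{l=1}^k m_{j_l}\Big):k\ge 1,\ j_l\ge 0\text{ and }j_1>0\Big\}$$ is a Parseval frame for $M_\infty$. If $\{m_j\}$ is an orthonormal basis for $M$, then this set is an orthonormal basis for $M_\infty$.
   Context: All Hilbert modules are right Hilbert $A$-modules, with inner product $A$-linear in the second variable. A correspondence over $A$ is a right Hilbert $A$-module $M$ with a left action given by a $*$-homomorphism $A\to\mathcal L(M)$; it is essential as a left module if $1_A\cdot n=n$ for all $n\in M$. $M^{\otimes k}$ is the $k$-fold internal (balanced) tensor power, where $\langle x\otimes n,y\otimes n'\rangle=\langle n,\langle x,y\rangle\cdot n'\rangle$, and $M^{\otimes 0}=A_A$. $\varinjlim(X_k,T_k)$, for inner-product preserving $T_k:X_k\to X_{k+1}$, is the Hilbert-module direct limit: the completion $X_\infty$ of the quotient of $\bigsqcup_kX_k$ in which $x\in X_k$ is identified with $T_kx\in X_{k+1}$, with canonical inner-product preserving maps $\iota^k:X_k\to X_\infty$ satisfying $\iota^{k+1}\circ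 T_k=\iota^k$. A countable family $\{x_j:j\in J\}$ in a Hilbert module $X$ over a unital $C^*$-algebra $A$ is a Parseval frame for $X$ if $\langle x,x\rangle=\sum_{j\in J}\langle x,x_j\rangle\langle x_j,x\rangle$ for every $x\in X$, with norm convergence in $A$ (the terms being positive, convergence to $\langle x,x\rangle$ along one enumeration is equivalent to convergence along the net of finite subsets of $J$); equivalently, $x=\sum_jx_j\cdot\langle x_j,x\rangle$ in norm for every $x$. It is an orthonormal basis if $\{x_j\}$ generates $X$ (as a closed submodule) and $\langle x_j,x_k\rangle=\delta_{j,k}1_A$. The sets in the claim are understood as families indexed by the tuples $(j_1,\dots,j_k)$ together with the one extra element $\iota^0(1)$. *)

theory Defs
  imports "HOL-Analysis.Analysis" "HOL-Library.Poly_Mapping"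
begin

section \<open>Unital C*-algebras\<close>

(* The class monoid_mult is used instead of ring_1 so as not to exclude the zero algebra;
   norm 1 = 1 follows from the C*-identity whenever 1 \<noteq> 0. *)
class unital_cstar_algebra = real_normed_algebra + banach + monoid_mult +
  fixes scaleC :: "complex \<Rightarrow> 'a \<Rightarrow> 'a" (infixr \<open>*\<^sub>C\<close> 75)
    and star :: "'a \<Rightarrow> 'a"
  assumes scaleC_add_right: "c *\<^sub>C (x + y) = c *\<^sub>C x + c *\<^sub>C y"
    and scaleC_add_left: "(c + d) *\<^sub>C x = c *\<^sub>C x + d *\<^sub>C x"
    and scaleC_scaleC: "c *\<^sub>C (d *\<^sub>C x) = (c * d) *\<^sub>C x"
    and scaleC_of_real: "complex_of_real r *\<^sub>C x = r *\<^sub>R x"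
    and mult_scaleC_left: "(c *\<^sub>C x) * y = c *\<^sub>C (x * y)"
    and mult_scaleC_right: "x * (c *\<^sub>C y) = c *\<^sub>C (x * y)"
    and norm_scaleC: "norm (c *\<^sub>C x) = cmod c * norm x"
    and star_star: "star (star x) = x"
    and star_add: "star (x + y) = star x + star y"
    and star_scaleC: "star (c *\<^sub>C x) = cnj c *\<^sub>C star x"
    and star_mult: "star (x * y) = star y * star x"
    and cstar_identity: "norm (star x * x) = (norm x)\<^sup>2"

definition cstar_positive :: "'a::unital_cstar_algebra \<Rightarrow> bool" where
  "cstar_positive a \<longleftrightarrow> (\<exists>b. a = star b * b)"


section \<open>Right Hilbert modules\<close>

(* hscale x a is x \<cdot> a. As A is unital, no separate complex scalar multiplication is needed:
   the scalar c acts as x \<cdot> (c 1). *)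
record ('a, 'x) hmodule =
  hcarrier :: "'x set"
  hzero :: "'x"
  hadd :: "'x \<Rightarrow> 'x \<Rightarrow> 'x"
  hscale :: "'x \<Rightarrow> 'a \<Rightarrow> 'x"
  hinner :: "'x \<Rightarrow> 'x \<Rightarrow> 'a"

definition hdiff :: "('a::unital_cstar_algebra, 'x, 'r) hmodule_scheme \<Rightarrow> 'x \<Rightarrow> 'x \<Rightarrow> 'x" where
  "hdiff X x y = hadd X x (hscale X y (- 1))"

definition hnorm :: "('a::unital_cstar_algebra, 'x, 'r) hmodule_scheme \<Rightarrow> 'x \<Rightarrow> real" where
  "hnorm X x = sqrt (norm (hinner X x x))"

definition hconverges ::
    "('a::unital_cstar_algebra, 'x, 'r) hmodule_scheme \<Rightarrow> (nat \<Rightarrow> 'x) \<Rightarrow> 'x \<Rightarrow> bool" where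
  "hconverges X s x \<longleftrightarrow> (\<lambda>n. hnorm X (hdiff X (s n) x)) \<longlonglongrightarrow> 0"

definition hCauchy :: "('a::unital_cstar_algebra, 'x, 'r) hmodule_scheme \<Rightarrow> (nat \<Rightarrow> 'x) \<Rightarrow> bool" where
  "hCauchy X s \<longleftrightarrow> (\<forall>n. s n \<in> hcarrier X) \<and>
     (\<forall>e>0. \<exists>N. \<forall>i\<ge>N. \<forall>j\<ge>N. hnorm X (hdiff X (s i) (s j)) < e)"

locale hilbert_module =
  fixes X :: "('a::unital_cstar_algebra, 'x, 'r) hmodule_scheme"
  assumes zero_closed: "hzero X \<in> hcarrier X"
    and add_closed: "\<lbrakk>x \<in> hcarrier X; y \<in> hcarrier X\<rbrakk> \<Longrightarrow> hadd X x y \<in> hcarrier X"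
    and scale_closed: "x \<in> hcarrier X \<Longrightarrow> hscale X x a \<in> hcarrier X"
    and add_assoc: "\<lbrakk>x \<in> hcarrier X; y \<in> hcarrier X; z \<in> hcarrier X\<rbrakk>
      \<Longrightarrow> hadd X (hadd X x y) z = hadd X x (hadd X y z)"
    and add_commute: "\<lbrakk>x \<in> hcarrier X; y \<in> hcarrier X\<rbrakk> \<Longrightarrow> hadd X x y = hadd X y x"
    and add_zero: "x \<in> hcarrier X \<Longrightarrow> hadd X x (hzero X) = x"
    and add_inverse: "x \<in> hcarrier X \<Longrightarrow> \<exists>y\<in>hcarrier X. hadd X x y = hzero X"
    and scale_add_left: "\<lbrakk>x \<in> hcarrier X; y \<in> hcarrier X\<rbrakk>
      \<Longrightarrow> hscale X (hadd X x y) a = hadd X (hscale X x a) (hscale X y a)"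
    and scale_add_right: "x \<in> hcarrier X
      \<Longrightarrow> hscale X x (a + b) = hadd X (hscale X x a) (hscale X x b)"
    and scale_mult: "x \<in> hcarrier X \<Longrightarrow> hscale X x (a * b) = hscale X (hscale X x a) b"
    and scale_one: "x \<in> hcarrier X \<Longrightarrow> hscale X x 1 = x"
    and inner_add_right: "\<lbrakk>x \<in> hcarrier X; y \<in> hcarrier X; z \<in> hcarrier X\<rbrakk>
      \<Longrightarrow> hinner X x (hadd X y z) = hinner X x y + hinner X x z"
    and inner_scale_right: "\<lbrakk>x \<in> hcarrier X; y \<in> hcarrier X\<rbrakk>
      \<Longrightarrow> hinner X x (hscale X y a) = hinner X x y * a"
    and star_inner: "\<lbrakk>x \<in> hcarrier X; y \<in> hcarrier X\<rbrakk> \<Longrightarrow> star (hinner X x y) = hinner X y x"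
    and inner_positive: "x \<in> hcarrier X \<Longrightarrow> cstar_positive (hinner X x x)"
    and inner_definite: "\<lbrakk>x \<in> hcarrier X; hinner X x x = 0\<rbrakk> \<Longrightarrow> x = hzero X"
    and complete: "hCauchy X s \<Longrightarrow> \<exists>x\<in>hcarrier X. hconverges X s x"

definition parseval_frame ::
    "('a::unital_cstar_algebra, 'x, 'r) hmodule_scheme \<Rightarrow> 'i set \<Rightarrow> ('i \<Rightarrow> 'x) \<Rightarrow> bool" where
  "parseval_frame X J x \<longleftrightarrow>
     hilbert_module X \<and> countable J \<and> (\<forall>j\<in>J. x j \<in> hcarrier X) \<and>
     (\<forall>\<xi>\<in>hcarrier X. ((\<lambda>j. hinner X \<xi> (x j) * hinner X (x j) \<xi>) has_sum hinner X \<xi> \<xi>) J)"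

definition closed_submodule ::
    "('a::unital_cstar_algebra, 'x, 'r) hmodule_scheme \<Rightarrow> 'x set \<Rightarrow> bool" where
  "closed_submodule X S \<longleftrightarrow>
     S \<subseteq> hcarrier X \<and> hzero X \<in> S \<and>
     (\<forall>x\<in>S. \<forall>y\<in>S. hadd X x y \<in> S) \<and> (\<forall>x\<in>S. \<forall>a. hscale X x a \<in> S) \<and>
     (\<forall>s x. (\<forall>n. s n \<in> S) \<and> x \<in> hcarrier X \<and> hconverges X s x \<longrightarrow> x \<in> S)"

definition orthonormal_basis ::
    "('a::unital_cstar_algebra, 'x, 'r) hmodule_scheme \<Rightarrow> 'i set \<Rightarrow> ('i \<Rightarrow> 'x) \<Rightarrow> bool" where
  "orthonormal_basis X J x \<longleftrightarrow>
     hilbert_module X \<and> countable J \<and> (\<forall>j\<in>J. x j \<in> hcarrier X) \<and>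
     (\<forall>S. closed_submodule X S \<and> x ` J \<subseteq> S \<longrightarrow> S = hcarrier X) \<and>
     (\<forall>j\<in>J. \<forall>k\<in>J. hinner X (x j) (x k) = (if j = k then 1 else 0))"


section \<open>Correspondences\<close>

record ('a, 'x) corr = "('a, 'x) hmodule" +
  lact :: "'a \<Rightarrow> 'x \<Rightarrow> 'x"

(* lact_adjoint says both that each lact M a is adjointable and that a \<mapsto> lact M a preserves
   the involution; adjointable maps are automatically A-linear. *)
locale correspondence = hilbert_module M
  for M :: "('a::unital_cstar_algebra, 'x, 'r) corr_scheme" +
  assumes lact_closed: "x \<in> hcarrier M \<Longrightarrow> lact M a x \<in> hcarrier M"
    and lact_adjoint: "\<lbrakk>x \<in> hcarrier M; y \<in> hcarrier M\<rbrakk>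
      \<Longrightarrow> hinner M (lact M a x) y = hinner M x (lact M (star a) y)"
    and lact_add: "x \<in> hcarrier M \<Longrightarrow> lact M (a + b) x = hadd M (lact M a x) (lact M b x)"
    and lact_scaleC: "x \<in> hcarrier M \<Longrightarrow> lact M (c *\<^sub>C a) x = hscale M (lact M a x) (c *\<^sub>C 1)"
    and lact_mult: "x \<in> hcarrier M \<Longrightarrow> lact M (a * b) x = lact M a (lact M b x)"

definition essential_left :: "('a::unital_cstar_algebra, 'x, 'r) corr_scheme \<Rightarrow> bool" where
  "essential_left M \<longleftrightarrow> (\<forall>x\<in>hcarrier M. lact M 1 x = x)"


section \<open>Completion\<close>

(* X is a module with an A-valued semi-inner product. Cauchy sequences are identified when their
   difference tends to 0, so the null vectors of X are divided out at the same time. *)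
definition completion_rel ::
    "('a::unital_cstar_algebra, 'x, 'r) hmodule_scheme \<Rightarrow> ((nat \<Rightarrow> 'x) \<times> (nat \<Rightarrow> 'x)) set" where
  "completion_rel X =
     {(s, t). hCauchy X s \<and> hCauchy X t \<and> (\<lambda>n. hnorm X (hdiff X (s n) (t n))) \<longlonglongrightarrow> 0}"

definition completion ::
    "('a::unital_cstar_algebra, 'x, 'r) hmodule_scheme \<Rightarrow> ('a, (nat \<Rightarrow> 'x) set) hmodule" where
  "completion X = \<lparr>
     hcarrier = {s. hCauchy X s} // completion_rel X,
     hzero = completion_rel X `` {\<lambda>n. hzero X},
     hadd = (\<lambda>P Q. \<Union>s\<in>P. \<Union>t\<in>Q. completion_rel X `` {\<lambda>n. hadd X (s n) (t n)}),
     hscale = (\<lambda>P a. \<Union>s\<in>P. completion_rel X `` {\<lambda>n. hscale X (s n) a}),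
     hinner = (\<lambda>P Q. THE c. \<forall>s\<in>P. \<forall>t\<in>Q. (\<lambda>n. hinner X (s n) (t n)) \<longlonglongrightarrow> c) \<rparr>"

definition completion_embed ::
    "('a::unital_cstar_algebra, 'x, 'r) hmodule_scheme \<Rightarrow> 'x \<Rightarrow> (nat \<Rightarrow> 'x) set" where
  "completion_embed X x = completion_rel X `` {\<lambda>n. x}"


section \<open>Internal tensor powers\<close>

(* tensor_inner_act M xs c ys is the inner product of x1 \<otimes> ... \<otimes> xk with c \<cdot> (y1 \<otimes> ... \<otimes> yk),
   where the empty tensor is 1 in A. The recursions unfold
   \<langle>x \<otimes> n, y \<otimes> n'\<rangle> = \<langle>n, \<langle>x, y\<rangle> \<cdot> n'\<rangle> and c \<cdot> (y \<otimes> n') = (c \<cdot> y) \<otimes> n'. *)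
fun tensor_inner_act ::
    "('a::unital_cstar_algebra, 'x, 'r) corr_scheme \<Rightarrow> 'x list \<Rightarrow> 'a \<Rightarrow> 'x list \<Rightarrow> 'a" where
  "tensor_inner_act M [] c [] = c"
| "tensor_inner_act M (x # xs) c (y # ys) = tensor_inner_act M xs (hinner M x (lact M c y)) ys"
| "tensor_inner_act M _ _ _ = 0"

fun tensor_inner :: "('a::unital_cstar_algebra, 'x, 'r) corr_scheme \<Rightarrow> 'x list \<Rightarrow> 'x list \<Rightarrow> 'a" where
  "tensor_inner M [] [] = 1"
| "tensor_inner M (x # xs) (y # ys) = tensor_inner_act M xs (hinner M x y) ys"
| "tensor_inner M _ _ = 0"

(* The free right A-module on the k-tuples of elements of M, with the semi-inner product determined
   by tensor_inner: the finitely supported f stands for the sum of the (x1 \<otimes> ... \<otimes> xk) \<cdot> f(x1,...,xk).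
   The multilinearity and balancing relations, and (x1 \<otimes> ... \<otimes> xk) \<cdot> a = x1 \<otimes> ... \<otimes> (xk \<cdot> a), hold
   up to null vectors. For k = 0 the only tuple is the empty one, and this is A with
   \<langle>a, b\<rangle> = a* b. *)
definition tensor_pre :: "('a::unital_cstar_algebra, 'x, 'r) corr_scheme \<Rightarrow> nat
    \<Rightarrow> ('a, 'x list \<Rightarrow>\<^sub>0 'a) hmodule" where
  "tensor_pre M k = \<lparr>
     hcarrier = {f. \<forall>xs\<in>Poly_Mapping.keys f. length xs = k \<and> set xs \<subseteq> hcarrier M},
     hzero = 0,
     hadd = (+),
     hscale = (\<lambda>f a. Poly_Mapping.map (\<lambda>c. c * a) f),
     hinner = (\<lambda>f g. \<Sum>xs\<in>Poly_Mapping.keys f. \<Sum>ys\<in>Poly_Mapping.keys g.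
       star (Poly_Mapping.lookup f xs) * tensor_inner M xs ys * Poly_Mapping.lookup g ys) \<rparr>"

type_synonym ('a, 'x) tensor = "(nat \<Rightarrow> ('x list \<Rightarrow>\<^sub>0 'a)) set"

definition tensor_power :: "('a::unital_cstar_algebra, 'x, 'r) corr_scheme \<Rightarrow> nat
    \<Rightarrow> ('a, ('a, 'x) tensor) hmodule" where
  "tensor_power M k = completion (tensor_pre M k)"

(* The identification of A with the 0-th tensor power. *)
definition tensor_scalar :: "('a::unital_cstar_algebra, 'x, 'r) corr_scheme \<Rightarrow> 'a \<Rightarrow> ('a, 'x) tensor" where
  "tensor_scalar M a = completion_embed (tensor_pre M 0) (Poly_Mapping.single [] a)"

definition elementary_tensor ::
    "('a::unital_cstar_algebra, 'x, 'r) corr_scheme \<Rightarrow> 'x list \<Rightarrow> ('a, 'x) tensor" where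
  "elementary_tensor M xs =
     completion_embed (tensor_pre M (length xs)) (Poly_Mapping.single xs 1)"

definition formal_cons :: "'x \<Rightarrow> ('x list \<Rightarrow>\<^sub>0 'a::unital_cstar_algebra) \<Rightarrow> ('x list \<Rightarrow>\<^sub>0 'a)" where
  "formal_cons x f =
     (\<Sum>xs\<in>Poly_Mapping.keys f. Poly_Mapping.single (x # xs) (Poly_Mapping.lookup f xs))"

(* tensor_cons M k x n is x \<otimes> n in the (k+1)-st tensor power, for n in the k-th one. For k = 0 it
   sends a in A to the class of (x) \<cdot> a, which is the elementary tensor of x \<cdot> a. *)
definition tensor_cons :: "('a::unital_cstar_algebra, 'x, 'r) corr_scheme \<Rightarrow> nat \<Rightarrow> 'x
    \<Rightarrow> ('a, 'x) tensor \<Rightarrow> ('a, 'x) tensor" where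
  "tensor_cons M k x P =
     (\<Union>s\<in>P. completion_rel (tensor_pre M (Suc k)) `` {\<lambda>n. formal_cons x (s n)})"


section \<open>Direct limits\<close>

primrec transport :: "(nat \<Rightarrow> 'x \<Rightarrow> 'x) \<Rightarrow> nat \<Rightarrow> nat \<Rightarrow> 'x \<Rightarrow> 'x" where
  "transport T k 0 x = x"
| "transport T k (Suc d) x = T (k + d) (transport T k d x)"

definition limit_rel :: "(nat \<Rightarrow> ('a, 'x) hmodule) \<Rightarrow> (nat \<Rightarrow> 'x \<Rightarrow> 'x)
    \<Rightarrow> ((nat \<times> 'x) \<times> (nat \<times> 'x)) set" where
  "limit_rel X T =
     {((k, x), (l, y)). x \<in> hcarrier (X k) \<and> y \<in> hcarrier (X l) \<and>
        (\<exists>n\<ge>max k l. transport T k (n - k) x = transport T l (n - l) y)}"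

definition algebraic_limit :: "(nat \<Rightarrow> ('a::unital_cstar_algebra, 'x) hmodule) \<Rightarrow> (nat \<Rightarrow> 'x \<Rightarrow> 'x)
    \<Rightarrow> ('a, (nat \<times> 'x) set) hmodule" where
  "algebraic_limit X T = \<lparr>
     hcarrier = (SIGMA k:UNIV. hcarrier (X k)) // limit_rel X T,
     hzero = limit_rel X T `` {(0, hzero (X 0))},
     hadd = (\<lambda>P Q. \<Union>(k, x)\<in>P. \<Union>(l, y)\<in>Q. limit_rel X T ``
       {(max k l, hadd (X (max k l)) (transport T k (max k l - k) x) (transport T l (max k l - l) y))}),
     hscale = (\<lambda>P a. \<Union>(k, x)\<in>P. limit_rel X T `` {(k, hscale (X k) x a)}),
     hinner = (\<lambda>P Q. THE c. \<forall>(k, x)\<in>P. \<forall>(l, y)\<in>Q. c =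
       hinner (X (max k l)) (transport T k (max k l - k) x) (transport T l (max k l - l) y)) \<rparr>"

type_synonym 'x limit = "(nat \<Rightarrow> (nat \<times> 'x) set) set"

definition direct_limit :: "(nat \<Rightarrow> ('a::unital_cstar_algebra, 'x) hmodule) \<Rightarrow> (nat \<Rightarrow> 'x \<Rightarrow> 'x)
    \<Rightarrow> ('a, 'x limit) hmodule" where
  "direct_limit X T = completion (algebraic_limit X T)"

definition limit_map :: "(nat \<Rightarrow> ('a::unital_cstar_algebra, 'x) hmodule) \<Rightarrow> (nat \<Rightarrow> 'x \<Rightarrow> 'x)
    \<Rightarrow> nat \<Rightarrow> 'x \<Rightarrow> 'x limit" where
  "limit_map X T k x = completion_embed (algebraic_limit X T) (limit_rel X T `` {(k, x)})"

end

theory Submission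
  imports Defs
begin

text \<open>Expanding inner products through the frame gives, by induction on \<open>k\<close>, Parseval's identity
  for the words \<open>m\<^bsub>j\<^sub>1\<^esub> \<otimes> \<dots> \<otimes> m\<^bsub>j\<^sub>k\<^esub>\<close> in the \<open>k\<close>-th tensor power; the positivity of the
  semi-inner product on the algebraic tensor power is a by-product. In the direct limit a word is
  unchanged when \<open>m\<^sub>0\<close> is put in front of it, so deleting leading zeros matches the words of length
  \<open>k\<close> with the words of length at most \<open>k\<close> that are empty or begin with a positive index. Parseval's
  identity therefore holds on the dense union of the images of the tensor powers, and it extends to
  the closure. The frame expansion in the limit shows that an orthonormal family generates it.\<close>

section \<open>Positive elements of a unital C*-algebra\<close>

text \<open>Positivity of the inner product on a balanced tensor product is usually read off from
  positivity of Gram matrices over A. Here the frame does that work: it exhibits each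
  \<open>hinner (pre k) f f\<close> as an unconditional sum of elements \<open>star b * b\<close>.
  The price is order theory. Positivity is defined by a factorization but is needed for sums and
  limits, so Kaplansky's theorem is derived from the C*-identity, with a power series for square
  roots in place of functional calculus. The order also controls the summation. For 0 \<le> a \<le>
  b the norms are ordered too (\<open>psd_norm_le\<close>), so a defect of Parseval's identity that
  is small for one finite set of words stays small for every larger one; this is convergence along
  the net of finite sets. The limit module is a completion of a limit of completions. Identities are
  therefore checked on finite formal sums at one level and carried over by isometries and
  density.\<close>

lemma star_zero [simp]: "star (0::'a::unital_cstar_algebra) = 0"
  by (metis add_cancel_right_right star_add)

lemma star_minus: "star (- x) = - star (x::'a::unital_cstar_algebra)"
  by (metis add.right_inverse add_eq_0_iff star_add star_zero)

lemma star_diff: "star (x - y) = star x - star (y::'a::unital_cstar_algebra)"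
  by (metis diff_conv_add_uminus star_add star_minus)

lemma star_one [simp]: "star (1::'a::unital_cstar_algebra) = 1"
  by (metis mult.right_neutral star_mult star_star)

lemma star_scaleR: "star (r *\<^sub>R x) = r *\<^sub>R star (x::'a::unital_cstar_algebra)"
  by (metis complex_cnj_complex_of_real scaleC_of_real star_scaleC)

lemma star_sum: "star (sum f S) = (\<Sum>i\<in>S. star (f i :: 'a::unital_cstar_algebra))"
  by (induction S rule: infinite_finite_induct) (simp_all add: star_add)

lemma norm_star [simp]: "norm (star x) = norm (x::'a::unital_cstar_algebra)"
proof -
  have *: "norm y \<le> norm (star y)" for y :: 'a
  proof (cases "norm y = 0")
    case False
    have "norm y * norm y \<le> norm (star y) * norm y"
      using norm_mult_ineq[of "star y" y] cstar_identity[of y] by (simp add: power2_eq_square)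
    then show ?thesis using False by simp
  qed auto
  show ?thesis using *[of x] *[of "star x"] by (simp add: star_star)
qed

lemma bounded_linear_star: "bounded_linear (star :: 'a::unital_cstar_algebra \<Rightarrow> 'a)"
  by (rule bounded_linear_intro[where K = 1]) (auto simp: star_add star_scaleR)

lemmas tendsto_star = bounded_linear.tendsto[OF bounded_linear_star]

text \<open>The C*-identity makes \<open>norm 1\<close> equal to its own square. It can be 0,
  because the zero algebra is allowed.\<close>

lemma norm_one_le: "norm (1::'a::unital_cstar_algebra) \<le> 1"
proof -
  have "norm (1::'a) = norm (1::'a) * norm (1::'a)"
    using cstar_identity[of "1::'a"] by (simp add: power2_eq_square)
  then show ?thesis by (cases "norm (1::'a) = 0") auto
qed

lemma norm_pow_le: "norm (x ^ n) \<le> norm (x::'a::unital_cstar_algebra) ^ n"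
proof (induction n)
  case (Suc n)
  have "norm (x ^ Suc n) \<le> norm x * norm (x ^ n)" by (simp add: norm_mult_ineq)
  also have "\<dots> \<le> norm x * norm x ^ n" by (rule mult_left_mono[OF Suc]) simp
  finally show ?case by simp
qed (simp add: norm_one_le)

lemma scaleC_minus_one [simp]: "(-1) *\<^sub>C x = - (x::'a::unital_cstar_algebra)"
  using scaleC_of_real[of "-1" x] by simp

lemma scaleC_one [simp]: "1 *\<^sub>C x = (x::'a::unital_cstar_algebra)"
  using scaleC_of_real[of 1 x] by simp

lemma scaleC_minus_left: "(- c) *\<^sub>C x = - (c *\<^sub>C (x::'a::unital_cstar_algebra))"
  using scaleC_scaleC[of "-1" c x] by simp

lemma scaleC_minus_right: "c *\<^sub>C (- x) = - (c *\<^sub>C (x::'a::unital_cstar_algebra))"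
  using scaleC_scaleC[of c "-1" x] by (simp add: scaleC_minus_left)

lemma scaleC_diff_right: "c *\<^sub>C (x - y) = c *\<^sub>C x - c *\<^sub>C (y::'a::unital_cstar_algebra)"
  using scaleC_add_right[of c x "- y"] by (simp add: scaleC_minus_right)

section \<open>Square roots by the binomial series\<close>

text \<open>The Taylor coefficients of \<open>sqrt (1 - x)\<close>. Only the first is positive and their partial sums
  are nonnegative, so the series converges absolutely for \<open>norm x \<le> 1\<close>.\<close>

definition sqrt_coeff :: "nat \<Rightarrow> real" where
  "sqrt_coeff n = (-1) ^ n * ((1/2) gchoose n)"

lemma sqrt_coeff_0 [simp]: "sqrt_coeff 0 = 1"
  by (simp add: sqrt_coeff_def)

lemma neg_half_gchoose_nonneg: "(-1) ^ n * ((-1/2 :: real) gchoose n) \<ge> 0"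
proof -
  have "(-1) ^ n * ((-1/2 :: real) gchoose n) = pochhammer (1/2) n / fact n"
    by (simp add: gbinomial_pochhammer)
  then show ?thesis by (simp add: pochhammer_nonneg)
qed

lemma sqrt_coeff_Suc_nonpos: "sqrt_coeff (Suc n) \<le> 0"
proof -
  have "sqrt_coeff (Suc n) = pochhammer (- (1/2)) (Suc n) / fact (Suc n)"
    by (simp add: sqrt_coeff_def gbinomial_pochhammer)
  also have "\<dots> = - (1/2) * pochhammer (1/2) n / fact (Suc n)"
    by (simp add: pochhammer_rec)
  finally show ?thesis by (simp add: pochhammer_nonneg)
qed

text \<open>The partial sum up to n telescopes to (-1)^n times the generalized binomial coefficient
  of 1/2 - 1 = -1/2 over n, which is nonnegative.\<close>

lemma sum_sqrt_coeff_nonneg: "(\<Sum>k\<le>n. sqrt_coeff k) \<ge> 0"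
  using gbinomial_sum_lower_neg[of "1/2 :: real" n] neg_half_gchoose_nonneg[of n]
  by (simp add: sqrt_coeff_def mult.commute)

text \<open>All coefficients after the constant one are nonpositive, so this sum is 1 minus a
  partial sum of the series. The bound serves twice in \<open>sqrt_one_minus\<close>: for
  convergence on the closed unit ball and for \<open>norm (1 - y) \<le> 1\<close>.\<close>

lemma sum_abs_sqrt_coeff: "(\<Sum>k<n. \<bar>sqrt_coeff (Suc k)\<bar>) \<le> 1"
proof -
  have "(\<Sum>k<n. \<bar>sqrt_coeff (Suc k)\<bar>) = - (\<Sum>k<n. sqrt_coeff (Suc k))"
    by (simp add: abs_of_nonpos sqrt_coeff_Suc_nonpos sum_negf)
  moreover have "(\<Sum>k\<le>n. sqrt_coeff k) = 1 + (\<Sum>k<n. sqrt_coeff (Suc k))"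
    by (simp add: sum.atMost_shift)
  ultimately show ?thesis using sum_sqrt_coeff_nonneg[of n] by simp
qed

text \<open>Vandermonde's identity for the exponents 1/2 + 1/2 = 1: the square of the series has the
  coefficients of 1 - x.\<close>

lemma sqrt_coeff_convolution:
  "(\<Sum>i\<le>k. sqrt_coeff i * sqrt_coeff (k - i)) = (if k = 0 then 1 else if k = 1 then -1 else 0)"
proof -
  have "(\<Sum>i\<le>k. sqrt_coeff i * sqrt_coeff (k - i))
      = (\<Sum>i\<le>k. (-1) ^ k * (((1/2) gchoose i) * ((1/2) gchoose (k - i))))"
  proof (rule sum.cong[OF refl])
    fix i assume "i \<in> {..k}"
    then have "(-1::real) ^ k = (-1) ^ i * (-1) ^ (k - i)"
      by (simp flip: power_add)
    then show "sqrt_coeff i * sqrt_coeff (k - i)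
        = (-1) ^ k * (((1/2) gchoose i) * ((1/2) gchoose (k - i)))"
      by (simp add: sqrt_coeff_def)
  qed
  also have "\<dots> = (-1) ^ k * ((1/2 + 1/2 :: real) gchoose k)"
    using gbinomial_Vandermonde[of "1/2::real" "1/2" k] by (simp add: atMost_atLeast0 flip: sum_distrib_left)
  also have "\<dots> = (-1) ^ k * real (1 choose k)"
    by (simp add: binomial_gbinomial)
  also have "\<dots> = (if k = 0 then 1 else if k = 1 then -1 else 0)"
    by (cases k; cases "k - 1") auto
  finally show ?thesis .
qed

text \<open>The root is a norm limit of real polynomials in x. Hence it inherits self-adjointness
  and commutes with everything that commutes with x; the commutation clause later lets roots of
  commuting elements be combined.\<close>

lemma sqrt_one_minus:
  fixes x :: "'a::unital_cstar_algebra"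
  assumes "norm x \<le> 1"
  obtains y where "y * y = 1 - x" "norm (1 - y) \<le> 1" "star x = x \<Longrightarrow> star y = y"
    "\<And>z. z * x = x * z \<Longrightarrow> z * y = y * z"
proof -
  let ?f = "\<lambda>n. sqrt_coeff n *\<^sub>R x ^ n"
  have bound: "norm (?f n) \<le> \<bar>sqrt_coeff n\<bar>" for n
  proof -
    have "norm (x ^ n) \<le> 1"
      using norm_pow_le[of x n] power_le_one[OF norm_ge_zero assms] by (rule order_trans)
    then have "\<bar>sqrt_coeff n\<bar> * norm (x ^ n) \<le> \<bar>sqrt_coeff n\<bar> * 1"
      by (rule mult_left_mono) simp
    then show ?thesis by simp
  qed
  have sc: "summable (\<lambda>n. \<bar>sqrt_coeff (Suc n)\<bar>)"
    by (rule bounded_imp_summable[of _ 1]) (simp_all add: sum_abs_sqrt_coeff del: sum.lessThan_Suc flip: lessThan_Suc_atMost)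
  have sumSuc: "summable (\<lambda>n. norm (?f (Suc n)))"
    by (rule summable_comparison_test'[OF sc, of 0]) (simp only: real_norm_def abs_norm_cancel bound)
  then have sn: "summable (\<lambda>n. norm (?f n))" by (subst (asm) summable_Suc_iff)
  then have sf: "summable ?f" by (rule summable_norm_cancel)
  define y where "y = suminf (\<lambda>n. ?f n)"
  have "y * y = suminf (\<lambda>k. \<Sum>i\<le>k. ?f i * ?f (k - i))"
    unfolding y_def by (rule Cauchy_product[OF sn sn])
  also have "\<dots> = suminf (\<lambda>k. (if k = 0 then 1 else if k = 1 then -1 else 0) *\<^sub>R x ^ k)"
  proof (rule suminf_cong)
    fix k
    have "(\<Sum>i\<le>k. ?f i * ?f (k - i)) = (\<Sum>i\<le>k. (sqrt_coeff i * sqrt_coeff (k - i)) *\<^sub>R x ^ k)"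
      by (rule sum.cong) (auto simp flip: power_add)
    then show "(\<Sum>i\<le>k. ?f i * ?f (k - i)) = (if k = 0 then 1 else if k = 1 then -1 else 0) *\<^sub>R x ^ k"
      by (simp add: sqrt_coeff_convolution flip: scaleR_sum_left)
  qed
  also have "\<dots> = (\<Sum>k\<in>{0,1}. (if k = 0 then 1 else if k = 1 then -1 else 0) *\<^sub>R x ^ k)"
    by (rule suminf_finite) auto
  finally have "y * y = 1 - x" by simp
  moreover have "norm (1 - y) \<le> 1"
  proof -
    have "y = 1 + suminf (\<lambda>n. ?f (Suc n))"
      unfolding y_def using suminf_split_head[OF sf] by simp
    moreover have "norm (suminf (\<lambda>n. ?f (Suc n))) \<le> 1"
    proof -
      have "norm (suminf (\<lambda>n. ?f (Suc n))) \<le> suminf (\<lambda>n. norm (?f (Suc n)))"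
        by (rule summable_norm[OF sumSuc])
      also have "\<dots> \<le> suminf (\<lambda>n. \<bar>sqrt_coeff (Suc n)\<bar>)"
        by (rule suminf_le[OF _ sumSuc sc]) (rule bound)
      also have "\<dots> \<le> 1"
        by (rule suminf_le_const[OF sc]) (rule sum_abs_sqrt_coeff)
      finally show ?thesis .
    qed
    ultimately show ?thesis by simp
  qed
  moreover have "star y = y" if "star x = x"
  proof -
    have "star (x ^ n) = x ^ n" for n
      by (induction n) (use that in \<open>simp_all add: star_mult power_commutes\<close>)
    then show ?thesis
      unfolding y_def using bounded_linear.suminf[OF bounded_linear_star sf] by (simp add: star_scaleR)
  qed
  moreover have "z * y = y * z" if "z * x = x * z" for z
  proof -
    have "z * x ^ n = x ^ n * z" for n
      by (induction n) (use that in \<open>simp_all, metis mult.assoc\<close>)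
    then show ?thesis
      unfolding y_def using bounded_linear.suminf[OF bounded_linear_mult_left sf, of z]
        bounded_linear.suminf[OF bounded_linear_mult_right sf, of z] by simp
  qed
  ultimately show thesis by (rule that)
qed

section \<open>The positive cone in its norm description\<close>

text \<open>A norm description of positivity, visibly closed under sums; it is shown below
  to agree with \<^const>\<open>cstar_positive\<close>.\<close>

definition psd :: "'a::unital_cstar_algebra \<Rightarrow> bool" where
  "psd h \<longleftrightarrow> star h = h \<and> (\<exists>t. norm (t *\<^sub>R 1 - h) \<le> t)"

lemma psd_zero [simp]: "psd 0"
  unfolding psd_def by (auto intro!: exI[of _ 0])

lemma psd_self_adjoint: "psd h \<Longrightarrow> star h = h"
  by (simp add: psd_def)

lemma psd_add: "psd h \<Longrightarrow> psd k \<Longrightarrow> psd (h + k)"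
proof -
  assume "psd h" "psd k"
  then obtain s t where *: "star h = h" "star k = k" "norm (s *\<^sub>R 1 - h) \<le> s" "norm (t *\<^sub>R 1 - k) \<le> t"
    by (auto simp: psd_def)
  have "norm ((s + t) *\<^sub>R 1 - (h + k)) = norm ((s *\<^sub>R 1 - h) + (t *\<^sub>R 1 - k))"
    by (simp add: algebra_simps)
  also have "\<dots> \<le> s + t" using * by (intro norm_triangle_le add_mono)
  finally show ?thesis using * by (auto simp: psd_def star_add)
qed

lemma psd_sum: "(\<And>i. i \<in> S \<Longrightarrow> psd (f i)) \<Longrightarrow> psd (sum f S)"
  by (induction S rule: infinite_finite_induct) (auto intro: psd_add)

lemma psd_scaleR:
  assumes "psd h" "r \<ge> 0" shows "psd (r *\<^sub>R h)"
proof -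
  obtain t where t: "star h = h" "norm (t *\<^sub>R 1 - h) \<le> t" using assms by (auto simp: psd_def)
  have "norm ((r * t) *\<^sub>R 1 - r *\<^sub>R h) = r * norm (t *\<^sub>R 1 - h)"
    using assms(2) by (simp flip: scaleR_scaleR scaleR_diff_right)
  also have "\<dots> \<le> r * t" by (rule mult_left_mono) (use t assms in auto)
  finally show ?thesis using t by (auto simp: psd_def star_scaleR)
qed

text \<open>For t > 0 write h = t (1 - x) with \<open>norm x \<le> 1\<close>. The root is
  \<open>sqrt t\<close> times the root y of 1 - x, and \<open>norm (1 - y) \<le> 1\<close> makes it
  \<open>psd\<close> with parameter \<open>sqrt t\<close>.\<close>

lemma psd_sqrt:
  fixes h :: "'a::unital_cstar_algebra"
  assumes "star h = h" "norm (t *\<^sub>R 1 - h) \<le> t"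
  obtains s where "psd s" "s * s = h" "\<And>z. z * h = h * z \<Longrightarrow> z * s = s * z"
proof (cases "t = 0")
  case True
  then show ?thesis using assms that[of 0] by auto
next
  case False
  with assms have t: "t > 0" by (metis less_eq_real_def norm_ge_zero order_trans)
  define x where "x = 1 - (1 / t) *\<^sub>R h"
  have "t *\<^sub>R x = t *\<^sub>R 1 - h" using t by (simp add: x_def algebra_simps)
  then have "t * norm x \<le> t * 1" using assms(2) t by (metis abs_of_pos mult.right_neutral norm_scaleR)
  then have "norm x \<le> 1" using t by simp
  then obtain y where y: "y * y = 1 - x" "norm (1 - y) \<le> 1" "star x = x \<Longrightarrow> star y = y"
    "\<And>z. z * x = x * z \<Longrightarrow> z * y = y * z" by (rule sqrt_one_minus) blast
  have "star x = x" using assms by (simp add: x_def star_diff star_scaleR)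
  then have "star (sqrt t *\<^sub>R y) = sqrt t *\<^sub>R y" using y(3) by (simp add: star_scaleR)
  moreover have "norm (sqrt t *\<^sub>R 1 - sqrt t *\<^sub>R y) \<le> sqrt t"
    using y(2) t by (simp flip: scaleR_diff_right)
  ultimately have "psd (sqrt t *\<^sub>R y)" by (auto simp: psd_def)
  moreover have "sqrt t *\<^sub>R y * sqrt t *\<^sub>R y = h" using t y(1) by (simp add: x_def)
  moreover have "z * sqrt t *\<^sub>R y = sqrt t *\<^sub>R y * z" if "z * h = h * z" for z
    using y(4)[of z] that by (simp add: x_def algebra_simps)
  ultimately show ?thesis by (rule that)
qed

lemma norm_self_adjoint_square: "star s = s \<Longrightarrow> norm (s * s) = (norm (s::'a::unital_cstar_algebra))\<^sup>2"
  using cstar_identity[of s] by simp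

text \<open>The element \<open>a + \<i> b\<close> is a multiple of a unitary, and \<open>a\<close> is its real part.\<close>

lemma norm_le_of_squares:
  fixes a b :: "'a::unital_cstar_algebra"
  assumes "star a = a" "star b = b" "a * b = b * a" "a * a + b * b = t *\<^sub>R 1" "t \<ge> 0"
  shows "(norm a)\<^sup>2 \<le> t"
proof -
  define u where "u = a + \<i> *\<^sub>C b"
  have su: "star u = a - \<i> *\<^sub>C b"
    using assms by (simp add: u_def star_add star_scaleC scaleC_minus_left)
  have "star u * u = a * a - \<i> *\<^sub>C b * \<i> *\<^sub>C b"
    unfolding su unfolding u_def using assms(3)
    by (simp add: algebra_simps mult_scaleC_left mult_scaleC_right scaleC_diff_right)
  also have "\<dots> = a * a + b * b"
    by (simp add: mult_scaleC_left mult_scaleC_right scaleC_scaleC)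
  finally have "(norm u)\<^sup>2 = norm (t *\<^sub>R (1::'a))"
    using cstar_identity[of u] assms(4) by simp
  also have "\<dots> \<le> t * 1" using assms(5) norm_one_le[where 'a='a] by (auto simp: mult_left_le)
  finally have nu: "(norm u)\<^sup>2 \<le> t" by simp
  have "2 *\<^sub>R a = u + star u" unfolding su by (simp add: u_def scaleR_2)
  then have "2 * norm a \<le> norm u + norm (star u)" by (metis abs_numeral norm_scaleR norm_triangle_ineq)
  then have "norm a \<le> norm u" by simp
  then show ?thesis using nu by (meson norm_ge_zero order_trans power_mono)
qed

text \<open>Put t = (norm s)^2. Since \<open>norm (s * s)\<close> is t, the element t - s s
  satisfies the hypothesis of \<open>psd_sqrt\<close> with parameter t. Its root r commutes with s
  and r r + s s = t, so \<open>norm_le_of_squares\<close> bounds r.\<close>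

lemma norm_psd_square:
  fixes s :: "'a::unital_cstar_algebra"
  assumes "star s = s"
  shows "norm ((norm s)\<^sup>2 *\<^sub>R 1 - s * s) \<le> (norm s)\<^sup>2"
proof -
  let ?h = "(norm s)\<^sup>2 *\<^sub>R 1 - s * s"
  have "star ?h = ?h" using assms by (simp add: star_diff star_scaleR star_mult)
  moreover have "norm ((norm s)\<^sup>2 *\<^sub>R 1 - ?h) \<le> (norm s)\<^sup>2"
    using norm_self_adjoint_square[OF assms] by simp
  ultimately obtain r where r: "psd r" "r * r = ?h" "\<And>z. z * ?h = ?h * z \<Longrightarrow> z * r = r * z"
    by (rule psd_sqrt) blast
  have "s * r = r * s" by (rule r(3)) (simp add: algebra_simps)
  then have "(norm r)\<^sup>2 \<le> (norm s)\<^sup>2"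
    using r(1,2) \<open>s * r = r * s\<close> by (intro norm_le_of_squares[of r s]) (auto simp: assms psd_self_adjoint)
  then show ?thesis
    using norm_self_adjoint_square[OF psd_self_adjoint[OF r(1)]] r(2) by simp
qed

lemma psd_square: "star s = s \<Longrightarrow> psd (s * s)"
  unfolding psd_def using norm_psd_square by (auto simp: star_mult)

text \<open>The existential parameter can be taken to be \<open>norm h\<close>, which depends
  continuously on h; this is why the cone is closed in \<open>psd_tendsto\<close>. A root writes h
  as a square, to which \<open>norm_psd_square\<close> applies.\<close>

lemma psd_iff_norm:
  "psd h \<longleftrightarrow> star h = h \<and> norm (norm h *\<^sub>R 1 - h) \<le> norm (h::'a::unital_cstar_algebra)"
proof
  assume "psd h"
  then obtain t where "star h = h" "norm (t *\<^sub>R 1 - h) \<le> t" by (auto simp: psd_def)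
  then obtain s where s: "psd s" "s * s = h" by (rule psd_sqrt)
  then have "norm h = (norm s)\<^sup>2" using norm_self_adjoint_square psd_self_adjoint by blast
  with s norm_psd_square[OF psd_self_adjoint[OF s(1)]] \<open>star h = h\<close>
  show "star h = h \<and> norm (norm h *\<^sub>R 1 - h) \<le> norm h" by simp
qed (auto simp: psd_def)

lemma psd_tendsto:
  assumes "F \<noteq> bot" "(f \<longlongrightarrow> h) F" "\<forall>\<^sub>F i in F. psd (f i)"
  shows "psd (h::'a::unital_cstar_algebra)"
proof -
  have "((\<lambda>i. star (f i)) \<longlongrightarrow> star h) F" by (intro tendsto_star assms)
  then have "(f \<longlongrightarrow> star h) F"
    by (rule Lim_transform_eventually) (use assms(3) in \<open>auto simp: psd_def elim: eventually_mono\<close>)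
  then have "star h = h" using assms tendsto_unique by blast
  moreover have "norm (norm h *\<^sub>R 1 - h) \<le> norm h"
  proof (rule tendsto_le[OF assms(1)])
    show "((\<lambda>i. norm (f i)) \<longlongrightarrow> norm h) F"
      "((\<lambda>i. norm (norm (f i) *\<^sub>R 1 - f i)) \<longlongrightarrow> norm (norm h *\<^sub>R 1 - h)) F"
      by (intro tendsto_intros assms)+
    show "\<forall>\<^sub>F i in F. norm (norm (f i) *\<^sub>R 1 - f i) \<le> norm (f i)"
      using assms(3) by (auto simp: psd_iff_norm elim: eventually_mono)
  qed
  ultimately show ?thesis by (simp add: psd_iff_norm)
qed

lemma psd_norm_minus: "star h = h \<Longrightarrow> psd (norm h *\<^sub>R 1 - (h::'a::unital_cstar_algebra))"
  unfolding psd_def by (auto simp: star_diff star_scaleR intro!: exI[of _ "norm h"])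

text \<open>Adding the positive element \<open>norm b\<close> - b to b - a gives a \<le>
  \<open>norm b\<close>, where both sides commute. Roots s of a and r of \<open>norm b\<close> - a
  then commute, and their squares add up to a scalar, so \<open>norm_le_of_squares\<close>
  applies.\<close>

lemma psd_norm_le:
  fixes a b :: "'a::unital_cstar_algebra"
  assumes "psd a" "psd (b - a)"
  shows "norm a \<le> norm b"
proof -
  have "star b = b" using assms by (metis diff_add_cancel psd_add psd_self_adjoint)
  then have "psd ((norm b *\<^sub>R 1 - b) + (b - a))" by (intro psd_add psd_norm_minus assms)
  then have c: "psd (norm b *\<^sub>R 1 - a)" by simp
  obtain s where s: "psd s" "s * s = a" "\<And>z. z * a = a * z \<Longrightarrow> z * s = s * z"
    using assms(1) psd_sqrt unfolding psd_def by metis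
  obtain r where r: "psd r" "r * r = norm b *\<^sub>R 1 - a"
    "\<And>z. z * (norm b *\<^sub>R 1 - a) = (norm b *\<^sub>R 1 - a) * z \<Longrightarrow> z * r = r * z"
    using c psd_sqrt unfolding psd_def by metis
  have "(norm b *\<^sub>R 1 - a) * s = s * (norm b *\<^sub>R 1 - a)" by (rule s(3)) (simp add: algebra_simps)
  then have "s * r = r * s" by (intro r(3)) simp
  then have "(norm s)\<^sup>2 \<le> norm b"
    using s(1,2) r(1,2) \<open>s * r = r * s\<close> by (intro norm_le_of_squares[of s r]) (auto simp: psd_self_adjoint)
  then show ?thesis using norm_self_adjoint_square[OF psd_self_adjoint[OF s(1)]] s(2) by simp
qed

lemma psd_antisym: "psd a \<Longrightarrow> psd (- a) \<Longrightarrow> (a::'a::unital_cstar_algebra) = 0"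
  using psd_norm_le[of a 0] by simp

section \<open>Kaplansky's theorem\<close>

lemma norm_self_adjoint_pow2:
  fixes y :: "'a::unital_cstar_algebra"
  assumes "star y = y"
  shows "norm (y ^ 2 ^ m) = norm y ^ 2 ^ m \<and> star (y ^ 2 ^ m) = y ^ 2 ^ m"
proof (induction m)
  case (Suc m)
  have "y ^ 2 ^ Suc m = y ^ 2 ^ m * y ^ 2 ^ m" by (simp flip: power_add add: mult_2)
  with Suc show ?case using norm_self_adjoint_square[of "y ^ 2 ^ m"]
    by (simp add: star_mult power_mult[symmetric] mult.commute)
qed (simp add: assms)

text \<open>For self-adjoint \<open>y = t + c c\<^sup>*\<close> the norm is the spectral radius, and \<open>y\<^sup>n\<close> grows
  like \<open>n t\<^sup>n\<close> since \<open>(c c\<^sup>*)\<^sup>n = c (c\<^sup>* c)\<^sup>n\<^sup>-\<^sup>1 c\<^sup>*\<close>.\<close>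

lemma psd_minus_swap:
  fixes c :: "'a::unital_cstar_algebra"
  assumes "psd (- (star c * c))"
  shows "psd (- (c * star c))"
proof -
  define t where "t = (norm c)\<^sup>2"
  define z where "z = t *\<^sub>R 1 + star c * c"
  define y where "y = t *\<^sub>R 1 + c * star c"
  have t0: "t \<ge> 0" by (simp add: t_def)
  have z: "norm z \<le> t" using assms cstar_identity[of c] unfolding psd_iff_norm z_def t_def by simp
  have sy: "star y = y" by (simp add: y_def star_add star_scaleR star_mult star_star)
  \<comment> \<open>Because y c = c z, multiplication by y turns q into t^n + z q. As
    \<open>norm z \<le> t\<close>, each multiplication adds at most one further t^n, whence the
    factor n. The bound is stated for t times \<open>norm q\<close> since the outer factors c and
    \<open>star c\<close> contribute (norm c)^2 = t.\<close>
  have pow: "\<exists>q. y ^ n = t ^ n *\<^sub>R 1 + c * q * star c \<and> t * norm q \<le> n * t ^ n" for n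
  proof (induction n)
    case 0
    then show ?case by (auto intro!: exI[of _ 0])
  next
    case (Suc n)
    then obtain q where q: "y ^ n = t ^ n *\<^sub>R 1 + c * q * star c" "t * norm q \<le> n * t ^ n" by auto
    let ?q = "t ^ n *\<^sub>R 1 + z * q"
    have "y ^ Suc n = t ^ Suc n *\<^sub>R 1 + c * ?q * star c"
      by (simp add: q(1)) (simp add: y_def z_def algebra_simps)
    moreover have "t * norm ?q \<le> Suc n * t ^ Suc n"
    proof -
      have "norm ?q \<le> t ^ n * 1 + t * norm q"
        using t0 z norm_one_le[where 'a='a]
        by (intro norm_triangle_le add_mono order_trans[OF norm_mult_ineq] mult_right_mono)
           (auto simp: mult_left_le)
      also have "\<dots> \<le> t ^ n + n * t ^ n" using q(2) by simp
      finally have "norm ?q \<le> Suc n * t ^ n" by (simp add: algebra_simps)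
      then have "t * norm ?q \<le> t * (Suc n * t ^ n)" by (rule mult_left_mono) (rule t0)
      then show ?thesis by (simp add: algebra_simps)
    qed
    ultimately show ?case by blast
  qed
  have pow': "norm (y ^ n) \<le> (n + 1) * t ^ n" for n
  proof -
    obtain q where q: "y ^ n = t ^ n *\<^sub>R 1 + c * q * star c" "t * norm q \<le> n * t ^ n" using pow by blast
    have "norm (c * q * star c) \<le> norm c * norm q * norm c"
      using norm_mult_ineq[of "c * q" "star c"] norm_mult_ineq[of c q]
      by (smt (verit, ccfv_SIG) mult_right_mono norm_ge_zero norm_star)
    also have "\<dots> = t * norm q" by (simp add: t_def power2_eq_square)
    finally have "norm (c * q * star c) \<le> n * t ^ n" using q by simp
    moreover have "norm (t ^ n *\<^sub>R (1::'a)) \<le> t ^ n"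
      using t0 norm_one_le[where 'a='a] by (simp add: mult_left_le)
    ultimately show ?thesis unfolding q(1) by (intro norm_triangle_le) (simp add: algebra_simps)
  qed
  have "norm y \<le> t"
  proof (rule ccontr)
    assume "\<not> norm y \<le> t"
    then have y: "norm y > t" "norm y > 0" using t0 by auto
    \<comment> \<open>Along n = 2^m the norm of y^n is exactly (norm y)^n, so \<open>pow'\<close>
      gives 1 \<le> (n + 1) x^n, while x < 1 sends the right side to 0.\<close>
    define x where "x = t / norm y"
    have x: "0 \<le> x" "x < 1" using y t0 by (auto simp: x_def)
    have "(\<lambda>n. real n * x ^ n) \<longlonglongrightarrow> 0"
      by (rule powser_times_n_limit_0) (use x in auto)
    moreover have "(\<lambda>n. x ^ n) \<longlonglongrightarrow> 0" by (rule LIMSEQ_realpow_zero) (use x in auto)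
    ultimately have "(\<lambda>n. real n * x ^ n + x ^ n) \<longlonglongrightarrow> 0 + 0" by (rule tendsto_add)
    then have "((\<lambda>n. real n * x ^ n + x ^ n) \<circ> (\<lambda>m. 2 ^ m)) \<longlonglongrightarrow> 0 + 0"
      by (rule LIMSEQ_subseq_LIMSEQ) (auto intro: strict_monoI)
    moreover have "1 \<le> ((\<lambda>n. real n * x ^ n + x ^ n) \<circ> (\<lambda>m. 2 ^ m)) m" for m
    proof -
      have "norm y ^ 2 ^ m \<le> (real (2 ^ m) + 1) * t ^ 2 ^ m"
        using pow'[of "2 ^ m"] norm_self_adjoint_pow2[OF sy, of m] by simp
      then have "1 \<le> (real (2 ^ m) + 1) * t ^ 2 ^ m / norm y ^ 2 ^ m"
        using y by (simp add: field_simps)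
      then show ?thesis by (simp add: x_def power_divide algebra_simps add_divide_distrib)
    qed
    ultimately have "1 \<le> 0 + (0::real)" by (intro LIMSEQ_le_const) auto
    then show False by simp
  qed
  moreover have "t *\<^sub>R 1 - (- (c * star c)) = y" by (simp add: y_def)
  ultimately show ?thesis unfolding psd_def by (metis star_minus star_mult star_star)
qed

text \<open>Up to sign, x and y are twice the real and imaginary parts of c; the terms c c and
  \<open>star c * star c\<close> cancel in x x + y y.\<close>

lemma psd_star_mult_add: "psd (star c * c + c * star (c::'a::unital_cstar_algebra))"
proof -
  define x where "x = c + star c"
  define y where "y = \<i> *\<^sub>C (c - star c)"
  have sx: "star x = x" by (simp add: x_def star_add star_star)
  have "star y = - (\<i> *\<^sub>C (star c - c))" by (simp add: y_def star_scaleC star_diff star_star scaleC_minus_left)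
  also have "\<dots> = y" unfolding y_def
    by (metis minus_diff_eq scaleC_minus_right)
  finally have sy: "star y = y" .
  have "y * y = - ((c - star c) * (c - star c))"
    unfolding y_def by (simp add: mult_scaleC_left mult_scaleC_right scaleC_scaleC)
  then have "x * x + y * y = 2 *\<^sub>R (star c * c + c * star c)"
    by (simp add: x_def algebra_simps scaleR_2)
  then have "star c * c + c * star c = (1/2) *\<^sub>R (x * x + y * y)" by simp
  then show ?thesis using psd_add[OF psd_square[OF sx] psd_square[OF sy]] psd_scaleR[of _ "1/2"] by simp
qed

text \<open>Kaplansky's theorem. With \<open>h = a\<^sup>* a\<close>, \<open>k = \<bar>h\<bar>\<close> and \<open>p = k - h\<close> (twice the negative part
  of \<open>h\<close>), the element \<open>c = a p\<close> satisfies \<open>c\<^sup>* c = - p k p \<le> 0\<close>, which forces \<open>c = 0\<close>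
  and then \<open>p = 0\<close>.\<close>

lemma psd_star_mult: "psd (star a * (a::'a::unital_cstar_algebra))"
proof -
  define h where "h = star a * a"
  have sh: "star h = h" by (simp add: h_def star_mult star_star)
  from psd_square[OF sh] obtain k where k: "psd k" "k * k = h * h"
    "\<And>z. z * (h * h) = (h * h) * z \<Longrightarrow> z * k = k * z"
    using psd_sqrt unfolding psd_def[of "h * h"] by metis
  \<comment> \<open>A root of k that commutes with p turns p k p into the square of the self-adjoint
    element r p.\<close>
  from k(1) obtain r where r: "psd r" "r * r = k" "\<And>z. z * k = k * z \<Longrightarrow> z * r = r * z"
    using psd_sqrt unfolding psd_def[of k] by metis
  have hk: "h * k = k * h" by (rule k(3)) (simp add: mult.assoc)
  have hr: "h * r = r * h" by (rule r(3)[OF hk])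
  have kr: "k * r = r * k" by (rule r(3)) simp
  define p where "p = k - h"
  have sp: "star p = p" using sh psd_self_adjoint[OF k(1)] by (simp add: p_def star_diff)
  have pr: "p * r = r * p" by (simp add: p_def algebra_simps hr kr)
  have hp: "h * p = - (k * p)" by (simp add: p_def algebra_simps k(2) hk)
  have srp: "star (r * p) = r * p" by (simp add: star_mult sp psd_self_adjoint[OF r(1)] pr)
  define c where "c = a * p"
  have "star c * c = p * (h * p)" by (simp add: c_def star_mult sp h_def mult.assoc)
  also have "\<dots> = - (p * r * (r * p))" by (simp add: hp mult.assoc flip: r(2))
  finally have cc: "star c * c = - (r * p * (r * p))" by (simp add: pr)
  have "psd (- (star c * c))" using psd_square[OF srp] by (simp add: cc)
  \<comment> \<open>By \<open>psd_minus_swap\<close> also -(c \<open>star c\<close>) is positive;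
    adding it to the positive element of \<open>psd_star_mult_add\<close> leaves
    \<open>star c * c\<close>, which is therefore both positive and negative.\<close>
  moreover have "psd (star c * c)"
    using psd_add[OF psd_star_mult_add[of c] psd_minus_swap[OF calculation]] by simp
  ultimately have "star c * c = 0" by (simp add: psd_antisym)
  \<comment> \<open>From r p = 0 follows k p = r (r p) = 0, hence h p = -k p = 0 and p p = k p - h p
    = 0.\<close>
  then have "norm (r * p) = 0" using norm_self_adjoint_square[OF srp] cc by simp
  then have "k * p = 0" by (simp flip: r(2) add: mult.assoc)
  then have "p * p = 0" using hp by (subst (1) p_def) (simp add: algebra_simps)
  then have "p = 0" using norm_self_adjoint_square[OF sp] by simp
  then show ?thesis using k(1) by (simp add: p_def h_def)
qed

text \<open>The two descriptions complement each other: the factorization gives stability under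
  conjugation (\<open>psd_conj\<close>), the norm condition gives stability under sums and
  limits.\<close>

lemma cstar_positive_iff_psd: "cstar_positive a \<longleftrightarrow> psd a"
proof
  assume "psd a"
  then obtain s where "psd s" "s * s = a" using psd_sqrt unfolding psd_def[of a] by metis
  then show "cstar_positive a" unfolding cstar_positive_def by (metis psd_self_adjoint)
qed (auto simp: cstar_positive_def psd_star_mult)

lemma psd_conj: "psd a \<Longrightarrow> psd (star x * a * x)"
  by (metis cstar_positive_def cstar_positive_iff_psd star_mult mult.assoc)

lemma psd_mult_star: "psd (a * star a)"
  using psd_star_mult[of "star a"] by (simp add: star_star)

section \<open>Modules with a semi-inner product and their completions\<close>

text \<open>A common interface for formal tensors, the algebraic limit, completions, and the
  modified inner products of \<open>parseval_dense\<close>, where null vectors may occur. The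
  additive inverse is fixed as scaling by -1 to match \<open>hdiff\<close>.\<close>

locale semi_hilbert =
  fixes X :: "('a::unital_cstar_algebra, 'x, 'r) hmodule_scheme"
  assumes zero_closed: "hzero X \<in> hcarrier X"
    and add_closed: "\<lbrakk>x \<in> hcarrier X; y \<in> hcarrier X\<rbrakk> \<Longrightarrow> hadd X x y \<in> hcarrier X"
    and scale_closed: "x \<in> hcarrier X \<Longrightarrow> hscale X x a \<in> hcarrier X"
    and add_assoc: "\<lbrakk>x \<in> hcarrier X; y \<in> hcarrier X; z \<in> hcarrier X\<rbrakk>
      \<Longrightarrow> hadd X (hadd X x y) z = hadd X x (hadd X y z)"
    and add_commute: "\<lbrakk>x \<in> hcarrier X; y \<in> hcarrier X\<rbrakk> \<Longrightarrow> hadd X x y = hadd X y x"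
    and add_zero: "x \<in> hcarrier X \<Longrightarrow> hadd X x (hzero X) = x"
    and add_neg: "x \<in> hcarrier X \<Longrightarrow> hadd X x (hscale X x (- 1)) = hzero X"
    and scale_add_left: "\<lbrakk>x \<in> hcarrier X; y \<in> hcarrier X\<rbrakk>
      \<Longrightarrow> hscale X (hadd X x y) a = hadd X (hscale X x a) (hscale X y a)"
    and scale_add_right: "x \<in> hcarrier X
      \<Longrightarrow> hscale X x (a + b) = hadd X (hscale X x a) (hscale X x b)"
    and scale_mult: "x \<in> hcarrier X \<Longrightarrow> hscale X x (a * b) = hscale X (hscale X x a) b"
    and scale_one: "x \<in> hcarrier X \<Longrightarrow> hscale X x 1 = x"
    and inner_add_right: "\<lbrakk>x \<in> hcarrier X; y \<in> hcarrier X; z \<in> hcarrier X\<rbrakk>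
      \<Longrightarrow> hinner X x (hadd X y z) = hinner X x y + hinner X x z"
    and inner_scale_right: "\<lbrakk>x \<in> hcarrier X; y \<in> hcarrier X\<rbrakk>
      \<Longrightarrow> hinner X x (hscale X y a) = hinner X x y * a"
    and star_inner: "\<lbrakk>x \<in> hcarrier X; y \<in> hcarrier X\<rbrakk> \<Longrightarrow> star (hinner X x y) = hinner X y x"
    and inner_psd: "x \<in> hcarrier X \<Longrightarrow> psd (hinner X x x)"

abbreviation hdist ::
    "('a::unital_cstar_algebra, 'x, 'r) hmodule_scheme \<Rightarrow> 'x \<Rightarrow> 'x \<Rightarrow> real" where
  "hdist X x y \<equiv> hnorm X (hdiff X x y)"

lemma (in hilbert_module) scale_zero: "x \<in> hcarrier X \<Longrightarrow> hscale X x 0 = hzero X"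
proof -
  assume x: "x \<in> hcarrier X"
  let ?z = "hscale X x 0"
  have z: "?z \<in> hcarrier X" and zz: "hadd X ?z ?z = ?z"
    using x scale_closed scale_add_right[of x 0 0] by auto
  then obtain w where "w \<in> hcarrier X" "hadd X ?z w = hzero X" using add_inverse by blast
  then show ?thesis using z zz add_assoc[of ?z ?z w] add_zero by metis
qed

lemma (in hilbert_module) semi_hilbert: "semi_hilbert X"
proof
  show "hadd X x (hscale X x (- 1)) = hzero X" if "x \<in> hcarrier X" for x
    using scale_add_right[OF that, of 1 "-1"] scale_zero[OF that] scale_one[OF that] by simp
qed (fact zero_closed add_closed scale_closed add_assoc add_commute add_zero scale_add_left
      scale_add_right scale_mult scale_one inner_add_right inner_scale_right star_inner
      inner_positive[unfolded cstar_positive_iff_psd])+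

lemma tendsto_zero_le:
  fixes f g :: "nat \<Rightarrow> real"
  assumes "g \<longlonglongrightarrow> 0" "\<And>n. 0 \<le> f n" "\<And>n. f n \<le> g n"
  shows "f \<longlonglongrightarrow> 0"
  using tendsto_sandwich[OF always_eventually always_eventually tendsto_const assms(1)] assms(2,3) by blast

context semi_hilbert
begin

lemma diff_closed: "\<lbrakk>x \<in> hcarrier X; y \<in> hcarrier X\<rbrakk> \<Longrightarrow> hdiff X x y \<in> hcarrier X"
  by (simp add: hdiff_def add_closed scale_closed)

lemma inner_add_left: "\<lbrakk>x \<in> hcarrier X; y \<in> hcarrier X; z \<in> hcarrier X\<rbrakk>
    \<Longrightarrow> hinner X (hadd X x y) z = hinner X x z + hinner X y z"
  by (simp add: star_inner[of z, symmetric] add_closed inner_add_right star_add)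

lemma inner_scale_left: "\<lbrakk>x \<in> hcarrier X; y \<in> hcarrier X\<rbrakk>
    \<Longrightarrow> hinner X (hscale X x a) y = star a * hinner X x y"
  by (simp add: star_inner[of y, symmetric] scale_closed inner_scale_right star_mult)

lemma inner_diff_right: "\<lbrakk>x \<in> hcarrier X; y \<in> hcarrier X; z \<in> hcarrier X\<rbrakk>
    \<Longrightarrow> hinner X x (hdiff X y z) = hinner X x y - hinner X x z"
  by (simp add: hdiff_def inner_add_right inner_scale_right scale_closed)

lemma inner_diff_left: "\<lbrakk>x \<in> hcarrier X; y \<in> hcarrier X; z \<in> hcarrier X\<rbrakk>
    \<Longrightarrow> hinner X (hdiff X x y) z = hinner X x z - hinner X y z"
  by (simp add: hdiff_def inner_add_left inner_scale_left scale_closed star_minus)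

lemma inner_zero_right [simp]: "x \<in> hcarrier X \<Longrightarrow> hinner X x (hzero X) = 0"
  by (metis add_cancel_right_right add_zero inner_add_right zero_closed)

lemma inner_zero_left [simp]: "x \<in> hcarrier X \<Longrightarrow> hinner X (hzero X) x = 0"
  by (metis inner_zero_right star_inner star_zero zero_closed)

lemmas inner_simps = inner_add_left inner_add_right inner_scale_left inner_scale_right
  inner_diff_left inner_diff_right
lemmas closed_simps = zero_closed add_closed scale_closed diff_closed

section \<open>The seminorm of a semi-inner product\<close>

lemma hnorm_nonneg [simp]: "0 \<le> hnorm X x"
  by (simp add: hnorm_def)

lemma hnorm_square: "(hnorm X x)\<^sup>2 = norm (hinner X x x)"
  by (simp add: hnorm_def)

text \<open>The test vector is z = x t b - y with b = \<langle>x, y\<rangle> and t = 1/N, where N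
  \<ge> \<langle>x, x\<rangle>. Replacing \<langle>x, x\<rangle> by N in \<langle>z, z\<rangle>
  \<ge> 0 leaves t b* b \<le> \<langle>y, y\<rangle>, and \<open>psd_norm_le\<close> passes to
  norms. The summand e keeps N invertible when x is a null vector; it is removed at the end.\<close>

lemma cauchy_schwarz:
  assumes x: "x \<in> hcarrier X" and y: "y \<in> hcarrier X"
  shows "norm (hinner X x y) \<le> hnorm X x * hnorm X y"
proof -
  define b where "b = hinner X x y"
  define A where "A = norm (hinner X x x)"
  define C where "C = norm (hinner X y y)"
  have eps: "(norm b)\<^sup>2 \<le> (A + e) * C" if "e > 0" for e
  proof -
    define N where "N = A + e"
    define t where "t = 1 / N"
    have N: "N > 0" using that by (simp add: N_def A_def add_nonneg_pos)
    have tN: "t > 0" "t * N = 1" using N by (auto simp: t_def)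
    define z where "z = hdiff X (hscale X x (t *\<^sub>R b)) y"
    have yx: "hinner X y x = star b" by (simp add: b_def star_inner x y)
    have "hinner X z z = (t * t) *\<^sub>R (star b * hinner X x x * b) - (2 * t) *\<^sub>R (star b * b) + hinner X y y"
      unfolding z_def
      by (simp add: inner_simps closed_simps x y yx star_scaleR algebra_simps scaleR_2
          flip: b_def scaleR_scaleR)
    moreover have "psd (hinner X z z)" unfolding z_def by (intro inner_psd closed_simps x y)
    ultimately have 1: "psd ((t * t) *\<^sub>R (star b * hinner X x x * b) - (2 * t) *\<^sub>R (star b * b) + hinner X y y)"
      by simp
    have "psd ((A *\<^sub>R 1 - hinner X x x) + e *\<^sub>R (star 1 * 1))"
      unfolding A_def using that
      by (intro psd_add psd_norm_minus psd_scaleR psd_star_mult) (auto simp: star_inner x)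
    then have "psd (N *\<^sub>R 1 - hinner X x x)" by (simp add: N_def algebra_simps)
    then have "psd ((t * t) *\<^sub>R (star b * (N *\<^sub>R 1 - hinner X x x) * b))"
      by (intro psd_scaleR psd_conj) auto
    also have "(t * t) *\<^sub>R (star b * (N *\<^sub>R 1 - hinner X x x) * b)
        = (t * (t * N)) *\<^sub>R (star b * b) - (t * t) *\<^sub>R (star b * hinner X x x * b)"
      by (simp add: algebra_simps)
    finally have "psd (t *\<^sub>R (star b * b) - (t * t) *\<^sub>R (star b * hinner X x x * b))"
      using tN by simp
    from psd_add[OF 1 this] have "psd (hinner X y y - t *\<^sub>R (star b * b))"
      by (simp add: algebra_simps scaleR_2 flip: scaleR_scaleR)
    moreover have "psd (t *\<^sub>R (star b * b))" using tN by (intro psd_scaleR psd_star_mult) auto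
    ultimately have "norm (t *\<^sub>R (star b * b)) \<le> C"
      unfolding C_def by (rule psd_norm_le[rotated])
    then have "t * (norm b)\<^sup>2 \<le> C" using tN by (simp add: cstar_identity)
    then have "N * (t * (norm b)\<^sup>2) \<le> N * C" using N by simp
    then show ?thesis using tN(2) unfolding N_def[symmetric] by (metis mult.assoc mult.commute mult_1)
  qed
  have "(norm b)\<^sup>2 \<le> A * C"
  proof (cases "C = 0")
    case True
    then show ?thesis using eps[of 1] by simp
  next
    case False
    then have C: "C > 0" by (simp add: C_def)
    show ?thesis
    proof (rule field_le_epsilon)
      fix d :: real assume "d > 0"
      moreover have "(A + d / C) * C = A * C + d" using C by (simp add: field_simps)
      ultimately show "(norm b)\<^sup>2 \<le> A * C + d" using eps[of "d / C"] C by simp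
    qed
  qed
  then have "(norm b)\<^sup>2 \<le> (hnorm X x * hnorm X y)\<^sup>2"
    by (simp add: power_mult_distrib hnorm_square A_def C_def)
  then show ?thesis unfolding b_def by (rule power2_le_imp_le) simp
qed

lemma hnorm_triangle:
  assumes "x \<in> hcarrier X" "y \<in> hcarrier X"
  shows "hnorm X (hadd X x y) \<le> hnorm X x + hnorm X y"
proof (rule power2_le_imp_le)
  have "hinner X (hadd X x y) (hadd X x y)
      = hinner X x x + hinner X x y + (hinner X y x + hinner X y y)"
    using assms by (simp add: inner_simps closed_simps)
  then have "(hnorm X (hadd X x y))\<^sup>2
      \<le> norm (hinner X x x) + norm (hinner X x y) + (norm (hinner X y x) + norm (hinner X y y))"
    unfolding hnorm_square by (simp add: norm_triangle_le add_mono norm_triangle_ineq)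
  also have "\<dots> \<le> (hnorm X x + hnorm X y)\<^sup>2"
    using cauchy_schwarz[OF assms] cauchy_schwarz[OF assms(2,1)]
    unfolding power2_sum hnorm_square by (simp add: mult_ac)
  finally show "(hnorm X (hadd X x y))\<^sup>2 \<le> (hnorm X x + hnorm X y)\<^sup>2" .
qed simp

lemma hnorm_scale:
  assumes "x \<in> hcarrier X"
  shows "hnorm X (hscale X x a) \<le> hnorm X x * norm a"
proof (rule power2_le_imp_le)
  have "norm (star a * hinner X x x * a) \<le> norm a * norm (hinner X x x) * norm a"
    using norm_mult_ineq[of "star a * hinner X x x" a] norm_mult_ineq[of "star a" "hinner X x x"]
    by (smt (verit) mult_right_mono norm_ge_zero norm_star)
  then show "(hnorm X (hscale X x a))\<^sup>2 \<le> (hnorm X x * norm a)\<^sup>2"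
    using assms unfolding hnorm_square power_mult_distrib
    by (simp add: inner_simps closed_simps power2_eq_square mult_ac)
qed simp

text \<open>Vectors with the same inner products have the same norm, so the axioms of a vector space are
  not needed for the next identities.\<close>

lemma hdist_self [simp]: "x \<in> hcarrier X \<Longrightarrow> hdist X x x = 0"
  by (simp add: hnorm_def inner_simps closed_simps)

lemma hdist_commute: "\<lbrakk>x \<in> hcarrier X; y \<in> hcarrier X\<rbrakk> \<Longrightarrow> hdist X x y = hdist X y x"
  by (simp add: hnorm_def inner_simps closed_simps algebra_simps)

lemma hdist_triangle:
  assumes "x \<in> hcarrier X" "y \<in> hcarrier X" "z \<in> hcarrier X"
  shows "hdist X x z \<le> hdist X x y + hdist X y z"
proof -
  have "hdist X x z = hnorm X (hadd X (hdiff X x y) (hdiff X y z))"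
    using assms by (simp add: hnorm_def inner_simps closed_simps algebra_simps)
  also have "\<dots> \<le> hdist X x y + hdist X y z" by (intro hnorm_triangle closed_simps assms)
  finally show ?thesis .
qed

lemma hdist_add:
  assumes "x \<in> hcarrier X" "y \<in> hcarrier X" "x' \<in> hcarrier X" "y' \<in> hcarrier X"
  shows "hdist X (hadd X x y) (hadd X x' y') \<le> hdist X x x' + hdist X y y'"
proof -
  have "hdist X (hadd X x y) (hadd X x' y') = hnorm X (hadd X (hdiff X x x') (hdiff X y y'))"
    using assms by (simp add: hnorm_def inner_simps closed_simps algebra_simps)
  also have "\<dots> \<le> hdist X x x' + hdist X y y'" by (intro hnorm_triangle closed_simps assms)
  finally show ?thesis .
qed

lemma hdist_scale:
  assumes "x \<in> hcarrier X" "x' \<in> hcarrier X"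
  shows "hdist X (hscale X x a) (hscale X x' a) \<le> hdist X x x' * norm a"
proof -
  have "hdist X (hscale X x a) (hscale X x' a) = hnorm X (hscale X (hdiff X x x') a)"
    using assms by (simp add: hnorm_def inner_simps closed_simps algebra_simps)
  also have "\<dots> \<le> hdist X x x' * norm a" by (intro hnorm_scale closed_simps assms)
  finally show ?thesis .
qed

lemma hnorm_le_add_hdist:
  assumes "x \<in> hcarrier X" "y \<in> hcarrier X"
  shows "hnorm X x \<le> hnorm X y + hdist X x y"
proof -
  have "hnorm X x = hnorm X (hadd X y (hdiff X x y))"
    using assms by (simp add: hnorm_def inner_simps closed_simps algebra_simps)
  then show ?thesis using hnorm_triangle[OF assms(2) diff_closed[OF assms]] by simp
qed

lemma inner_diff_bound:
  assumes "x \<in> hcarrier X" "y \<in> hcarrier X" "x' \<in> hcarrier X" "y' \<in> hcarrier X"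
  shows "norm (hinner X x y - hinner X x' y') \<le> hdist X x x' * hnorm X y + hnorm X x' * hdist X y y'"
proof -
  have "hinner X x y - hinner X x' y' = hinner X (hdiff X x x') y + hinner X x' (hdiff X y y')"
    using assms by (simp add: inner_simps)
  also have "norm \<dots> \<le> hdist X x x' * hnorm X y + hnorm X x' * hdist X y y'"
    by (intro norm_triangle_le add_mono cauchy_schwarz closed_simps assms)
  finally show ?thesis .
qed

lemma hconverges_hnorm_tendsto:
  assumes "\<And>n. s n \<in> hcarrier X" "x \<in> hcarrier X" "hconverges X s x"
  shows "(\<lambda>n. hnorm X (s n)) \<longlonglongrightarrow> hnorm X x"
proof (rule LIM_zero_cancel, rule Lim_null_comparison)
  show "\<forall>\<^sub>F n in sequentially. norm (hnorm X (s n) - hnorm X x) \<le> hdist X (s n) x"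
    using hnorm_le_add_hdist[OF assms(1) assms(2)] hnorm_le_add_hdist[OF assms(2) assms(1)]
      hdist_commute[OF assms(1) assms(2)]
    by (intro always_eventually allI) (smt (verit) real_norm_def)
qed (use assms(3) in \<open>simp add: hconverges_def\<close>)

lemma hconverges_inner_tendsto:
  assumes s: "\<And>n. s n \<in> hcarrier X" "x \<in> hcarrier X" "hconverges X s x"
    and t: "\<And>n. t n \<in> hcarrier X" "y \<in> hcarrier X" "hconverges X t y"
  shows "(\<lambda>n. hinner X (s n) (t n)) \<longlonglongrightarrow> hinner X x y"
proof (rule LIM_zero_cancel, rule Lim_null_comparison)
  show "\<forall>\<^sub>F n in sequentially. norm (hinner X (s n) (t n) - hinner X x y)
      \<le> hdist X (s n) x * hnorm X (t n) + hnorm X x * hdist X (t n) y"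
    using inner_diff_bound s t by auto
  have "(\<lambda>n. hdist X (s n) x * hnorm X (t n) + hnorm X x * hdist X (t n) y)
      \<longlonglongrightarrow> 0 * hnorm X y + hnorm X x * 0"
    using s t hconverges_hnorm_tendsto[OF t] unfolding hconverges_def by (intro tendsto_intros)
  then show "(\<lambda>n. hdist X (s n) x * hnorm X (t n) + hnorm X x * hdist X (t n) y) \<longlonglongrightarrow> 0" by simp
qed

section \<open>Cauchy sequences in a semi-Hilbert module\<close>

lemma hCauchy_closed: "hCauchy X s \<Longrightarrow> s n \<in> hcarrier X"
  by (simp add: hCauchy_def)

lemma hCauchy_const: "x \<in> hcarrier X \<Longrightarrow> hCauchy X (\<lambda>n. x)"
  by (simp add: hCauchy_def)

lemma hCauchyD: "hCauchy X s \<Longrightarrow> e > 0 \<Longrightarrow> \<exists>N. \<forall>i\<ge>N. \<forall>j\<ge>N. hdist X (s i) (s j) < e"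
  by (simp add: hCauchy_def)

lemma hCauchy_add:
  assumes s: "hCauchy X s" and t: "hCauchy X t"
  shows "hCauchy X (\<lambda>n. hadd X (s n) (t n))"
  unfolding hCauchy_def
proof (intro conjI allI impI)
  show "hadd X (s n) (t n) \<in> hcarrier X" for n
    by (intro closed_simps hCauchy_closed s t)
  fix e :: real assume "e > 0"
  then obtain M N where MN: "\<forall>i\<ge>M. \<forall>j\<ge>M. hdist X (s i) (s j) < e / 2"
    "\<forall>i\<ge>N. \<forall>j\<ge>N. hdist X (t i) (t j) < e / 2"
    using hCauchyD[OF s, of "e / 2"] hCauchyD[OF t, of "e / 2"] by auto
  show "\<exists>N. \<forall>i\<ge>N. \<forall>j\<ge>N. hdist X (hadd X (s i) (t i)) (hadd X (s j) (t j)) < e"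
  proof (intro exI allI impI)
    fix i j assume "max M N \<le> i" "max M N \<le> j"
    with MN have "hdist X (s i) (s j) < e / 2" "hdist X (t i) (t j) < e / 2" by auto
    with hdist_add[of "s i" "t i" "s j" "t j"] s t
    show "hdist X (hadd X (s i) (t i)) (hadd X (s j) (t j)) < e" by (simp add: hCauchy_closed)
  qed
qed

lemma hCauchy_scale:
  assumes s: "hCauchy X s"
  shows "hCauchy X (\<lambda>n. hscale X (s n) a)"
  unfolding hCauchy_def
proof (intro conjI allI impI)
  show "hscale X (s n) a \<in> hcarrier X" for n
    by (intro closed_simps hCauchy_closed s)
  fix e :: real assume e: "e > 0"
  define K where "K = norm a + 1"
  have K: "K > 0" "norm a \<le> K" by (auto simp: K_def add_nonneg_pos)
  obtain N where N: "\<forall>i\<ge>N. \<forall>j\<ge>N. hdist X (s i) (s j) < e / K"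
    using hCauchyD[OF s, of "e / K"] e K by auto
  show "\<exists>N. \<forall>i\<ge>N. \<forall>j\<ge>N. hdist X (hscale X (s i) a) (hscale X (s j) a) < e"
  proof (intro exI allI impI)
    fix i j assume "N \<le> i" "N \<le> j"
    with N have "hdist X (s i) (s j) < e / K" by auto
    then have "hdist X (s i) (s j) * K < e" using K by (simp add: field_simps)
    moreover have "hdist X (s i) (s j) * norm a \<le> hdist X (s i) (s j) * K"
      using K by (intro mult_left_mono) auto
    ultimately show "hdist X (hscale X (s i) a) (hscale X (s j) a) < e"
      using hdist_scale[of "s i" "s j" a] s by (simp add: hCauchy_closed)
  qed
qed

lemma hCauchy_diff: "hCauchy X s \<Longrightarrow> hCauchy X t \<Longrightarrow> hCauchy X (\<lambda>n. hdiff X (s n) (t n))"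
  unfolding hdiff_def by (intro hCauchy_add hCauchy_scale)

lemma hCauchy_bounded:
  assumes "hCauchy X s"
  obtains K where "\<And>n. hnorm X (s n) \<le> K" "K > 0"
proof -
  obtain N where N: "\<forall>i\<ge>N. \<forall>j\<ge>N. hdist X (s i) (s j) < 1" using hCauchyD[OF assms, of 1] by auto
  define K where "K = Max ((\<lambda>n. hnorm X (s n)) ` {..N}) + 1"
  have *: "hnorm X (s n) \<le> K - 1" if "n \<le> N" for n
    unfolding K_def using that by auto
  have "hnorm X (s n) \<le> K" for n
  proof (cases "n \<le> N")
    case False
    then have "hnorm X (s n) \<le> hnorm X (s N) + 1"
      using hnorm_le_add_hdist[of "s n" "s N"] N[rule_format, of n N] assms by (simp add: hCauchy_closed)
    then show ?thesis using *[of N] by simp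
  qed (use * in force)
  moreover have "K > 0" using *[of 0] hnorm_nonneg[of "s 0"] by linarith
  ultimately show thesis by (rule that)
qed

lemma hCauchy_inner_convergent:
  assumes s: "hCauchy X s" and t: "hCauchy X t"
  shows "convergent (\<lambda>n. hinner X (s n) (t n))"
proof -
  obtain K L where K: "\<And>n. hnorm X (s n) \<le> K" "K > 0" and L: "\<And>n. hnorm X (t n) \<le> L" "L > 0"
    using hCauchy_bounded s t by metis
  have "Cauchy (\<lambda>n. hinner X (s n) (t n))"
  proof (rule CauchyI)
    fix e :: real assume e: "e > 0"
    have "e / (2 * L) > 0" "e / (2 * K) > 0" using e K L by auto
    then obtain M N where MN: "\<forall>i\<ge>M. \<forall>j\<ge>M. hdist X (s i) (s j) < e / (2 * L)"
      "\<forall>i\<ge>N. \<forall>j\<ge>N. hdist X (t i) (t j) < e / (2 * K)"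
      using hCauchyD[OF s] hCauchyD[OF t] by meson
    show "\<exists>M. \<forall>m\<ge>M. \<forall>n\<ge>M. norm (hinner X (s m) (t m) - hinner X (s n) (t n)) < e"
    proof (intro exI allI impI)
      fix i j assume ij: "max M N \<le> i" "max M N \<le> j"
      have "norm (hinner X (s i) (t i) - hinner X (s j) (t j))
          \<le> hdist X (s i) (s j) * hnorm X (t i) + hnorm X (s j) * hdist X (t i) (t j)"
        by (intro inner_diff_bound hCauchy_closed s t)
      also have "\<dots> \<le> hdist X (s i) (s j) * L + K * hdist X (t i) (t j)"
        by (intro add_mono mult_left_mono mult_right_mono K L) auto
      also have "\<dots> < e / (2 * L) * L + K * (e / (2 * K))"
        using MN ij K(2) L(2) by (intro add_strict_mono mult_strict_left_mono mult_strict_right_mono) auto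
      also have "\<dots> = e" using K L by simp
      finally show "norm (hinner X (s i) (t i) - hinner X (s j) (t j)) < e" .
    qed
  qed
  then show ?thesis by (simp add: Cauchy_convergent)
qed

section \<open>The completion as a set of classes of Cauchy sequences\<close>

lemma completion_rel_iff:
  "(s, t) \<in> completion_rel X \<longleftrightarrow> hCauchy X s \<and> hCauchy X t \<and> (\<lambda>n. hdist X (s n) (t n)) \<longlonglongrightarrow> 0"
  by (simp add: completion_rel_def)

lemma equiv_completion_rel: "equiv {s. hCauchy X s} (completion_rel X)"
proof (rule equivI)
  show "completion_rel X \<subseteq> {s. hCauchy X s} \<times> {s. hCauchy X s}"
    by (auto simp: completion_rel_iff)
  show "refl_on {s. hCauchy X s} (completion_rel X)"
    by (auto simp: refl_on_def completion_rel_iff hCauchy_closed)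
  show "sym (completion_rel X)"
  proof (rule symI)
    fix s t assume *: "(s, t) \<in> completion_rel X"
    then have "hdist X (t n) (s n) = hdist X (s n) (t n)" for n
      by (auto simp: completion_rel_iff hCauchy_closed intro: hdist_commute)
    with * show "(t, s) \<in> completion_rel X" by (auto simp: completion_rel_iff)
  qed
  show "trans (completion_rel X)"
  proof (rule transI)
    fix s t u assume st: "(s, t) \<in> completion_rel X" and tu: "(t, u) \<in> completion_rel X"
    then have "hdist X (s n) (u n) \<le> hdist X (s n) (t n) + hdist X (t n) (u n)" for n
      by (auto simp: completion_rel_iff hCauchy_closed intro: hdist_triangle)
    moreover have "(\<lambda>n. hdist X (s n) (t n) + hdist X (t n) (u n)) \<longlonglongrightarrow> 0 + 0"
      using st tu by (intro tendsto_add) (auto simp: completion_rel_iff)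
    ultimately have "(\<lambda>n. hdist X (s n) (u n)) \<longlonglongrightarrow> 0"
      by (rule_tac tendsto_zero_le[where g = "\<lambda>n. hdist X (s n) (t n) + hdist X (t n) (u n)"]) simp_all
    with st tu show "(s, u) \<in> completion_rel X" by (auto simp: completion_rel_iff)
  qed
qed

abbreviation cls :: "(nat \<Rightarrow> 'x) \<Rightarrow> (nat \<Rightarrow> 'x) set" where
  "cls s \<equiv> completion_rel X `` {s}"

lemma cls_eq_iff: "hCauchy X s \<Longrightarrow> hCauchy X t \<Longrightarrow> cls s = cls t \<longleftrightarrow> (\<lambda>n. hdist X (s n) (t n)) \<longlonglongrightarrow> 0"
  using eq_equiv_class_iff[OF equiv_completion_rel, of s t] by (simp add: completion_rel_iff)

lemma mem_cls: "t \<in> cls s \<longleftrightarrow> hCauchy X s \<and> hCauchy X t \<and> (\<lambda>n. hdist X (s n) (t n)) \<longlonglongrightarrow> 0"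
  by (simp add: completion_rel_iff)

lemma self_mem_cls: "hCauchy X s \<Longrightarrow> s \<in> cls s"
  by (simp add: completion_rel_iff hCauchy_closed)

lemma cls_eqI: "t \<in> cls s \<Longrightarrow> cls t = cls s"
  using equiv_class_eq[OF equiv_completion_rel, of s t] by blast

lemma completion_carrier: "hcarrier (completion X) = {cls s | s. hCauchy X s}"
  by (auto simp: completion_def quotient_def)

lemma completion_carrierE:
  assumes "P \<in> hcarrier (completion X)"
  obtains s where "hCauchy X s" "P = cls s"
  using assms by (auto simp: completion_carrier)

lemma cls_closed: "hCauchy X s \<Longrightarrow> cls s \<in> hcarrier (completion X)"
  by (auto simp: completion_carrier)

lemma completion_zero: "hzero (completion X) = cls (\<lambda>n. hzero X)"
  by (simp add: completion_def)

text \<open>All members of the union in the definition coincide, because equivalent representatives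
  give equivalent sums; the union is over nonempty classes, so it collapses to that one class. The
  same pattern recurs for \<open>hscale\<close>, \<open>extension\<close> and the direct
  limit.\<close>

lemma completion_add:
  assumes s: "hCauchy X s" and t: "hCauchy X t"
  shows "hadd (completion X) (cls s) (cls t) = cls (\<lambda>n. hadd X (s n) (t n))"
proof -
  have *: "cls (\<lambda>n. hadd X (s' n) (t' n)) = cls (\<lambda>n. hadd X (s n) (t n))"
    if "s' \<in> cls s" "t' \<in> cls t" for s' t'
  proof (rule cls_eqI, unfold mem_cls, intro conjI hCauchy_add)
    have "(\<lambda>n. hdist X (s n) (s' n) + hdist X (t n) (t' n)) \<longlonglongrightarrow> 0 + 0"
      using that by (intro tendsto_add) (auto simp: completion_rel_iff)
    then show "(\<lambda>n. hdist X (hadd X (s n) (t n)) (hadd X (s' n) (t' n))) \<longlonglongrightarrow> 0"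
      using that
      by (rule_tac tendsto_zero_le[where g = "\<lambda>n. hdist X (s n) (s' n) + hdist X (t n) (t' n)"])
        (simp_all add: completion_rel_iff hCauchy_closed hdist_add)
  qed (use that in \<open>auto simp: completion_rel_iff\<close>)
  have "hadd (completion X) (cls s) (cls t)
      = (\<Union>s'\<in>cls s. \<Union>t'\<in>cls t. cls (\<lambda>n. hadd X (s' n) (t' n)))"
    by (simp add: completion_def)
  also have "\<dots> = (\<Union>s'\<in>cls s. \<Union>t'\<in>cls t. cls (\<lambda>n. hadd X (s n) (t n)))"
    by (intro SUP_cong refl *)
  also have "\<dots> = cls (\<lambda>n. hadd X (s n) (t n))" using self_mem_cls[OF s] self_mem_cls[OF t] by blast
  finally show ?thesis .
qed

lemma completion_scale:
  assumes s: "hCauchy X s"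
  shows "hscale (completion X) (cls s) a = cls (\<lambda>n. hscale X (s n) a)"
proof -
  have *: "cls (\<lambda>n. hscale X (s' n) a) = cls (\<lambda>n. hscale X (s n) a)" if "s' \<in> cls s" for s'
  proof (rule cls_eqI, unfold mem_cls, intro conjI hCauchy_scale)
    have "(\<lambda>n. hdist X (s n) (s' n) * norm a) \<longlonglongrightarrow> 0 * norm a"
      using that by (intro tendsto_mult tendsto_const) (auto simp: completion_rel_iff)
    then show "(\<lambda>n. hdist X (hscale X (s n) a) (hscale X (s' n) a)) \<longlonglongrightarrow> 0"
      using that
      by (rule_tac tendsto_zero_le[where g = "\<lambda>n. hdist X (s n) (s' n) * norm a"])
        (simp_all add: completion_rel_iff hCauchy_closed hdist_scale)
  qed (use that in \<open>auto simp: completion_rel_iff\<close>)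
  have "hscale (completion X) (cls s) a = (\<Union>s'\<in>cls s. cls (\<lambda>n. hscale X (s' n) a))"
    by (simp add: completion_def)
  also have "\<dots> = (\<Union>s'\<in>cls s. cls (\<lambda>n. hscale X (s n) a))"
    by (intro SUP_cong refl *)
  also have "\<dots> = cls (\<lambda>n. hscale X (s n) a)" using self_mem_cls[OF s] by blast
  finally show ?thesis .
qed

lemma completion_diff:
  assumes s: "hCauchy X s" and t: "hCauchy X t"
  shows "hdiff (completion X) (cls s) (cls t) = cls (\<lambda>n. hdiff X (s n) (t n))"
  unfolding hdiff_def by (simp add: completion_scale completion_add hCauchy_scale s t)

text \<open>In the form of a limit, every identity and the positivity of the inner product pass from
  representatives to classes. For the description by \<open>THE\<close>, the limit has to be the
  same for all representatives, which follows from boundedness of Cauchy sequences.\<close>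

lemma completion_inner:
  assumes s: "hCauchy X s" and t: "hCauchy X t"
  shows "(\<lambda>n. hinner X (s n) (t n)) \<longlonglongrightarrow> hinner (completion X) (cls s) (cls t)"
proof -
  obtain c where c: "(\<lambda>n. hinner X (s n) (t n)) \<longlonglongrightarrow> c"
    using hCauchy_inner_convergent[OF s t] by (auto simp: convergent_def)
  have *: "(\<lambda>n. hinner X (s' n) (t' n)) \<longlonglongrightarrow> c" if "s' \<in> cls s" "t' \<in> cls t" for s' t'
  proof -
    have s': "hCauchy X s'" "(\<lambda>n. hdist X (s n) (s' n)) \<longlonglongrightarrow> 0"
      and t': "hCauchy X t'" "(\<lambda>n. hdist X (t n) (t' n)) \<longlonglongrightarrow> 0"
      using that by (auto simp: completion_rel_iff)
    obtain K L where K: "\<And>n. hnorm X (s' n) \<le> K" "K > 0" and L: "\<And>n. hnorm X (t n) \<le> L" "L > 0"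
      using hCauchy_bounded s'(1) t by metis
    have "(\<lambda>n. hinner X (s n) (t n) - hinner X (s' n) (t' n)) \<longlonglongrightarrow> 0"
    proof (rule Lim_null_comparison)
      show "\<forall>\<^sub>F n in sequentially. norm (hinner X (s n) (t n) - hinner X (s' n) (t' n))
          \<le> hdist X (s n) (s' n) * L + K * hdist X (t n) (t' n)"
      proof (intro always_eventually allI)
        fix n
        have "norm (hinner X (s n) (t n) - hinner X (s' n) (t' n))
            \<le> hdist X (s n) (s' n) * hnorm X (t n) + hnorm X (s' n) * hdist X (t n) (t' n)"
          by (intro inner_diff_bound hCauchy_closed s t s' t')
        also have "\<dots> \<le> hdist X (s n) (s' n) * L + K * hdist X (t n) (t' n)"
          by (intro add_mono mult_left_mono mult_right_mono K L) auto
        finally show "norm (hinner X (s n) (t n) - hinner X (s' n) (t' n))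
            \<le> hdist X (s n) (s' n) * L + K * hdist X (t n) (t' n)" .
      qed
      have "(\<lambda>n. hdist X (s n) (s' n) * L + K * hdist X (t n) (t' n)) \<longlonglongrightarrow> 0 * L + K * 0"
        by (intro tendsto_intros s' t')
      then show "(\<lambda>n. hdist X (s n) (s' n) * L + K * hdist X (t n) (t' n)) \<longlonglongrightarrow> 0" by simp
    qed
    from tendsto_diff[OF c this] show ?thesis by simp
  qed
  have "hinner (completion X) (cls s) (cls t)
      = (THE c. \<forall>s'\<in>cls s. \<forall>t'\<in>cls t. (\<lambda>n. hinner X (s' n) (t' n)) \<longlonglongrightarrow> c)"
    by (simp add: completion_def)
  also have "\<dots> = c"
  proof (rule the_equality)
    fix d assume "\<forall>s'\<in>cls s. \<forall>t'\<in>cls t. (\<lambda>n. hinner X (s' n) (t' n)) \<longlonglongrightarrow> d"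
    then have "(\<lambda>n. hinner X (s n) (t n)) \<longlonglongrightarrow> d"
      using self_mem_cls[OF s] self_mem_cls[OF t] by blast
    then show "d = c" using c LIMSEQ_unique by blast
  qed (use * in blast)
  finally show ?thesis using c by simp
qed

lemma completion_inner_eqI:
  assumes "hCauchy X s" "hCauchy X t" "(\<lambda>n. hinner X (s n) (t n)) \<longlonglongrightarrow> c"
  shows "hinner (completion X) (cls s) (cls t) = c"
  using LIMSEQ_unique[OF completion_inner assms(3)] assms by blast

lemma completion_hnorm:
  assumes "hCauchy X s"
  shows "(\<lambda>n. hnorm X (s n)) \<longlonglongrightarrow> hnorm (completion X) (cls s)"
  unfolding hnorm_def by (intro tendsto_intros completion_inner assms)

lemma completion_hdist:
  assumes "hCauchy X s" "hCauchy X t"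
  shows "(\<lambda>n. hdist X (s n) (t n)) \<longlonglongrightarrow> hdist (completion X) (cls s) (cls t)"
  using completion_hnorm[OF hCauchy_diff[OF assms]] by (simp add: completion_diff assms)

lemma semi_hilbert_completion: "semi_hilbert (completion X)"
proof
  show "hzero (completion X) \<in> hcarrier (completion X)"
    by (simp add: completion_zero cls_closed hCauchy_const zero_closed)
next
  fix P Q assume "P \<in> hcarrier (completion X)" "Q \<in> hcarrier (completion X)"
  then obtain s t where s: "hCauchy X s" "P = cls s" and t: "hCauchy X t" "Q = cls t"
    by (metis completion_carrierE)
  note [simp] = s t completion_add completion_scale completion_zero hCauchy_add hCauchy_scale
    cls_closed hCauchy_const zero_closed hCauchy_closed
  show "hadd (completion X) P Q \<in> hcarrier (completion X)" by simp
  show "hscale (completion X) P a \<in> hcarrier (completion X)" for a by simp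
  show "hadd (completion X) P Q = hadd (completion X) Q P" by (simp add: add_commute)
  show "hadd (completion X) P (hzero (completion X)) = P" by (simp add: add_zero)
  show "hadd (completion X) P (hscale (completion X) P (- 1)) = hzero (completion X)"
    by (simp add: add_neg)
  show "hscale (completion X) (hadd (completion X) P Q) a
      = hadd (completion X) (hscale (completion X) P a) (hscale (completion X) Q a)" for a
    by (simp add: scale_add_left)
  show "hscale (completion X) P (a + b)
      = hadd (completion X) (hscale (completion X) P a) (hscale (completion X) P b)" for a b
    by (simp add: scale_add_right)
  show "hscale (completion X) P (a * b) = hscale (completion X) (hscale (completion X) P a) b" for a b
    by (simp add: scale_mult)
  show "hscale (completion X) P 1 = P" by (simp add: scale_one)
  show "hinner (completion X) P (hscale (completion X) Q a) = hinner (completion X) P Q * a" for a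
  proof -
    have "(\<lambda>n. hinner X (s n) (t n) * a) \<longlonglongrightarrow> hinner (completion X) P Q * a"
      using completion_inner[OF s(1) t(1)] by (auto intro!: tendsto_intros)
    then show ?thesis by (auto intro!: completion_inner_eqI simp: inner_scale_right)
  qed
  show "star (hinner (completion X) P Q) = hinner (completion X) Q P"
  proof -
    have "(\<lambda>n. star (hinner X (s n) (t n))) \<longlonglongrightarrow> star (hinner (completion X) P Q)"
      using completion_inner[OF s(1) t(1)] by (auto intro!: tendsto_star)
    then show ?thesis by (auto intro!: completion_inner_eqI[symmetric] simp: star_inner)
  qed
  show "psd (hinner (completion X) P P)"
    unfolding s(2) by (rule psd_tendsto[OF _ completion_inner[OF s(1) s(1)]]) (auto simp: inner_psd)
  fix R assume "R \<in> hcarrier (completion X)"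
  then obtain u where u [simp]: "hCauchy X u" "R = cls u" by (metis completion_carrierE)
  show "hadd (completion X) (hadd (completion X) P Q) R
      = hadd (completion X) P (hadd (completion X) Q R)"
    by (simp add: add_assoc)
  have "(\<lambda>n. hinner X (s n) (t n) + hinner X (s n) (u n))
      \<longlonglongrightarrow> hinner (completion X) P Q + hinner (completion X) P R"
    using completion_inner s t u by (auto intro!: tendsto_intros)
  then show "hinner (completion X) P (hadd (completion X) Q R)
      = hinner (completion X) P Q + hinner (completion X) P R"
    by (auto intro!: completion_inner_eqI simp: inner_add_right)
qed

abbreviation emb :: "'x \<Rightarrow> (nat \<Rightarrow> 'x) set" where
  "emb x \<equiv> completion_embed X x"

lemma emb_eq_cls: "emb x = cls (\<lambda>n. x)"
  by (simp add: completion_embed_def)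

lemma emb_closed: "x \<in> hcarrier X \<Longrightarrow> emb x \<in> hcarrier (completion X)"
  by (simp add: emb_eq_cls cls_closed hCauchy_const)

lemma emb_inner: "\<lbrakk>x \<in> hcarrier X; y \<in> hcarrier X\<rbrakk> \<Longrightarrow> hinner (completion X) (emb x) (emb y) = hinner X x y"
  by (simp add: emb_eq_cls completion_inner_eqI hCauchy_const)

lemma emb_hdist:
  "\<lbrakk>x \<in> hcarrier X; y \<in> hcarrier X\<rbrakk> \<Longrightarrow> hdist (completion X) (emb x) (emb y) = hdist X x y"
  using LIMSEQ_unique[OF completion_hdist[OF hCauchy_const hCauchy_const] tendsto_const]
  by (simp add: emb_eq_cls)

lemma emb_hdist_tendsto:
  assumes s: "hCauchy X s"
  shows "(\<lambda>n. hdist (completion X) (emb (s n)) (cls s)) \<longlonglongrightarrow> 0"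
proof (rule LIMSEQ_I)
  fix e :: real assume e: "e > 0"
  then obtain N where N: "\<forall>i\<ge>N. \<forall>j\<ge>N. hdist X (s i) (s j) < e / 2"
    using hCauchyD[OF s, of "e / 2"] by auto
  have "hdist (completion X) (emb (s n)) (cls s) \<le> e / 2" if "n \<ge> N" for n
  proof (rule LIMSEQ_le_const2)
    show "(\<lambda>j. hdist X (s n) (s j)) \<longlonglongrightarrow> hdist (completion X) (emb (s n)) (cls s)"
      unfolding emb_eq_cls by (intro completion_hdist hCauchy_const hCauchy_closed s)
    show "\<exists>N. \<forall>j\<ge>N. hdist X (s n) (s j) \<le> e / 2" using N that less_imp_le by blast
  qed
  moreover have "0 \<le> hdist (completion X) P Q" for P Q by (simp add: hnorm_def)
  ultimately show "\<exists>N. \<forall>n\<ge>N. norm (hdist (completion X) (emb (s n)) (cls s) - 0) < e"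
    using e by (intro exI[of _ N]) (force intro: le_less_trans)
qed

lemma completion_dense:
  assumes "P \<in> hcarrier (completion X)" "e > 0"
  obtains x where "x \<in> hcarrier X" "hdist (completion X) (emb x) P < e"
proof -
  obtain s where s: "hCauchy X s" "P = cls s" by (rule completion_carrierE[OF assms(1)])
  have "\<forall>\<^sub>F n in sequentially. hdist (completion X) (emb (s n)) P < e"
    using order_tendstoD(2)[OF emb_hdist_tendsto[OF s(1)] assms(2)] s(2) by simp
  then obtain n where "hdist (completion X) (emb (s n)) P < e"
    by (auto simp: eventually_sequentially)
  then show thesis using s that hCauchy_closed by blast
qed

text \<open>Completeness is the diagonal argument: each term of a Cauchy sequence of classes is
  approximated by a constant class up to 1/(n+1), the approximants form a Cauchy sequence in X, and
  its class is the limit. Definiteness holds because a class of norm 0 is represented by a sequence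
  of seminorms tending to 0.\<close>

lemma hilbert_module_completion: "hilbert_module (completion X)"
proof -
  interpret C: semi_hilbert "completion X" by (rule semi_hilbert_completion)
  show ?thesis
  proof
    fix P assume P: "P \<in> hcarrier (completion X)"
    show "\<exists>Q\<in>hcarrier (completion X). hadd (completion X) P Q = hzero (completion X)"
      using C.add_neg[OF P] C.scale_closed[OF P] by blast
    assume "hinner (completion X) P P = 0"
    moreover obtain s where s: "hCauchy X s" "P = cls s" by (rule completion_carrierE[OF P])
    ultimately have "hnorm (completion X) (cls s) = 0" by (simp add: hnorm_def)
    then have "(\<lambda>n. hnorm X (s n)) \<longlonglongrightarrow> 0" using completion_hnorm[OF s(1)] by simp
    moreover have "hdist X (s n) (hzero X) = hnorm X (s n)" for n
      using hCauchy_closed[OF s(1)] by (simp add: hnorm_def inner_simps closed_simps)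
    ultimately show "P = hzero (completion X)"
      by (simp add: s(2) completion_zero cls_eq_iff s(1) hCauchy_const zero_closed)
  next
    fix S assume S: "hCauchy (completion X) S"
    have "\<exists>x\<in>hcarrier X. hdist (completion X) (emb x) (S n) < inverse (real (Suc n))" for n
      using completion_dense[OF C.hCauchy_closed[OF S], of "inverse (real (Suc n))" n] by auto
    then obtain x where x: "\<And>n. x n \<in> hcarrier X"
      "\<And>n. hdist (completion X) (emb (x n)) (S n) < inverse (real (Suc n))" by metis
    have lim: "(\<lambda>n. hdist (completion X) (emb (x n)) (S n)) \<longlonglongrightarrow> 0"
      by (rule Lim_null_comparison[OF _ LIMSEQ_inverse_real_of_nat])
        (use x(2) in \<open>auto intro!: always_eventually less_imp_le\<close>)
    have "hCauchy X x"
      unfolding hCauchy_def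
    proof (intro conjI allI impI x)
      fix e :: real assume e: "e > 0"
      then obtain M where M: "\<forall>i\<ge>M. \<forall>j\<ge>M. hdist (completion X) (S i) (S j) < e / 3"
        using C.hCauchyD[OF S, of "e / 3"] by auto
      have "\<forall>\<^sub>F n in sequentially. hdist (completion X) (emb (x n)) (S n) < e / 3"
        using order_tendstoD(2)[OF lim, of "e / 3"] e by simp
      then obtain N where N: "\<forall>n\<ge>N. hdist (completion X) (emb (x n)) (S n) < e / 3"
        by (auto simp: eventually_sequentially)
      show "\<exists>N. \<forall>i\<ge>N. \<forall>j\<ge>N. hdist X (x i) (x j) < e"
      proof (intro exI allI impI)
        fix i j assume ij: "max M N \<le> i" "max M N \<le> j"
        note cl = emb_closed[OF x(1)] C.hCauchy_closed[OF S]
        have "hdist X (x i) (x j) = hdist (completion X) (emb (x i)) (emb (x j))"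
          by (simp add: emb_hdist x)
        also have "\<dots> \<le> hdist (completion X) (emb (x i)) (S i) + hdist (completion X) (S i) (S j)
            + hdist (completion X) (S j) (emb (x j))"
          using C.hdist_triangle[OF cl(1)[of i] cl(2)[of j] cl(1)[of j]]
            C.hdist_triangle[OF cl(1)[of i] cl(2)[of i] cl(2)[of j]] by linarith
        also have "\<dots> < e / 3 + e / 3 + e / 3"
          using M N ij C.hdist_commute[OF cl(1)[of j] cl(2)[of j]] by (intro add_strict_mono) auto
        finally show "hdist X (x i) (x j) < e" by simp
      qed
    qed
    have "(\<lambda>n. hdist (completion X) (emb (x n)) (S n) + hdist (completion X) (emb (x n)) (cls x)) \<longlonglongrightarrow> 0 + 0"
      by (intro tendsto_add lim emb_hdist_tendsto \<open>hCauchy X x\<close>)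
    then have "hconverges (completion X) S (cls x)"
      unfolding hconverges_def
    proof (rule_tac tendsto_zero_le)
      fix n
      note cl = emb_closed[OF x(1)[of n]] C.hCauchy_closed[OF S, of n] cls_closed[OF \<open>hCauchy X x\<close>]
      show "hdist (completion X) (S n) (cls x) \<le> hdist (completion X) (emb (x n)) (S n)
          + hdist (completion X) (emb (x n)) (cls x)"
        using C.hdist_triangle[OF cl(2,1,3)] C.hdist_commute[OF cl(1,2)] by simp
    qed simp_all
    then show "\<exists>P\<in>hcarrier (completion X). hconverges (completion X) S P"
      using cls_closed[OF \<open>hCauchy X x\<close>] by blast
  qed (fact C.zero_closed C.add_closed C.scale_closed C.add_assoc C.add_commute C.add_zero
      C.scale_add_left C.scale_add_right C.scale_mult C.scale_one C.inner_add_right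
      C.inner_scale_right C.star_inner C.inner_psd[folded cstar_positive_iff_psd])+
qed

end

section \<open>Isometries and their extension to completions\<close>

locale hilbert_isometry = X: semi_hilbert X + Y: semi_hilbert Y
  for X :: "('a::unital_cstar_algebra, 'x, 'r) hmodule_scheme"
    and Y :: "('a, 'y, 's) hmodule_scheme"
    and \<phi> :: "'x \<Rightarrow> 'y" +
  assumes closed: "x \<in> hcarrier X \<Longrightarrow> \<phi> x \<in> hcarrier Y"
    and add: "\<lbrakk>x \<in> hcarrier X; y \<in> hcarrier X\<rbrakk> \<Longrightarrow> \<phi> (hadd X x y) = hadd Y (\<phi> x) (\<phi> y)"
    and scale: "x \<in> hcarrier X \<Longrightarrow> \<phi> (hscale X x a) = hscale Y (\<phi> x) a"
    and inner: "\<lbrakk>x \<in> hcarrier X; y \<in> hcarrier X\<rbrakk> \<Longrightarrow> hinner Y (\<phi> x) (\<phi> y) = hinner X x y"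
begin

lemma hdist_eq: "\<lbrakk>x \<in> hcarrier X; y \<in> hcarrier X\<rbrakk> \<Longrightarrow> hdist Y (\<phi> x) (\<phi> y) = hdist X x y"
  by (simp add: hnorm_def X.inner_simps X.closed_simps Y.inner_simps Y.closed_simps closed inner)

lemma hCauchy_image: "hCauchy X s \<Longrightarrow> hCauchy Y (\<lambda>n. \<phi> (s n))"
  by (simp add: hCauchy_def closed hdist_eq)

text \<open>Written as a union over representatives so as to agree literally with
  \<open>tensor_cons\<close>; this is how the connecting maps are recognized as well-defined
  isometries in \<open>tensor_cons_eq_extension\<close>.\<close>

definition extension :: "(nat \<Rightarrow> 'x) set \<Rightarrow> (nat \<Rightarrow> 'y) set" where
  "extension P = (\<Union>s\<in>P. Y.cls (\<lambda>n. \<phi> (s n)))"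

lemma extension_cls:
  assumes s: "hCauchy X s"
  shows "extension (X.cls s) = Y.cls (\<lambda>n. \<phi> (s n))"
proof -
  have *: "Y.cls (\<lambda>n. \<phi> (s' n)) = Y.cls (\<lambda>n. \<phi> (s n))" if "s' \<in> X.cls s" for s'
    using that by (intro Y.cls_eqI) (auto simp: X.completion_rel_iff Y.completion_rel_iff hCauchy_image hdist_eq X.hCauchy_closed)
  have "extension (X.cls s) = (\<Union>s'\<in>X.cls s. Y.cls (\<lambda>n. \<phi> (s n)))"
    unfolding extension_def by (intro SUP_cong refl *)
  then show ?thesis using X.self_mem_cls[OF s] by blast
qed

lemma extension_emb: "x \<in> hcarrier X \<Longrightarrow> extension (X.emb x) = Y.emb (\<phi> x)"
  by (simp add: X.emb_eq_cls Y.emb_eq_cls extension_cls X.hCauchy_const)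

lemma hilbert_isometry_extension: "hilbert_isometry (completion X) (completion Y) extension"
proof -
  interpret CX: semi_hilbert "completion X" by (rule X.semi_hilbert_completion)
  interpret CY: semi_hilbert "completion Y" by (rule Y.semi_hilbert_completion)
  show ?thesis
  proof
    fix P Q assume "P \<in> hcarrier (completion X)" "Q \<in> hcarrier (completion X)"
    then obtain s t where s: "hCauchy X s" "P = X.cls s" and t: "hCauchy X t" "Q = X.cls t"
      by (metis X.completion_carrierE)
    note [simp] = s t X.completion_add X.completion_scale Y.completion_add Y.completion_scale
      X.hCauchy_add X.hCauchy_scale hCauchy_image extension_cls Y.cls_closed X.hCauchy_closed
    show "extension P \<in> hcarrier (completion Y)" by simp
    show "extension (hadd (completion X) P Q) = hadd (completion Y) (extension P) (extension Q)"
      by (simp add: add)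
    show "extension (hscale (completion X) P a) = hscale (completion Y) (extension P) a" for a
      by (simp add: scale)
    show "hinner (completion Y) (extension P) (extension Q) = hinner (completion X) P Q"
      using X.completion_inner[OF s(1) t(1)] by (auto intro!: Y.completion_inner_eqI simp: inner)
  qed
qed

end

section \<open>Direct limits\<close>

context hilbert_isometry
begin

lemma zero: "\<phi> (hzero X) = hzero Y"
  by (metis X.add_neg X.scale_closed X.zero_closed Y.add_neg add closed scale)

lemma compose:
  assumes "hilbert_isometry Y Z \<psi>"
  shows "hilbert_isometry X Z (\<lambda>x. \<psi> (\<phi> x))"
proof -
  interpret \<psi>: hilbert_isometry Y Z \<psi> by (rule assms)
  show ?thesis
    by unfold_locales (simp_all add: closed add scale inner \<psi>.closed \<psi>.add \<psi>.scale \<psi>.inner)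
qed

end

lemma transport_add: "transport T k (d + e) x = transport T (k + d) e (transport T k d x)"
  by (induction e) (simp_all add: add.assoc)

locale hilbert_system =
  fixes X :: "nat \<Rightarrow> ('a::unital_cstar_algebra, 'x) hmodule" and T :: "nat \<Rightarrow> 'x \<Rightarrow> 'x"
  assumes isometry: "hilbert_isometry (X k) (X (Suc k)) (T k)"
begin

sublocale X: semi_hilbert "X k" for k
  using isometry[of k] by (simp add: hilbert_isometry_def)

abbreviation lift :: "nat \<Rightarrow> nat \<Rightarrow> 'x \<Rightarrow> 'x" where
  "lift n k x \<equiv> transport T k (n - k) x"

lemma isometry_transport: "hilbert_isometry (X k) (X (k + d)) (transport T k d)"
proof (induction d)
  case 0
  show ?case by unfold_locales simp_all
next
  case (Suc d)
  then show ?case using hilbert_isometry.compose[OF Suc isometry[of "k + d"]] by simp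
qed

lemma isometry_lift: "k \<le> n \<Longrightarrow> hilbert_isometry (X k) (X n) (lift n k)"
  using isometry_transport[of k "n - k"] by simp

lemmas lift_closed = hilbert_isometry.closed[OF isometry_lift]
lemmas lift_add = hilbert_isometry.add[OF isometry_lift]
lemmas lift_scale = hilbert_isometry.scale[OF isometry_lift]
lemmas lift_inner = hilbert_isometry.inner[OF isometry_lift]

lemma lift_lift: "k \<le> n \<Longrightarrow> n \<le> p \<Longrightarrow> lift p n (lift n k x) = lift p k x"
  using transport_add[of T k "n - k" "p - n" x] by simp

lemma lift_eq_mono: "\<lbrakk>lift n k x = lift n l y; k \<le> n; l \<le> n; n \<le> p\<rbrakk> \<Longrightarrow> lift p k x = lift p l y"
  by (metis lift_lift)

lemma limit_rel_iff: "((k, x), (l, y)) \<in> limit_rel X T \<longleftrightarrow>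
    x \<in> hcarrier (X k) \<and> y \<in> hcarrier (X l) \<and> (\<exists>n\<ge>max k l. lift n k x = lift n l y)"
  by (simp add: limit_rel_def)

lemma equiv_limit_rel: "equiv (SIGMA k:UNIV. hcarrier (X k)) (limit_rel X T)"
proof (rule equivI)
  show "limit_rel X T \<subseteq> (SIGMA k:UNIV. hcarrier (X k)) \<times> (SIGMA k:UNIV. hcarrier (X k))"
    by (auto simp: limit_rel_def)
  show "refl_on (SIGMA k:UNIV. hcarrier (X k)) (limit_rel X T)"
    by (auto simp: refl_on_def limit_rel_def)
  show "sym (limit_rel X T)"
    by (auto simp: sym_def limit_rel_def max.commute)
  show "trans (limit_rel X T)"
  proof (rule transI, clarify)
    fix k x l y p z
    assume 1: "((k, x), (l, y)) \<in> limit_rel X T" and 2: "((l, y), (p, z)) \<in> limit_rel X T"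
    then obtain m n where "max k l \<le> m" "lift m k x = lift m l y" "max l p \<le> n" "lift n l y = lift n p z"
      unfolding limit_rel_iff by blast
    then have "lift (max m n) k x = lift (max m n) l y" "lift (max m n) l y = lift (max m n) p z"
      by (auto intro: lift_eq_mono[where n = m] lift_eq_mono[where n = n])
    then show "((k, x), (p, z)) \<in> limit_rel X T"
      using 1 2 \<open>max k l \<le> m\<close> \<open>max l p \<le> n\<close> unfolding limit_rel_iff
      by (auto intro!: exI[of _ "max m n"])
  qed
qed

abbreviation lcls :: "nat \<Rightarrow> 'x \<Rightarrow> (nat \<times> 'x) set" where
  "lcls k x \<equiv> limit_rel X T `` {(k, x)}"

abbreviation L :: "('a, (nat \<times> 'x) set) hmodule" where
  "L \<equiv> algebraic_limit X T"

lemma lcls_lift: "x \<in> hcarrier (X k) \<Longrightarrow> k \<le> n \<Longrightarrow> lcls n (lift n k x) = lcls k x"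
  by (intro equiv_class_eq[OF equiv_limit_rel])
    (auto simp: limit_rel_iff lift_closed intro!: exI[of _ n])

lemma self_mem_lcls: "x \<in> hcarrier (X k) \<Longrightarrow> (k, x) \<in> lcls k x"
  by (auto simp: limit_rel_iff)

text \<open>Equivalent representatives agree only from some level on. A threshold valid for all
  later p allows several such agreements to be used together at the maximum of their
  thresholds.\<close>

lemma lcls_memE:
  assumes "((k, x), (l, y)) \<in> limit_rel X T"
  obtains n where "y \<in> hcarrier (X l)" "k \<le> n" "l \<le> n" "\<And>p. n \<le> p \<Longrightarrow> lift p l y = lift p k x"
proof -
  obtain n where n: "y \<in> hcarrier (X l)" "max k l \<le> n" "lift n k x = lift n l y"
    using assms by (auto simp: limit_rel_iff)
  then have "lift p l y = lift p k x" if "n \<le> p" for p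
    using lift_eq_mono[OF n(3) _ _ that] n(2) by simp
  then show thesis using that n by (meson max.bounded_iff)
qed

lemma L_carrier: "hcarrier L = {lcls k x | k x. x \<in> hcarrier (X k)}"
  by (auto simp: algebraic_limit_def quotient_def)

lemma lcls_closed: "x \<in> hcarrier (X k) \<Longrightarrow> lcls k x \<in> hcarrier L"
  by (auto simp: L_carrier)

text \<open>The definition adds arbitrary representatives at level \<open>max k l\<close>, where
  they need not yet agree with lifts of x and y. The result is pushed up to a level beyond both
  thresholds, compared there, and brought down to n.\<close>

lemma L_add:
  assumes "x \<in> hcarrier (X n)" "y \<in> hcarrier (X n)"
  shows "hadd L (lcls n x) (lcls n y) = lcls n (hadd (X n) x y)"
proof -
  let ?f = "\<lambda>(k, x') (l, y'). lcls (max k l) (hadd (X (max k l)) (lift (max k l) k x') (lift (max k l) l y'))"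
  have *: "?f a b = lcls n (hadd (X n) x y)" if ab: "a \<in> lcls n x" "b \<in> lcls n y" for a b
  proof -
    obtain k x' l y' where [simp]: "a = (k, x')" "b = (l, y')" by (metis surj_pair)
    obtain p where p: "x' \<in> hcarrier (X k)" "n \<le> p" "k \<le> p" "\<And>q. p \<le> q \<Longrightarrow> lift q k x' = lift q n x"
      using ab by (auto elim!: lcls_memE)
    obtain q where q: "y' \<in> hcarrier (X l)" "n \<le> q" "l \<le> q" "\<And>p. q \<le> p \<Longrightarrow> lift p l y' = lift p n y"
      using ab by (auto elim!: lcls_memE)
    let ?N = "max k l" and ?M = "max p q"
    have "?N \<le> ?M" using p(3) q(3) by arith
    then have "?f a b = lcls ?M (lift ?M ?N (hadd (X ?N) (lift ?N k x') (lift ?N l y')))"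
      using lcls_lift[OF X.add_closed[OF lift_closed lift_closed] \<open>?N \<le> ?M\<close>, OF _ p(1) _ q(1)] by simp
    also have "lift ?M ?N (hadd (X ?N) (lift ?N k x') (lift ?N l y'))
        = hadd (X ?M) (lift ?M ?N (lift ?N k x')) (lift ?M ?N (lift ?N l y'))"
      using p(1-3) q(1-3) by (intro lift_add lift_closed) auto
    also have "\<dots> = hadd (X ?M) (lift ?M k x') (lift ?M l y')"
      using p(3) q(3) by (subst (1 2) lift_lift) auto
    also have "\<dots> = lift ?M n (hadd (X n) x y)"
      using p(2) q(2) p(4)[of ?M] q(4)[of ?M] assms by (subst lift_add) auto
    also have "lcls ?M \<dots> = lcls n (hadd (X n) x y)"
      using p(2) assms by (intro lcls_lift X.add_closed) auto
    finally show ?thesis .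
  qed
  have "hadd L (lcls n x) (lcls n y) = (\<Union>a\<in>lcls n x. \<Union>b\<in>lcls n y. ?f a b)"
    by (simp add: algebraic_limit_def split_def)
  also have "\<dots> = (\<Union>a\<in>lcls n x. \<Union>b\<in>lcls n y. lcls n (hadd (X n) x y))"
    by (intro SUP_cong refl *)
  finally show ?thesis using self_mem_lcls assms by blast
qed

lemma L_scale:
  assumes "x \<in> hcarrier (X n)"
  shows "hscale L (lcls n x) c = lcls n (hscale (X n) x c)"
proof -
  let ?f = "\<lambda>(k, x'). lcls k (hscale (X k) x' c)"
  have *: "?f a = lcls n (hscale (X n) x c)" if a: "a \<in> lcls n x" for a
  proof -
    obtain k x' where [simp]: "a = (k, x')" by (metis surj_pair)
    obtain p where p: "x' \<in> hcarrier (X k)" "n \<le> p" "k \<le> p" "\<And>q. p \<le> q \<Longrightarrow> lift q k x' = lift q n x"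
      using a by (auto elim!: lcls_memE)
    have "?f a = lcls p (lift p k (hscale (X k) x' c))"
      using lcls_lift[OF X.scale_closed[OF p(1)] p(3)] by simp
    also have "lift p k (hscale (X k) x' c) = lift p n (hscale (X n) x c)"
      using p assms by (simp add: lift_scale)
    also have "lcls p \<dots> = lcls n (hscale (X n) x c)"
      using lcls_lift[OF X.scale_closed[OF assms] p(2)] by simp
    finally show ?thesis .
  qed
  have "hscale L (lcls n x) c = (\<Union>a\<in>lcls n x. ?f a)"
    by (simp add: algebraic_limit_def)
  also have "\<dots> = (\<Union>a\<in>lcls n x. lcls n (hscale (X n) x c))"
    by (intro SUP_cong refl *)
  finally show ?thesis using self_mem_lcls assms by blast
qed

lemma L_inner:
  assumes "x \<in> hcarrier (X n)" "y \<in> hcarrier (X n)"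
  shows "hinner L (lcls n x) (lcls n y) = hinner (X n) x y"
proof -
  let ?f = "\<lambda>k x' l y'. hinner (X (max k l)) (lift (max k l) k x') (lift (max k l) l y')"
  have *: "?f k x' l y' = hinner (X n) x y" if ab: "(k, x') \<in> lcls n x" "(l, y') \<in> lcls n y" for k x' l y'
  proof -
    obtain p where p: "x' \<in> hcarrier (X k)" "n \<le> p" "k \<le> p" "\<And>q. p \<le> q \<Longrightarrow> lift q k x' = lift q n x"
      using ab by (auto elim!: lcls_memE)
    obtain q where q: "y' \<in> hcarrier (X l)" "n \<le> q" "l \<le> q" "\<And>p. q \<le> p \<Longrightarrow> lift p l y' = lift p n y"
      using ab by (auto elim!: lcls_memE)
    let ?N = "max k l" and ?M = "max p q"
    have "?f k x' l y' = hinner (X ?M) (lift ?M ?N (lift ?N k x')) (lift ?M ?N (lift ?N l y'))"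
      using p(1-3) q(1-3) by (intro lift_inner[symmetric] lift_closed) auto
    also have "\<dots> = hinner (X ?M) (lift ?M k x') (lift ?M l y')"
      using p(3) q(3) by (subst (1 2) lift_lift) auto
    also have "\<dots> = hinner (X n) x y"
      using p(2) q(2) p(4)[of ?M] q(4)[of ?M] assms by (simp add: lift_inner)
    finally show ?thesis .
  qed
  have "hinner L (lcls n x) (lcls n y) = (THE c. \<forall>(k, x')\<in>lcls n x. \<forall>(l, y')\<in>lcls n y. c = ?f k x' l y')"
    by (simp add: algebraic_limit_def)
  also have "\<dots> = hinner (X n) x y"
  proof (rule the_equality)
    show "\<forall>(k, x')\<in>lcls n x. \<forall>(l, y')\<in>lcls n y. hinner (X n) x y = ?f k x' l y'"
      using * by fastforce
    fix c assume c: "\<forall>(k, x')\<in>lcls n x. \<forall>(l, y')\<in>lcls n y. c = ?f k x' l y'"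
    have "c = ?f n x n y"
      using bspec[OF bspec[OF c self_mem_lcls[OF assms(1)], unfolded prod.case]
          self_mem_lcls[OF assms(2)], unfolded prod.case] .
    then show "c = hinner (X n) x y" by simp
  qed
  finally show ?thesis .
qed

lemma L_zero: "hzero L = lcls n (hzero (X n))"
proof -
  have "hzero L = lcls 0 (hzero (X 0))" by (simp add: algebraic_limit_def)
  also have "\<dots> = lcls n (lift n 0 (hzero (X 0)))"
    by (intro lcls_lift[symmetric] X.zero_closed) simp
  also have "lift n 0 (hzero (X 0)) = hzero (X n)"
    by (rule hilbert_isometry.zero[OF isometry_lift]) simp
  finally show ?thesis .
qed

lemma L_carrierE:
  assumes "P \<in> hcarrier L"
  obtains k x where "x \<in> hcarrier (X k)" "P = lcls k x" "\<And>n. k \<le> n \<Longrightarrow> \<exists>y\<in>hcarrier (X n). P = lcls n y"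
proof -
  obtain k x where kx: "x \<in> hcarrier (X k)" "P = lcls k x" using assms by (auto simp: L_carrier)
  moreover have "\<exists>y\<in>hcarrier (X n). P = lcls n y" if "k \<le> n" for n
    using lift_closed[OF that kx(1)] lcls_lift[OF kx(1) that] kx(2) by blast
  ultimately show thesis by (rule that)
qed

lemma L_common_level:
  assumes "P \<in> hcarrier L" "Q \<in> hcarrier L" "R \<in> hcarrier L"
  obtains n x y z where "x \<in> hcarrier (X n)" "y \<in> hcarrier (X n)" "z \<in> hcarrier (X n)"
    "P = lcls n x" "Q = lcls n y" "R = lcls n z"
proof -
  obtain k where k: "\<And>n. k \<le> n \<Longrightarrow> \<exists>y\<in>hcarrier (X n). P = lcls n y" using L_carrierE[OF assms(1)] by metis
  obtain l where l: "\<And>n. l \<le> n \<Longrightarrow> \<exists>y\<in>hcarrier (X n). Q = lcls n y" using L_carrierE[OF assms(2)] by metis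
  obtain p where p: "\<And>n. p \<le> n \<Longrightarrow> \<exists>y\<in>hcarrier (X n). R = lcls n y" using L_carrierE[OF assms(3)] by metis
  show thesis using k[of "k + l + p"] l[of "k + l + p"] p[of "k + l + p"] that by auto
qed

lemma semi_hilbert_L: "semi_hilbert L"
proof
  show "hzero L \<in> hcarrier L" using lcls_closed[OF X.zero_closed, of 0] by (simp add: L_zero[of 0])
next
  fix P Q assume PQ: "P \<in> hcarrier L" "Q \<in> hcarrier L"
  {
    fix R assume "R \<in> hcarrier L"
    then obtain n x y z where [simp]: "x \<in> hcarrier (X n)" "y \<in> hcarrier (X n)" "z \<in> hcarrier (X n)"
      "P = lcls n x" "Q = lcls n y" "R = lcls n z"
      using L_common_level PQ by metis
    show "hadd L (hadd L P Q) R = hadd L P (hadd L Q R)"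
      by (simp add: L_add X.add_closed X.add_assoc)
    show "hinner L P (hadd L Q R) = hinner L P Q + hinner L P R"
      by (simp add: L_add L_inner X.add_closed X.inner_add_right)
  }
  from PQ obtain n x y where [simp]: "x \<in> hcarrier (X n)" "y \<in> hcarrier (X n)" "P = lcls n x" "Q = lcls n y"
    using L_common_level by metis
  note [simp] = L_add L_scale L_inner L_zero[of n] X.add_closed X.scale_closed X.zero_closed
  show "hadd L P Q \<in> hcarrier L" by (simp add: lcls_closed)
  show "hscale L P a \<in> hcarrier L" for a by (simp add: lcls_closed)
  show "hadd L P Q = hadd L Q P" by (simp add: X.add_commute)
  show "hadd L P (hzero L) = P" by (simp add: X.add_zero)
  show "hadd L P (hscale L P (- 1)) = hzero L" by (simp add: X.add_neg)
  show "hscale L (hadd L P Q) a = hadd L (hscale L P a) (hscale L Q a)" for a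
    by (simp add: X.scale_add_left)
  show "hscale L P (a + b) = hadd L (hscale L P a) (hscale L P b)" for a b
    by (simp add: X.scale_add_right)
  show "hscale L P (a * b) = hscale L (hscale L P a) b" for a b by (simp add: X.scale_mult)
  show "hscale L P 1 = P" by (simp add: X.scale_one)
  show "hinner L P (hscale L Q a) = hinner L P Q * a" for a by (simp add: X.inner_scale_right)
  show "star (hinner L P Q) = hinner L Q P" by (simp add: X.star_inner)
  show "psd (hinner L P P)" by (simp add: X.inner_psd)
qed

sublocale L: semi_hilbert L
  by (rule semi_hilbert_L)

lemma hilbert_module_direct_limit: "hilbert_module (direct_limit X T)"
  unfolding direct_limit_def by (rule L.hilbert_module_completion)

lemma limit_map_closed: "x \<in> hcarrier (X k) \<Longrightarrow> limit_map X T k x \<in> hcarrier (direct_limit X T)"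
  by (simp add: limit_map_def direct_limit_def L.emb_closed lcls_closed)

lemma limit_map_inner: "\<lbrakk>x \<in> hcarrier (X k); y \<in> hcarrier (X k)\<rbrakk>
    \<Longrightarrow> hinner (direct_limit X T) (limit_map X T k x) (limit_map X T k y) = hinner (X k) x y"
  by (simp add: limit_map_def direct_limit_def L.emb_inner lcls_closed L_inner)

lemma limit_map_hdist: "\<lbrakk>x \<in> hcarrier (X k); y \<in> hcarrier (X k)\<rbrakk>
    \<Longrightarrow> hdist (direct_limit X T) (limit_map X T k x) (limit_map X T k y) = hdist (X k) x y"
proof -
  interpret hilbert_isometry "X k" L "lcls k"
    by unfold_locales (simp_all add: lcls_closed L_add L_scale L_inner)
  show "\<lbrakk>x \<in> hcarrier (X k); y \<in> hcarrier (X k)\<rbrakk>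
    \<Longrightarrow> hdist (direct_limit X T) (limit_map X T k x) (limit_map X T k y) = hdist (X k) x y"
    by (simp add: limit_map_def direct_limit_def L.emb_hdist lcls_closed hdist_eq)
qed

lemma limit_map_Suc: "x \<in> hcarrier (X k) \<Longrightarrow> limit_map X T (Suc k) (T k x) = limit_map X T k x"
  using lcls_lift[of x k "Suc k"] by (simp add: limit_map_def Suc_diff_le)

lemma direct_limit_dense:
  assumes "P \<in> hcarrier (direct_limit X T)" "e > 0"
  obtains k x where "x \<in> hcarrier (X k)" "hdist (direct_limit X T) (limit_map X T k x) P < e"
proof -
  obtain p where "p \<in> hcarrier L" "hdist (completion L) (L.emb p) P < e"
    using L.completion_dense assms unfolding direct_limit_def by metis
  then show thesis using that by (auto simp: L_carrier limit_map_def direct_limit_def)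
qed

end

section \<open>Sums of positive elements and Parseval frames\<close>

lemma has_sum_sum_index:
  fixes f :: "'i \<Rightarrow> 'j \<Rightarrow> 'a::topological_comm_monoid_add"
  assumes "\<And>i. i \<in> N \<Longrightarrow> (f i has_sum S i) J"
  shows "((\<lambda>j. \<Sum>i\<in>N. f i j) has_sum (\<Sum>i\<in>N. S i)) J"
proof -
  have "((\<lambda>F. \<Sum>i\<in>N. \<Sum>j\<in>F. f i j) \<longlongrightarrow> (\<Sum>i\<in>N. S i)) (finite_subsets_at_top J)"
    using assms by (intro tendsto_sum) (simp add: has_sum_def)
  then show ?thesis by (simp add: has_sum_def sum.swap[of _ _ N])
qed

lemma has_sum_minus:
  fixes f g :: "'i \<Rightarrow> 'a::topological_ab_group_add"
  shows "(f has_sum S) A \<Longrightarrow> (g has_sum S') A \<Longrightarrow> ((\<lambda>i. f i - g i) has_sum (S - S')) A"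
  unfolding has_sum_def sum_subtractf by (rule tendsto_diff)

lemma has_sum_normI:
  fixes f :: "'i \<Rightarrow> 'a::real_normed_vector"
  assumes "\<And>e. e > 0 \<Longrightarrow> \<exists>F. finite F \<and> F \<subseteq> A \<and> (\<forall>G. finite G \<and> F \<subseteq> G \<and> G \<subseteq> A \<longrightarrow> norm (S - sum f G) < e)"
  shows "(f has_sum S) A"
  unfolding has_sum_def tendsto_iff eventually_finite_subsets_at_top dist_norm
  using assms by (simp add: norm_minus_commute)

lemma has_sum_normD:
  fixes f :: "'i \<Rightarrow> 'a::real_normed_vector"
  assumes "(f has_sum S) A" "e > 0"
  obtains F where "finite F" "F \<subseteq> A" "norm (S - sum f F) < e"
  using has_sum_finite_approximation[OF assms(1,2)] assms
  unfolding has_sum_def tendsto_iff eventually_finite_subsets_at_top dist_norm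
  by (metis norm_minus_commute order_refl)

text \<open>The difference is the limit of the positive sums over G - F for finite G containing F,
  and the cone is closed.\<close>

lemma has_sum_psd_minus_sum:
  assumes S: "(f has_sum S) A" and psd: "\<And>a. a \<in> A \<Longrightarrow> psd (f a)" and F: "finite F" "F \<subseteq> A"
  shows "psd (S - sum f F)"
proof (rule psd_tendsto[OF finite_subsets_at_top_neq_bot])
  show "((\<lambda>G. sum f G - sum f F) \<longlongrightarrow> S - sum f F) (finite_subsets_at_top A)"
    using S by (intro tendsto_diff tendsto_const) (simp add: has_sum_def)
  have "psd (sum f G - sum f F)" if "finite G" "F \<subseteq> G" "G \<subseteq> A" for G
    using that psd sum_diff[of G F f] by (metis psd_sum subset_iff DiffD1)
  then show "\<forall>\<^sub>F G in finite_subsets_at_top A. psd (sum f G - sum f F)"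
    using F by (auto simp: eventually_finite_subsets_at_top)
qed

lemma has_sum_psd: "(f has_sum S) A \<Longrightarrow> (\<And>a. a \<in> A \<Longrightarrow> psd (f a)) \<Longrightarrow> psd S"
  using has_sum_psd_minus_sum[where F = "{}"] by force

text \<open>Positivity is essential: in general an iterated sum need not be an unconditional double sum.\<close>

lemma has_sum_Times_psd:
  fixes f :: "'i \<Rightarrow> 'j \<Rightarrow> 'a::unital_cstar_algebra"
  assumes psd: "\<And>a b. a \<in> A \<Longrightarrow> b \<in> B \<Longrightarrow> psd (f a b)"
    and f: "\<And>a. a \<in> A \<Longrightarrow> (f a has_sum g a) B"
    and g: "(g has_sum S) A"
  shows "((\<lambda>(a, b). f a b) has_sum S) (A \<times> B)"
proof (rule has_sum_normI)
  have pg: "psd (g a)" if "a \<in> A" for a using has_sum_psd f psd that by blast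
  fix e :: real assume e: "e > 0"
  obtain X where X: "finite X" "X \<subseteq> A" "norm (S - sum g X) < e / 2"
    using has_sum_normD[OF g, of "e / 2"] e by auto
  \<comment> \<open>The error is shared among the rows in X; the summand 1 covers an empty
    X.\<close>
  define d where "d = e / (2 * (card X + 1))"
  have d: "d > 0" using e by (simp add: d_def)
  have "\<forall>a\<in>X. \<exists>F. finite F \<and> F \<subseteq> B \<and> norm (g a - sum (f a) F) < d"
    using has_sum_normD[OF f d] X(2) by (metis subset_iff)
  then obtain H where H: "\<And>a. a \<in> X \<Longrightarrow> finite (H a) \<and> H a \<subseteq> B \<and> norm (g a - sum (f a) (H a)) < d"
    by metis
  let ?f = "\<lambda>(a, b). f a b" and ?H = "Sigma X H"
  have sumH: "sum ?f ?H = (\<Sum>a\<in>X. sum (f a) (H a))" using X(1) H by (subst sum.Sigma) auto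
  have "norm (\<Sum>a\<in>X. g a - sum (f a) (H a)) \<le> (\<Sum>a\<in>X. d)"
    using H by (intro sum_norm_le) (auto intro: less_imp_le)
  also have "\<dots> \<le> e / 2" using e by (simp add: d_def field_simps)
  finally have "norm ((S - sum g X) + (\<Sum>a\<in>X. g a - sum (f a) (H a))) < e / 2 + e / 2"
    using X(3) by (intro norm_triangle_lt add_less_le_mono)
  then have small: "norm (S - sum ?f ?H) < e" by (simp add: sumH sum_subtractf)
  show "\<exists>F. finite F \<and> F \<subseteq> A \<times> B \<and>
      (\<forall>G. finite G \<and> F \<subseteq> G \<and> G \<subseteq> A \<times> B \<longrightarrow> norm (S - sum ?f G) < e)"
  proof (intro exI conjI allI impI)
    show "finite ?H" "?H \<subseteq> A \<times> B" using X H by auto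
    fix G assume G: "finite G \<and> ?H \<subseteq> G \<and> G \<subseteq> A \<times> B"
    let ?Y = "fst ` G"
    have Y: "finite ?Y" "?Y \<subseteq> A" "\<And>a. finite (G `` {a}) \<and> G `` {a} \<subseteq> B"
      using G by (auto simp: finite_Image)
    have "G = Sigma ?Y (\<lambda>a. G `` {a})" by force
    then have sumG: "sum ?f G = (\<Sum>a\<in>?Y. sum (f a) (G `` {a}))"
      by (rule trans[OF arg_cong[where f = "sum ?f"] sum.Sigma[symmetric]]) (simp_all add: Y)
    \<comment> \<open>The defect of G splits into the tail of g outside the rows met by G and the
      tails within those rows, all positive. It decreases from \<open>?H\<close> to G, so
      \<open>psd_norm_le\<close> carries the bound over.\<close>
    have "psd ((S - sum g ?Y) + (\<Sum>a\<in>?Y. g a - sum (f a) (G `` {a})))"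
      using Y psd pg f g by (intro psd_add psd_sum has_sum_psd_minus_sum) blast+
    then have 1: "psd (S - sum ?f G)" by (simp add: sumG sum_subtractf)
    have "psd (sum ?f (G - ?H))" using G psd by (intro psd_sum) auto
    then have "psd ((S - sum ?f ?H) - (S - sum ?f G))"
      using G sum_diff[of G ?H ?f] by simp
    from psd_norm_le[OF 1 this] small show "norm (S - sum ?f G) < e" by simp
  qed
qed

section \<open>Parseval's identity: polarization and dense subsets\<close>

context semi_hilbert
begin

lemma psd_inner_mult: "x \<in> hcarrier X \<Longrightarrow> y \<in> hcarrier X \<Longrightarrow> psd (hinner X x y * hinner X y x)"
  by (metis psd_mult_star star_inner)

text \<open>Polarization, with w = y i supplying the imaginary part. The identity \<open>pol\<close>
  holds for a general form B and is used both for the inner product and for each summand, which is a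
  form of the same kind.\<close>

lemma has_sum_polarize:
  assumes m: "\<And>j. j \<in> J \<Longrightarrow> m j \<in> hcarrier X"
    and q: "\<And>z. z \<in> hcarrier X \<Longrightarrow> ((\<lambda>j. hinner X z (m j) * hinner X (m j) z) has_sum hinner X z z) J"
    and x: "x \<in> hcarrier X" and y: "y \<in> hcarrier X"
  shows "((\<lambda>j. hinner X x (m j) * hinner X (m j) y) has_sum hinner X x y) J"
proof -
  let ?q = "\<lambda>z j. hinner X z (m j) * hinner X (m j) z"
  define w where "w = hscale X y (\<i> *\<^sub>C 1)"
  have w: "w \<in> hcarrier X" unfolding w_def by (intro closed_simps y)
  define s t where "s = hadd X x y" and "t = hadd X x w"
  have st: "s \<in> hcarrier X" "t \<in> hcarrier X" unfolding s_def t_def by (intro closed_simps x y w)+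
  have iw: "hinner X z w = \<i> *\<^sub>C hinner X z y" "hinner X w z = - (\<i> *\<^sub>C hinner X y z)" if "z \<in> hcarrier X" for z
    using that y by (simp_all add: w_def inner_simps closed_simps star_scaleC mult_scaleC_right
        mult_scaleC_left scaleC_minus_left)
  have pol: "B x y = (1/2) *\<^sub>R ((B s s - B x x - B y y) - \<i> *\<^sub>C (B t t - B x x - B w w))"
    if "B s s = B x x + B x y + B y x + B y y" "B t t = B x x + B x w + B w x + B w w"
      "B x w = \<i> *\<^sub>C B x y" "B w x = - (\<i> *\<^sub>C B y x)" for B :: "'x \<Rightarrow> 'x \<Rightarrow> 'a"
    unfolding that by (simp add: scaleC_diff_right scaleC_add_right scaleC_minus_right scaleC_scaleC
        algebra_simps flip: scaleR_add_left)
  have bl: "bounded_linear (\<lambda>a::'a. \<i> *\<^sub>C a)"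
    by (rule bounded_linear_intro[where K = 1])
      (auto simp: scaleC_add_right norm_scaleC scaleC_scaleC mult.commute simp flip: scaleC_of_real)
  have "((\<lambda>j. (1/2) *\<^sub>R ((?q s j - ?q x j - ?q y j) - \<i> *\<^sub>C (?q t j - ?q x j - ?q w j))) has_sum
      (1/2) *\<^sub>R ((hinner X s s - hinner X x x - hinner X y y)
        - \<i> *\<^sub>C (hinner X t t - hinner X x x - hinner X w w))) J"
    by (intro has_sum_bounded_linear[OF bounded_linear_scaleR_right] has_sum_minus
        has_sum_bounded_linear[OF bl] q x y w st)
  also have "(1/2) *\<^sub>R ((hinner X s s - hinner X x x - hinner X y y)
        - \<i> *\<^sub>C (hinner X t t - hinner X x x - hinner X w w)) = hinner X x y"
    by (rule pol[symmetric, where B = "hinner X"])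
      (use x y w in \<open>simp_all add: s_def t_def inner_simps closed_simps iw algebra_simps
        scaleC_diff_right scaleC_minus_right\<close>)
  finally show ?thesis
  proof (rule has_sum_cong[THEN iffD1, rotated])
    fix j assume "j \<in> J"
    then have mj: "m j \<in> hcarrier X" by (rule m)
    show "(1/2) *\<^sub>R ((?q s j - ?q x j - ?q y j) - \<i> *\<^sub>C (?q t j - ?q x j - ?q w j))
        = hinner X x (m j) * hinner X (m j) y"
      by (rule pol[symmetric, where B = "\<lambda>u v. hinner X u (m j) * hinner X (m j) v"])
        (use x y w mj in \<open>simp_all add: s_def t_def inner_simps closed_simps iw algebra_simps
          mult_scaleC_right mult_scaleC_left scaleC_diff_right scaleC_minus_right\<close>)
  qed
qed

text \<open>The defects \<open>\<langle>x, x\<rangle> - \<Sum>\<^sub>F \<langle>x, e\<^sub>j\<rangle>\<langle>e\<^sub>j, x\<rangle>\<close> come from a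
  semi-inner product on the same module, which bounds their variation.\<close>

lemma parseval_dense:
  assumes e: "\<And>j. j \<in> I \<Longrightarrow> e j \<in> hcarrier X"
    and D: "\<And>x d. x \<in> hcarrier X \<Longrightarrow> d > 0 \<Longrightarrow> \<exists>y\<in>D. hdist X y x < d" "D \<subseteq> hcarrier X"
    and P: "\<And>y. y \<in> D \<Longrightarrow> ((\<lambda>j. hinner X y (e j) * hinner X (e j) y) has_sum hinner X y y) I"
    and x: "x \<in> hcarrier X"
  shows "((\<lambda>j. hinner X x (e j) * hinner X (e j) x) has_sum hinner X x x) I"
proof (rule has_sum_normI)
  define S where "S = (\<lambda>F x y. \<Sum>j\<in>F. hinner X x (e j) * hinner X (e j) y)"
  define Y where "Y = (\<lambda>F. X\<lparr>hinner := \<lambda>x y. hinner X x y - S F x y\<rparr>)"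
  have Y_simps [simp]: "hcarrier (Y F) = hcarrier X" "hzero (Y F) = hzero X" "hadd (Y F) = hadd X"
    "hscale (Y F) = hscale X" "hinner (Y F) x y = hinner X x y - S F x y"
    "hdiff (Y F) = hdiff X" for F x y
    by (simp_all add: Y_def hdiff_def fun_eq_iff)
  have S_right: "S F x (hadd X y z) = S F x y + S F x z" "S F x (hscale X y a) = S F x y * a"
    "star (S F x y) = S F y x" "psd (S F x x)"
    if "F \<subseteq> I" "x \<in> hcarrier X" "y \<in> hcarrier X" "z \<in> hcarrier X" for F x y z a
  proof -
    have F: "e j \<in> hcarrier X" if "j \<in> F" for j using e \<open>F \<subseteq> I\<close> that by blast
    show "S F x (hadd X y z) = S F x y + S F x z" "S F x (hscale X y a) = S F x y * a"
      using that(2-) F by (simp_all add: S_def inner_simps distrib_left sum.distrib sum_distrib_right mult.assoc)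
    show "star (S F x y) = S F y x"
      using that(2-) F by (simp add: S_def star_sum star_mult star_inner)
    show "psd (S F x x)"
      using that(2-) F by (auto simp: S_def intro!: psd_sum psd_inner_mult)
  qed
  have psdD: "psd (hinner X y y - S F y y)" if "finite F" "F \<subseteq> I" "y \<in> D" for F y
    unfolding S_def using that e D(2) by (intro has_sum_psd_minus_sum[OF P]) (auto intro!: psd_inner_mult)
  \<comment> \<open>Positivity of the defect for finite F passes from D to all vectors by density
    and closedness of the cone; it is the one axiom of \<open>semi_hilbert\<close> for
    \<open>Y F\<close> that is not inherited algebraically.\<close>
  have psd: "psd (hinner X z z - S F z z)" if F: "finite F" "F \<subseteq> I" and z: "z \<in> hcarrier X" for F z
  proof -
    have "\<exists>y\<in>D. hdist X y z < inverse (real (Suc n))" for n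
      using D(1)[OF z, of "inverse (real (Suc n))"] by simp
    then obtain y where y: "\<And>n. y n \<in> D" "\<And>n. hdist X (y n) z < inverse (real (Suc n))" by metis
    have yc: "y n \<in> hcarrier X" for n using y(1) D(2) by blast
    have conv: "hconverges X y z"
      unfolding hconverges_def
      by (rule tendsto_zero_le[OF LIMSEQ_inverse_real_of_nat]) (use y(2) in \<open>auto intro: less_imp_le\<close>)
    have const: "hconverges X (\<lambda>n. w) w" if "w \<in> hcarrier X" for w
      using that by (simp add: hconverges_def)
    have "(\<lambda>n. hinner X (y n) (y n) - S F (y n) (y n)) \<longlonglongrightarrow> hinner X z z - S F z z"
      unfolding S_def using F e
      by (intro tendsto_intros hconverges_inner_tendsto conv z yc const) auto
    then show ?thesis by (rule psd_tendsto[rotated]) (use psdD F y in auto)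
  qed
  have Y: "semi_hilbert (Y F)" if F: "finite F" "F \<subseteq> I" for F
  proof
    show "hadd (Y F) u v = hadd (Y F) v u" if "u \<in> hcarrier (Y F)" "v \<in> hcarrier (Y F)" for u v
      using that by (simp add: add_commute)
  qed (simp_all add: closed_simps add_assoc add_zero add_neg scale_add_left scale_add_right
        scale_mult scale_one inner_add_right inner_scale_right star_inner star_diff S_right psd F
        left_diff_distrib)
  fix d :: real assume d: "d > 0"
  \<comment> \<open>One c bounds the defect seminorm of y, the other the distance from x to y; the
    square of their sum is d.\<close>
  define c where "c = sqrt d / 2"
  have c: "c > 0" "(c + c)\<^sup>2 = d" using d by (simp_all add: c_def)
  obtain y where y: "y \<in> D" "hdist X y x < c" using D(1)[OF x c(1)] by blast
  have yc: "y \<in> hcarrier X" using y D(2) by blast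
  obtain F where F: "finite F" "F \<subseteq> I" "norm (hinner X y y - S F y y) < c\<^sup>2"
    using has_sum_normD[OF P[OF y(1)], of "c\<^sup>2"] c unfolding S_def by (metis zero_less_power)
  have "norm (hinner X x x - S G x x) < d" if G: "finite G" "F \<subseteq> G" "G \<subseteq> I" for G
  proof -
    interpret Y: semi_hilbert "Y G" by (rule Y) (use G in auto)
    \<comment> \<open>Enlarging F to G only lowers the defect, so the estimate at y holds for all
      such G at once.\<close>
    have "psd (hinner X z z - S F z z - (hinner X z z - S G z z))" if "z \<in> hcarrier X" for z
    proof -
      have "S G z z = S F z z + S (G - F) z z" 
        unfolding S_def by (subst sum.subset_diff[OF G(2,1)]) (rule add.commute)
      then show ?thesis using S_right(4)[of "G - F" z] that G by auto
    qed
    from psd_norm_le[OF psd[OF G(1,3) yc] this[OF yc]] F(3)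
    have "norm (hinner X y y - S G y y) < c\<^sup>2" by (rule le_less_trans)
    then have "(hnorm (Y G) y)\<^sup>2 < c\<^sup>2" using Y.hnorm_square[of y] by simp
    then have 1: "hnorm (Y G) y < c" by (rule power2_less_imp_less) (use c(1) in simp)
    let ?z = "hdiff X x y"
    have z: "?z \<in> hcarrier X" by (intro closed_simps x yc)
    have "norm (hinner X ?z ?z - S G ?z ?z) \<le> norm (hinner X ?z ?z)"
      using psd[of G ?z] S_right(4)[of G ?z] G z by (intro psd_norm_le) auto
    then have "hnorm (Y G) ?z \<le> hnorm X ?z" by (simp add: hnorm_def)
    also have "\<dots> < c" using y(2) hdist_commute[OF x yc] by simp
    finally have "hdist (Y G) x y < c" by simp
    then have "hnorm (Y G) x < c + c" using 1 Y.hnorm_le_add_hdist[of x y] x yc by simp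
    then have "(hnorm (Y G) x)\<^sup>2 < (c + c)\<^sup>2" by (intro power_strict_mono) auto
    then show ?thesis using Y.hnorm_square[of x] c by simp
  qed
  then show "\<exists>F. finite F \<and> F \<subseteq> I \<and> (\<forall>G. finite G \<and> F \<subseteq> G \<and> G \<subseteq> I \<longrightarrow>
      norm (hinner X x x - (\<Sum>j\<in>G. hinner X x (e j) * hinner X (e j) x)) < d)"
    using F unfolding S_def by blast
qed

end

text \<open>What remains is generation. The finite partial expansions p of x lie in the submodule;
  orthonormality gives \<langle>p, p\<rangle> = \<langle>p, x\<rangle> = s, the partial Parseval
  sum, so the squared distance from p to x is the norm of \<langle>x, x\<rangle> - s.\<close>

lemma orthonormal_basisI:
  assumes frame: "parseval_frame X I e"
    and on: "\<And>i j. i \<in> I \<Longrightarrow> j \<in> I \<Longrightarrow> hinner X (e i) (e j) = (if i = j then 1 else 0)"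
  shows "orthonormal_basis X I e"
proof -
  interpret hilbert_module X using frame by (simp add: parseval_frame_def)
  interpret S: semi_hilbert X by (rule semi_hilbert)
  have e: "e j \<in> hcarrier X" if "j \<in> I" for j using frame that by (simp add: parseval_frame_def)
  have gen: "K = hcarrier X" if K: "closed_submodule X K" and eK: "e ` I \<subseteq> K" for K
  proof (rule antisym)
    show "K \<subseteq> hcarrier X" using K by (simp add: closed_submodule_def)
    show "hcarrier X \<subseteq> K"
    proof
      fix x assume x: "x \<in> hcarrier X"
      \<comment> \<open>Here p stands for the finite sum of the e_j \<langle>e_j, x\<rangle>,
        described by its inner products because these determine all the distances used
        below.\<close>
      have proj: "\<exists>p\<in>K. \<forall>z\<in>hcarrier X. hinner X z p = (\<Sum>j\<in>F. hinner X z (e j) * hinner X (e j) x)"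
        if "finite F" "F \<subseteq> I" for F
        using that
      proof (induction F)
        case empty
        then show ?case using K by (intro bexI[of _ "hzero X"]) (auto simp: closed_submodule_def)
      next
        case (insert j F)
        then obtain p where p: "p \<in> K" "\<forall>z\<in>hcarrier X. hinner X z p = (\<Sum>j\<in>F. hinner X z (e j) * hinner X (e j) x)"
          by auto
        let ?p = "hadd X p (hscale X (e j) (hinner X (e j) x))"
        have "e j \<in> K" "e j \<in> hcarrier X" "p \<in> hcarrier X"
          using insert.prems eK e p K by (auto simp: closed_submodule_def)
        then have "?p \<in> K" "\<forall>z\<in>hcarrier X. hinner X z ?p = (\<Sum>j\<in>insert j F. hinner X z (e j) * hinner X (e j) x)"
          using K p insert.hyps by (auto simp: closed_submodule_def S.inner_simps S.closed_simps add.commute)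
        then show ?case by blast
      qed
      have "\<exists>p\<in>K. hdist X p x < inverse (real (Suc n))" for n
      proof -
        let ?c = "inverse (real (Suc n))"
        have "((\<lambda>j. hinner X x (e j) * hinner X (e j) x) has_sum hinner X x x) I"
          using frame x by (simp add: parseval_frame_def)
        then obtain F where F: "finite F" "F \<subseteq> I"
          "norm (hinner X x x - (\<Sum>j\<in>F. hinner X x (e j) * hinner X (e j) x)) < ?c\<^sup>2"
          by (rule has_sum_normD[where e = "?c\<^sup>2"]) auto
        let ?s = "\<Sum>j\<in>F. hinner X x (e j) * hinner X (e j) x"
        obtain p where p: "p \<in> K" "\<And>z. z \<in> hcarrier X \<Longrightarrow> hinner X z p = (\<Sum>j\<in>F. hinner X z (e j) * hinner X (e j) x)"
          using proj[OF F(1,2)] by blast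
        have pc: "p \<in> hcarrier X" using p K by (auto simp: closed_submodule_def)
        have "hinner X (e j) p = hinner X (e j) x" if "j \<in> F" for j
        proof -
          have "hinner X (e j) p = (\<Sum>i\<in>F. if j = i then hinner X (e i) x else 0)"
            using that F(2) by (subst p(2)) (auto simp: e on subset_iff intro!: sum.cong)
          then show ?thesis using F(1) that by simp
        qed
        then have "hinner X p (e j) = hinner X x (e j)" if "j \<in> F" for j
          using that F(2) pc x e by (metis star_inner subset_iff)
        then have "hinner X p p = ?s" by (subst p(2)) (auto simp: pc)
        moreover have "hinner X p x = ?s"
        proof -
          have "hinner X p x = star ?s" using star_inner[OF x pc] p(2)[OF x] by simp
          also have "\<dots> = ?s" using F(2) x e by (simp add: star_sum star_mult star_inner subset_iff)
          finally show ?thesis .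
        qed
        ultimately have "hinner X (hdiff X p x) (hdiff X p x) = hinner X x x - ?s"
          using p(2)[OF x] by (simp add: S.inner_simps S.closed_simps pc x)
        then have "(hdist X p x)\<^sup>2 < ?c\<^sup>2" using F(3) S.hnorm_square by simp
        then have "hdist X p x < ?c" by (rule power2_less_imp_less) simp
        then show ?thesis using p(1) by blast
      qed
      then obtain p where p: "\<And>n. p n \<in> K" "\<And>n. hdist X (p n) x < inverse (real (Suc n))" by metis
      have "hconverges X p x"
        unfolding hconverges_def
        by (rule tendsto_zero_le[OF LIMSEQ_inverse_real_of_nat]) (use p(2) in \<open>auto intro: less_imp_le\<close>)
      then show "x \<in> K" using K p(1) x unfolding closed_submodule_def by blast
    qed
  qed
  show ?thesis
    using frame gen on unfolding orthonormal_basis_def parseval_frame_def by blast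
qed

section \<open>Tensor powers of a correspondence with a Parseval frame\<close>

locale framed_correspondence = correspondence M
  for M :: "('a::unital_cstar_algebra, 'x) corr" +
  fixes J :: "'j set" and m :: "'j \<Rightarrow> 'x"
  assumes essential: "essential_left M" and frame: "parseval_frame M J m"
begin

sublocale semi_hilbert M
  by (rule semi_hilbert)

abbreviation act :: "'x list \<Rightarrow> 'a \<Rightarrow> 'x list \<Rightarrow> 'a" where
  "act \<equiv> tensor_inner_act M"

abbreviation tuples :: "nat \<Rightarrow> 'x list set" where
  "tuples k \<equiv> {xs. length xs = k \<and> set xs \<subseteq> hcarrier M}"

abbreviation indices :: "nat \<Rightarrow> 'j list set" where
  "indices k \<equiv> {js. length js = k \<and> set js \<subseteq> J}"

lemma lact_one: "x \<in> hcarrier M \<Longrightarrow> lact M 1 x = x"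
  using essential by (simp add: essential_left_def)

lemma frame_closed: "j \<in> J \<Longrightarrow> m j \<in> hcarrier M"
  using frame by (simp add: parseval_frame_def)

lemma frame_has_sum: "x \<in> hcarrier M \<Longrightarrow> y \<in> hcarrier M
    \<Longrightarrow> ((\<lambda>j. hinner M x (m j) * hinner M (m j) y) has_sum hinner M x y) J"
  by (rule has_sum_polarize) (use frame frame_closed in \<open>simp_all add: parseval_frame_def\<close>)

text \<open>With \<open>star b * b\<close> = (norm a)^2 - \<open>star a * a\<close>, the adjoint
  relation gives \<langle>a x, a x\<rangle> + \<langle>b x, b x\<rangle> = (norm a)^2 \<langle>x,
  x\<rangle>, and the second term is positive.\<close>

lemma hnorm_lact:
  assumes x: "x \<in> hcarrier M"
  shows "hnorm M (lact M a x) \<le> norm a * hnorm M x"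
proof (rule power2_le_imp_le)
  let ?N = "(norm a)\<^sup>2"
  have aa: "norm (star a * a) = ?N" by (rule cstar_identity)
  have "psd (?N *\<^sub>R 1 - star a * a)"
    using psd_norm_minus[of "star a * a"] by (simp add: aa star_mult star_star)
  then obtain b where b: "star b * b = ?N *\<^sub>R 1 - star a * a"
    by (metis cstar_positive_def cstar_positive_iff_psd)
  have lac: "lact M c x \<in> hcarrier M" for c by (rule lact_closed[OF x])
  have inner_lact: "hinner M (lact M c x) (lact M c x) = hinner M x (lact M (star c * c) x)" for c
    by (simp add: lact_adjoint x lac lact_mult)
  have "hscale M x (?N *\<^sub>R 1) = lact M (star b * b + star a * a) x"
    using lact_scaleC[OF x, of "complex_of_real ?N" 1]
    by (simp only: b scaleC_of_real lact_one[OF x] diff_add_cancel)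
  then have "hinner M x (hscale M x (?N *\<^sub>R 1)) = hinner M x (lact M (star b * b + star a * a) x)"
    by (rule arg_cong)
  then have "?N *\<^sub>R hinner M x x
      = hinner M (lact M b x) (lact M b x) + hinner M (lact M a x) (lact M a x)"
    by (simp add: inner_lact lact_add x lac inner_simps)
  then have "psd (?N *\<^sub>R hinner M x x - hinner M (lact M a x) (lact M a x))"
    by (simp add: inner_psd lac)
  from psd_norm_le[OF inner_psd[OF lac] this]
  show "(hnorm M (lact M a x))\<^sup>2 \<le> (norm a * hnorm M x)\<^sup>2"
    by (simp add: hnorm_square power_mult_distrib)
qed simp

lemma bounded_linear_inner_lact:
  assumes x: "x \<in> hcarrier M" and y: "y \<in> hcarrier M"
  shows "bounded_linear (\<lambda>c. hinner M x (lact M c y))"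
proof (rule bounded_linear_intro[where K = "hnorm M x * hnorm M y"])
  fix b c :: 'a and r :: real
  show "hinner M x (lact M (b + c) y) = hinner M x (lact M b y) + hinner M x (lact M c y)"
    by (simp add: lact_add inner_simps lact_closed x y)
  show "hinner M x (lact M (r *\<^sub>R c) y) = r *\<^sub>R hinner M x (lact M c y)"
    using lact_scaleC[OF y, of "complex_of_real r" c]
    by (simp add: scaleC_of_real inner_simps lact_closed x y)
  have "norm (hinner M x (lact M c y)) \<le> hnorm M x * hnorm M (lact M c y)"
    by (intro cauchy_schwarz lact_closed x y)
  also have "\<dots> \<le> hnorm M x * (norm c * hnorm M y)"
    by (intro mult_left_mono hnorm_lact y) simp
  finally show "norm (hinner M x (lact M c y)) \<le> norm c * (hnorm M x * hnorm M y)"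
    by (simp add: mult_ac)
qed

text \<open>Continuity in the middle argument lets \<open>act_frame\<close> move a frame sum inside
  a tensor inner product.\<close>

lemma bounded_linear_act:
  "\<lbrakk>set xs \<subseteq> hcarrier M; set ys \<subseteq> hcarrier M\<rbrakk> \<Longrightarrow> bounded_linear (\<lambda>c. act xs c ys)"
proof (induction xs arbitrary: ys)
  case Nil
  then show ?case by (cases ys) (simp_all add: bounded_linear_ident bounded_linear_zero)
next
  case (Cons x xs)
  show ?case
  proof (cases ys)
    case Nil
    then show ?thesis by (simp add: bounded_linear_zero)
  next
    case (Cons y ys')
    then show ?thesis
      using Cons.prems bounded_linear_compose[OF Cons.IH bounded_linear_inner_lact[of x y]] by simp
  qed
qed

lemma star_act:
  "\<lbrakk>set xs \<subseteq> hcarrier M; set ys \<subseteq> hcarrier M\<rbrakk> \<Longrightarrow> star (act xs c ys) = act ys (star c) xs"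
proof (induction xs arbitrary: ys c)
  case Nil
  then show ?case by (cases ys) simp_all
next
  case (Cons x xs)
  then show ?case by (cases ys) (simp_all add: star_inner lact_closed lact_adjoint)
qed

text \<open>Essentialness enters here: it makes the unit a legitimate left coefficient.\<close>

lemma tensor_inner_eq_act: "set ys \<subseteq> hcarrier M \<Longrightarrow> tensor_inner M xs ys = act xs 1 ys"
  by (cases xs; cases ys) (simp_all add: lact_one)

text \<open>Parseval's identity for the sum of the tensors a_i xs_i b_i. The left coefficients make
  the induction possible: pairing the leading entry y_i with m_j leaves the shorter tensor with left
  coefficient \<langle>m_j, a_i y_i\<rangle>. Every summand is a square by its form, so positivity
  of the tensor inner product is not presupposed, and \<open>has_sum_Times_psd\<close> may merge the
  sum over j with the sums over the remaining indices.\<close>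

lemma act_frame:
  assumes "\<And>i. i \<in> N \<Longrightarrow> xs i \<in> tuples k"
  shows "((\<lambda>js. star (\<Sum>i\<in>N. act (map m js) (a i) (xs i) * b i) * (\<Sum>i\<in>N. act (map m js) (a i) (xs i) * b i))
    has_sum (\<Sum>i\<in>N. \<Sum>i'\<in>N. star (b i) * act (xs i) (star (a i) * a i') (xs i') * b i')) (indices k)"
  using assms
proof (induction k arbitrary: xs a)
  case 0
  then have xs: "xs i = []" if "i \<in> N" for i using that by auto
  have i0: "indices 0 = {[]}" by auto
  have "(\<Sum>i\<in>N. \<Sum>i'\<in>N. star (b i) * act (xs i) (star (a i) * a i') (xs i') * b i')
      = (\<Sum>i\<in>N. \<Sum>i'\<in>N. star (a i * b i) * (a i' * b i'))"
    by (simp add: xs star_mult mult.assoc)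
  also have "\<dots> = star (\<Sum>i\<in>N. act (map m []) (a i) (xs i) * b i) * (\<Sum>i\<in>N. act (map m []) (a i) (xs i) * b i)"
    by (simp add: xs star_sum sum_product)
  finally show ?case unfolding i0 by (intro has_sum_finiteI) simp_all
next
  case (Suc k)
  define y where "y i = hd (xs i)" for i
  define ys where "ys i = tl (xs i)" for i
  have xs: "xs i = y i # ys i" "y i \<in> hcarrier M" "ys i \<in> tuples k" if "i \<in> N" for i
    using Suc.prems[OF that] by (cases "xs i"; simp add: y_def ys_def)+
  define F where "F js = (\<Sum>i\<in>N. act (map m js) (a i) (xs i) * b i)" for js
  define V where "V j = (\<Sum>i\<in>N. \<Sum>i'\<in>N. star (b i) *
      act (ys i) (star (hinner M (m j) (lact M (a i) (y i))) * hinner M (m j) (lact M (a i') (y i'))) (ys i')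
      * b i')" for j
  have "((\<lambda>js. star (F (j # js)) * F (j # js)) has_sum V j) (indices k)" for j
  proof -
    have "F (j # js) = (\<Sum>i\<in>N. act (map m js) (hinner M (m j) (lact M (a i) (y i))) (ys i) * b i)" for js
      unfolding F_def by (intro sum.cong refl) (simp add: xs)
    then show ?thesis unfolding V_def using Suc.IH[of ys "\<lambda>i. hinner M (m j) (lact M (a i) (y i))"] xs(3) by simp
  qed
  \<comment> \<open>Summing over j is the frame identity for a_i y_i and a_i' y_i', applied inside
    the bounded linear map given by the remaining entries.\<close>
  moreover have "(V has_sum (\<Sum>i\<in>N. \<Sum>i'\<in>N. star (b i) * act (xs i) (star (a i) * a i') (xs i') * b i')) J"
    unfolding V_def
  proof (intro has_sum_sum_index)
    fix i i' assume i: "i \<in> N" "i' \<in> N"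
    let ?u = "lact M (a i) (y i)" and ?v = "lact M (a i') (y i')"
    have uv: "?u \<in> hcarrier M" "?v \<in> hcarrier M" using i xs(2) by (auto simp: lact_closed)
    have bl: "bounded_linear (\<lambda>c. star (b i) * act (ys i) c (ys i') * b i')"
      using xs(3)[OF i(1)] xs(3)[OF i(2)]
      by (intro bounded_linear_mult_const bounded_linear_const_mult bounded_linear_act) auto
    have "act (xs i) (star (a i) * a i') (xs i') = act (ys i) (hinner M ?u ?v) (ys i')"
      using i by (simp add: xs lact_adjoint lact_mult lact_closed)
    then have "((\<lambda>j. star (b i) * act (ys i) (hinner M ?u (m j) * hinner M (m j) ?v) (ys i') * b i')
        has_sum star (b i) * act (xs i) (star (a i) * a i') (xs i') * b i') J"
      using has_sum_bounded_linear[OF bl frame_has_sum[OF uv]] by simp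
    then show "((\<lambda>j. star (b i) * act (ys i) (star (hinner M (m j) ?u) * hinner M (m j) ?v) (ys i') * b i')
        has_sum star (b i) * act (xs i) (star (a i) * a i') (xs i') * b i') J"
      by (rule has_sum_cong[THEN iffD1, rotated]) (simp add: star_inner uv frame_closed)
  qed
  ultimately have "((\<lambda>(j, js). star (F (j # js)) * F (j # js)) has_sum
      (\<Sum>i\<in>N. \<Sum>i'\<in>N. star (b i) * act (xs i) (star (a i) * a i') (xs i') * b i')) (J \<times> indices k)"
    by (intro has_sum_Times_psd psd_star_mult)
  moreover have "bij_betw (\<lambda>(j, js). j # js) (J \<times> indices k) (indices (Suc k))"
    by (rule bij_betw_byWitness[where f' = "\<lambda>js. (hd js, tl js)"]) (auto simp: length_Suc_conv)
  ultimately show ?case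
    using has_sum_reindex_bij_betw[of "\<lambda>(j, js). j # js" "J \<times> indices k" "indices (Suc k)" "\<lambda>js. star (F js) * F js"]
    unfolding F_def by (simp add: case_prod_unfold)
qed

section \<open>The formal tensor power as a semi-Hilbert module\<close>

abbreviation pre :: "nat \<Rightarrow> ('a, 'x list \<Rightarrow>\<^sub>0 'a) hmodule" where
  "pre k \<equiv> tensor_pre M k"

abbreviation pkeys :: "('x list \<Rightarrow>\<^sub>0 'a) \<Rightarrow> 'x list set" where
  "pkeys \<equiv> Poly_Mapping.keys"

abbreviation coef :: "('x list \<Rightarrow>\<^sub>0 'a) \<Rightarrow> 'x list \<Rightarrow> 'a" where
  "coef \<equiv> Poly_Mapping.lookup"

lemma lookup_map_mult: "coef (Poly_Mapping.map (\<lambda>c. c * a) f) xs = coef f xs * a"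
  by (auto simp: Poly_Mapping.map.rep_eq when_def)

lemma pre_simps: "hzero (pre k) = 0" "hadd (pre k) f g = f + g"
  "hscale (pre k) f a = Poly_Mapping.map (\<lambda>c. c * a) f"
  by (simp_all add: tensor_pre_def)

lemma pre_carrier: "f \<in> hcarrier (pre k) \<longleftrightarrow> pkeys f \<subseteq> tuples k"
  by (auto simp: tensor_pre_def)

text \<open>Arbitrary finite supersets of the supports are allowed, so that g, h and g + h can be
  summed over one index set despite cancellation.\<close>

lemma pre_inner:
  assumes "f \<in> hcarrier (pre k)" "g \<in> hcarrier (pre k)"
    and K: "finite K" "pkeys f \<subseteq> K" and L: "finite L" "pkeys g \<subseteq> L" "L \<subseteq> tuples k"
  shows "hinner (pre k) f g = (\<Sum>xs\<in>K. \<Sum>ys\<in>L. star (coef f xs) * act xs 1 ys * coef g ys)"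
proof -
  have "hinner (pre k) f g
      = (\<Sum>xs\<in>pkeys f. \<Sum>ys\<in>pkeys g. star (coef f xs) * tensor_inner M xs ys * coef g ys)"
    by (simp add: tensor_pre_def)
  also have "\<dots> = (\<Sum>xs\<in>K. \<Sum>ys\<in>pkeys g. star (coef f xs) * tensor_inner M xs ys * coef g ys)"
    by (rule sum.mono_neutral_left) (use K in \<open>auto simp: in_keys_iff\<close>)
  also have "\<dots> = (\<Sum>xs\<in>K. \<Sum>ys\<in>L. star (coef f xs) * tensor_inner M xs ys * coef g ys)"
    by (intro sum.cong refl sum.mono_neutral_left) (use L in \<open>auto simp: in_keys_iff\<close>)
  also have "\<dots> = (\<Sum>xs\<in>K. \<Sum>ys\<in>L. star (coef f xs) * act xs 1 ys * coef g ys)"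
    by (intro sum.cong refl) (use L in \<open>auto simp: tensor_inner_eq_act subset_iff\<close>)
  finally show ?thesis .
qed

lemma pre_inner_keys:
  assumes "f \<in> hcarrier (pre k)" "g \<in> hcarrier (pre k)"
  shows "hinner (pre k) f g = (\<Sum>xs\<in>pkeys f. \<Sum>ys\<in>pkeys g. star (coef f xs) * act xs 1 ys * coef g ys)"
  by (rule pre_inner) (use assms in \<open>auto simp: pre_carrier\<close>)

lemma keys_map_mult: "pkeys (Poly_Mapping.map (\<lambda>c. c * a) f) \<subseteq> pkeys f"
  by (auto simp: in_keys_iff lookup_map_mult)

definition pre_basis :: "'j list \<Rightarrow> ('x list \<Rightarrow>\<^sub>0 'a)" where
  "pre_basis js = Poly_Mapping.single (map m js) 1"

lemma pre_basis_closed: "js \<in> indices k \<Longrightarrow> pre_basis js \<in> hcarrier (pre k)"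
  using frame_closed by (force simp: pre_carrier pre_basis_def)

lemma inner_pre_basis_left:
  assumes "js \<in> indices k" "f \<in> hcarrier (pre k)"
  shows "hinner (pre k) (pre_basis js) f = (\<Sum>xs\<in>pkeys f. act (map m js) 1 xs * coef f xs)"
proof -
  have "hinner (pre k) (pre_basis js) f
      = (\<Sum>xs\<in>{map m js}. \<Sum>ys\<in>pkeys f. star (coef (pre_basis js) xs) * act xs 1 ys * coef f ys)"
    by (rule pre_inner[OF pre_basis_closed[OF assms(1)] assms(2)])
      (use assms in \<open>auto simp: pre_basis_def pre_carrier\<close>)
  then show ?thesis by (simp add: pre_basis_def)
qed

text \<open>Kept as a sum of explicit squares because \<open>semi_hilbert_pre\<close> reads
  positivity of \<langle>f, f\<rangle> off it; only afterwards can it be rewritten with inner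
  products in \<open>pre_parseval\<close>.\<close>

lemma pre_parseval_act:
  assumes "f \<in> hcarrier (pre k)"
  shows "((\<lambda>js. star (\<Sum>xs\<in>pkeys f. act (map m js) 1 xs * coef f xs) * (\<Sum>xs\<in>pkeys f. act (map m js) 1 xs * coef f xs))
    has_sum hinner (pre k) f f) (indices k)"
  using act_frame[of "pkeys f" "\<lambda>xs. xs" k "\<lambda>_. 1" "coef f"] assms
  by (auto simp: pre_inner_keys pre_carrier)

lemma semi_hilbert_pre: "semi_hilbert (pre k)"
proof
  show "hzero (pre k) \<in> hcarrier (pre k)" by (simp add: pre_carrier pre_simps)
  fix f g assume f: "f \<in> hcarrier (pre k)" and g: "g \<in> hcarrier (pre k)"
  show "hadd (pre k) f g \<in> hcarrier (pre k)"
    using f g keys_add[of f g] unfolding pre_carrier pre_simps by blast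
  show "hscale (pre k) f a \<in> hcarrier (pre k)" for a
    using f keys_map_mult by (auto simp: pre_carrier pre_simps)
  show "hadd (pre k) f g = hadd (pre k) g f" by (simp add: pre_simps add.commute)
  show "hadd (pre k) f (hzero (pre k)) = f" by (simp add: pre_simps)
  show "hadd (pre k) f (hscale (pre k) f (- 1)) = hzero (pre k)"
    unfolding pre_simps by (rule poly_mapping_eqI, simp only: lookup_add lookup_map_mult, simp)
  show "hscale (pre k) (hadd (pre k) f g) a = hadd (pre k) (hscale (pre k) f a) (hscale (pre k) g a)" for a
    by (auto simp: pre_simps lookup_add lookup_map_mult algebra_simps intro!: poly_mapping_eqI)
  show "hscale (pre k) f (a + b) = hadd (pre k) (hscale (pre k) f a) (hscale (pre k) f b)" for a b
    unfolding pre_simps by (rule poly_mapping_eqI, simp only: lookup_add lookup_map_mult, rule distrib_left)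
  show "hscale (pre k) f (a * b) = hscale (pre k) (hscale (pre k) f a) b" for a b
    by (auto simp: pre_simps lookup_map_mult mult.assoc intro!: poly_mapping_eqI)
  show "hscale (pre k) f 1 = f"
    unfolding pre_simps by (rule poly_mapping_eqI, simp only: lookup_map_mult, simp)
  show "hinner (pre k) f (hscale (pre k) g a) = hinner (pre k) f g * a" for a
  proof -
    have "hscale (pre k) g a \<in> hcarrier (pre k)"
      using g keys_map_mult by (auto simp: pre_carrier pre_simps)
    then have "hinner (pre k) f (hscale (pre k) g a)
        = (\<Sum>xs\<in>pkeys f. \<Sum>ys\<in>pkeys g. star (coef f xs) * act xs 1 ys * coef (hscale (pre k) g a) ys)"
      using f g keys_map_mult by (intro pre_inner) (auto simp: pre_simps pre_carrier)
    then show ?thesis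
      by (simp add: pre_inner_keys f g pre_simps lookup_map_mult sum_distrib_right mult.assoc)
  qed
  show "star (hinner (pre k) f g) = hinner (pre k) g f"
  proof -
    have "star (hinner (pre k) f g) = (\<Sum>xs\<in>pkeys f. \<Sum>ys\<in>pkeys g. star (coef g ys) * act ys 1 xs * coef f xs)"
      using f g unfolding pre_inner_keys[OF f g] star_sum
      by (intro sum.cong refl) (auto simp: star_mult star_star star_act pre_carrier mult.assoc subset_iff)
    then show ?thesis by (simp add: pre_inner_keys[OF g f] sum.swap[of _ "pkeys g"])
  qed
  show "psd (hinner (pre k) f f)"
    by (rule has_sum_psd[OF pre_parseval_act[OF f]]) (rule psd_star_mult)
  fix h assume h: "h \<in> hcarrier (pre k)"
  show "hadd (pre k) (hadd (pre k) f g) h = hadd (pre k) f (hadd (pre k) g h)"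
    by (simp add: pre_simps add.assoc)
  show "hinner (pre k) f (hadd (pre k) g h) = hinner (pre k) f g + hinner (pre k) f h"
  proof -
    let ?L = "pkeys g \<union> pkeys h"
    have L: "finite ?L" "?L \<subseteq> tuples k" using g h by (auto simp: pre_carrier)
    have gh: "g + h \<in> hcarrier (pre k)" "pkeys (g + h) \<subseteq> ?L"
      using keys_add[of g h] L unfolding pre_carrier by blast+
    have "hinner (pre k) f u = (\<Sum>xs\<in>pkeys f. \<Sum>ys\<in>?L. star (coef f xs) * act xs 1 ys * coef u ys)"
      if "u \<in> hcarrier (pre k)" "pkeys u \<subseteq> ?L" for u
      using f that L by (intro pre_inner) auto
    then show ?thesis
      using g h gh by (simp add: pre_simps lookup_add distrib_left sum.distrib)
  qed
qed

sublocale pre: semi_hilbert "pre k" for k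
  by (rule semi_hilbert_pre)

lemma pre_parseval:
  assumes f: "f \<in> hcarrier (pre k)"
  shows "((\<lambda>js. hinner (pre k) f (pre_basis js) * hinner (pre k) (pre_basis js) f)
    has_sum hinner (pre k) f f) (indices k)"
  using pre_parseval_act[OF f]
proof (rule has_sum_cong[THEN iffD1, rotated])
  fix js assume js: "js \<in> indices k"
  show "star (\<Sum>xs\<in>pkeys f. act (map m js) 1 xs * coef f xs) * (\<Sum>xs\<in>pkeys f. act (map m js) 1 xs * coef f xs)
      = hinner (pre k) f (pre_basis js) * hinner (pre k) (pre_basis js) f"
    unfolding inner_pre_basis_left[OF js f, symmetric] pre.star_inner[OF pre_basis_closed[OF js] f] ..
qed

lemma coef_formal_cons:
  "coef (formal_cons x f) xs = (case xs of [] \<Rightarrow> 0 | y # ys \<Rightarrow> if y = x then coef f ys else 0)"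
proof -
  have "coef (formal_cons x f) (y # ys) = (\<Sum>zs\<in>pkeys f. if zs = ys then (if y = x then coef f ys else 0) else 0)" for y ys
    unfolding formal_cons_def lookup_sum lookup_single when_def by (intro sum.cong) auto
  moreover have "coef (formal_cons x f) [] = 0"
    by (simp add: formal_cons_def lookup_sum lookup_single)
  ultimately show ?thesis by (cases xs) (auto simp: in_keys_iff)
qed

lemma keys_formal_cons: "pkeys (formal_cons x f) = (#) x ` pkeys f"
  by (auto simp: in_keys_iff coef_formal_cons split: list.splits if_splits)

lemma formal_cons_single: "formal_cons (x :: 'x) (Poly_Mapping.single xs a) = Poly_Mapping.single (x # xs) (a :: 'a)"
  by (rule poly_mapping_eqI) (auto simp: coef_formal_cons lookup_single when_def split: list.splits)

text \<open>The leading entries contribute \<langle>x, 1 x\<rangle> = 1, which is the left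
  coefficient of the remaining inner product.\<close>

lemma isometry_formal_cons:
  assumes x: "x \<in> hcarrier M" "hinner M x x = 1"
  shows "hilbert_isometry (pre k) (pre (Suc k)) (formal_cons x)"
proof
  fix f g assume f: "f \<in> hcarrier (pre k)" and g: "g \<in> hcarrier (pre k)"
  have cl: "formal_cons x h \<in> hcarrier (pre (Suc k))" if "h \<in> hcarrier (pre k)" for h
    using that x unfolding pre_carrier keys_formal_cons by force
  show "formal_cons x f \<in> hcarrier (pre (Suc k))" by (rule cl[OF f])
  show "formal_cons x (hadd (pre k) f g) = hadd (pre (Suc k)) (formal_cons x f) (formal_cons x g)"
    by (auto simp: pre_simps coef_formal_cons lookup_add intro!: poly_mapping_eqI split: list.splits)
  show "formal_cons x (hscale (pre k) f a) = hscale (pre (Suc k)) (formal_cons x f) a" for a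
    by (auto simp: pre_simps coef_formal_cons lookup_map_mult intro!: poly_mapping_eqI split: list.splits)
  show "hinner (pre (Suc k)) (formal_cons x f) (formal_cons x g) = hinner (pre k) f g"
    by (simp add: pre_inner_keys f g cl keys_formal_cons sum.reindex coef_formal_cons x lact_one)
qed

end

section \<open>The direct limit of the tensor powers\<close>

lemma replicate_append_dropWhile:
  "replicate (length (takeWhile ((=) x) xs)) x @ dropWhile ((=) x) xs = xs"
proof -
  have "replicate (length (takeWhile ((=) x) xs)) x = takeWhile ((=) x) xs"
    by (rule replicate_length_same) (auto dest: set_takeWhileD)
  then show ?thesis by simp
qed

locale pointed_correspondence = framed_correspondence M J m
  for M :: "('a::unital_cstar_algebra, 'x) corr" and J :: "nat set" and m :: "nat \<Rightarrow> 'x" +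
  assumes zero_in: "0 \<in> J" and unit: "hinner M (m 0) (m 0) = 1"
begin

abbreviation T :: "nat \<Rightarrow> ('a, 'x) tensor \<Rightarrow> ('a, 'x) tensor" where
  "T \<equiv> \<lambda>k n. tensor_cons M k (m 0) n"

abbreviation Minf :: "('a, ('a, 'x) tensor limit) hmodule" where
  "Minf \<equiv> direct_limit (tensor_power M) T"

lemma isometry_pre: "hilbert_isometry (pre k) (pre (Suc k)) (formal_cons (m 0))"
  by (intro isometry_formal_cons frame_closed zero_in unit)

lemma tensor_cons_eq_extension: "T k = hilbert_isometry.extension (pre (Suc k)) (formal_cons (m 0))"
  by (simp add: fun_eq_iff tensor_cons_def hilbert_isometry.extension_def[OF isometry_pre])

sublocale sys: hilbert_system "tensor_power M" T
proof (rule hilbert_system.intro)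
  show "hilbert_isometry (tensor_power M k) (tensor_power M (Suc k)) (T k)" for k
    unfolding tensor_power_def tensor_cons_eq_extension
    by (rule hilbert_isometry.hilbert_isometry_extension[OF isometry_pre])
qed

lemma hilbert_module_Lim: "hilbert_module Minf"
  by (rule sys.hilbert_module_direct_limit)

sublocale Minf: semi_hilbert Minf
  by (rule hilbert_module.semi_hilbert[OF hilbert_module_Lim])

text \<open>Maps formal sums straight into the limit, bypassing both completions, so that later
  computations are finite.\<close>

definition level :: "nat \<Rightarrow> ('x list \<Rightarrow>\<^sub>0 'a) \<Rightarrow> ('a, 'x) tensor limit" where
  "level k f = limit_map (tensor_power M) T k (completion_embed (pre k) f)"

lemma emb_in_power: "f \<in> hcarrier (pre k) \<Longrightarrow> completion_embed (pre k) f \<in> hcarrier (tensor_power M k)"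
  by (simp add: tensor_power_def pre.emb_closed)

lemma level_closed: "f \<in> hcarrier (pre k) \<Longrightarrow> level k f \<in> hcarrier Minf"
  unfolding level_def by (intro sys.limit_map_closed emb_in_power)

lemma level_inner: "f \<in> hcarrier (pre k) \<Longrightarrow> g \<in> hcarrier (pre k)
    \<Longrightarrow> hinner Minf (level k f) (level k g) = hinner (pre k) f g"
  by (simp add: level_def sys.limit_map_inner emb_in_power) (simp add: tensor_power_def pre.emb_inner)

lemma level_cons:
  assumes "f \<in> hcarrier (pre k)"
  shows "level (Suc k) (formal_cons (m 0) f) = level k f"
proof -
  have "completion_embed (pre (Suc k)) (formal_cons (m 0) f) = T k (completion_embed (pre k) f)"
    unfolding tensor_cons_eq_extension by (rule hilbert_isometry.extension_emb[OF isometry_pre assms, symmetric])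
  then show ?thesis by (simp add: level_def sys.limit_map_Suc emb_in_power assms)
qed

lemma level_mono:
  assumes "f \<in> hcarrier (pre k)" "k \<le> l"
  shows "\<exists>g\<in>hcarrier (pre l). level l g = level k f"
  using assms(2)
proof (induction l rule: dec_induct)
  case (step l)
  then show ?case using level_cons hilbert_isometry.closed[OF isometry_pre] by metis
qed (use assms in auto)

text \<open>Half of e is spent on reaching some tensor power, the other half on replacing its
  element by a formal sum.\<close>

lemma level_dense:
  assumes P: "P \<in> hcarrier Minf" and e: "e > 0"
  shows "\<exists>k. \<exists>f\<in>hcarrier (pre k). hdist Minf (level k f) P < e"
proof -
  obtain k x where x: "x \<in> hcarrier (tensor_power M k)"
    "hdist Minf (limit_map (tensor_power M) T k x) P < e / 2"
    by (rule sys.direct_limit_dense[OF P half_gt_zero[OF e]])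
  obtain f where f: "f \<in> hcarrier (pre k)" "hdist (tensor_power M k) (completion_embed (pre k) f) x < e / 2"
    using pre.completion_dense[of x k "e / 2"] x(1) e unfolding tensor_power_def by auto
  have "hdist Minf (level k f) P \<le> hdist Minf (level k f) (limit_map (tensor_power M) T k x)
      + hdist Minf (limit_map (tensor_power M) T k x) P"
    using P x(1) f(1) by (intro Minf.hdist_triangle level_closed sys.limit_map_closed)
  moreover have "hdist Minf (level k f) (limit_map (tensor_power M) T k x) < e / 2"
    using f x(1) by (simp add: level_def sys.limit_map_hdist emb_in_power)
  ultimately have "hdist Minf (level k f) P < e" using x(2) by linarith
  then show ?thesis using f(1) by blast
qed

section \<open>Reduced words and Parseval's identity in the limit\<close>

definition basis :: "nat list \<Rightarrow> ('a, 'x) tensor limit" where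
  "basis js = level (length js) (pre_basis js)"

abbreviation reduced :: "nat list set" where
  "reduced \<equiv> {js. set js \<subseteq> J \<and> (js = [] \<or> hd js > 0)}"

lemma level_replicate:
  assumes "js \<in> indices k"
  shows "level (d + k) (pre_basis (replicate d 0 @ js)) = level k (pre_basis js)"
proof (induction d)
  case (Suc d)
  have "replicate d 0 @ js \<in> indices (d + k)" using assms zero_in by auto
  from level_cons[OF pre_basis_closed[OF this]] show ?case
    using Suc by (simp add: pre_basis_def formal_cons_single)
qed simp

lemma basis_dropWhile:
  assumes "js \<in> indices k"
  shows "basis (dropWhile ((=) 0) js) = level k (pre_basis js)"
proof -
  let ?d = "length (takeWhile ((=) 0) js)" and ?r = "dropWhile ((=) 0) js"
  have r: "?r \<in> indices (length ?r)" using assms by (auto dest: set_dropWhileD)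
  have "?d + length ?r = k"
    using assms by (metis (mono_tags, lifting) length_append mem_Collect_eq takeWhile_dropWhile_id)
  then show ?thesis
    using level_replicate[OF r, of ?d] by (simp add: basis_def replicate_append_dropWhile)
qed

lemma dropWhile_reduced: "js \<in> reduced \<Longrightarrow> dropWhile ((=) 0) (replicate d 0 @ js) = js"
  by (induction d) (auto simp: dropWhile_eq_self_iff)

text \<open>The inverse pads with zeros up to length k; a reduced word does not begin with 0, so
  stripping removes exactly the padding.\<close>

lemma bij_betw_dropWhile:
  "bij_betw (dropWhile ((=) 0)) (indices k) {js \<in> reduced. length js \<le> k}"
proof (rule bij_betw_byWitness[where f' = "\<lambda>js. replicate (k - length js) 0 @ js"])
  show "\<forall>js\<in>indices k. replicate (k - length (dropWhile ((=) 0) js)) 0 @ dropWhile ((=) 0) js = js"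
  proof
    fix js assume "js \<in> indices k"
    then have "k - length (dropWhile ((=) 0) js) = length (takeWhile ((=) 0) js)"
      by (metis (mono_tags, lifting) add_diff_cancel_right' length_append mem_Collect_eq takeWhile_dropWhile_id)
    then show "replicate (k - length (dropWhile ((=) 0) js)) 0 @ dropWhile ((=) 0) js = js"
      by (simp add: replicate_append_dropWhile)
  qed
  show "\<forall>js\<in>{js \<in> reduced. length js \<le> k}. dropWhile ((=) 0) (replicate (k - length js) 0 @ js) = js"
    using dropWhile_reduced by blast
  have "dropWhile ((=) 0) js = [] \<or> hd (dropWhile ((=) 0) js) > 0" for js :: "nat list"
    using hd_dropWhile[of "(=) 0" js] by (metis gr_zeroI)
  then show "dropWhile ((=) 0) ` indices k \<subseteq> {js \<in> reduced. length js \<le> k}"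
    by (intro image_subsetI CollectI conjI) (auto simp del: dropWhile_eq_Nil_conv dest: set_dropWhileD intro: length_dropWhile_le)
  show "(\<lambda>js. replicate (k - length js) 0 @ js) ` {js \<in> reduced. length js \<le> k} \<subseteq> indices k"
    using zero_in by auto
qed

lemma basis_closed: "js \<in> reduced \<Longrightarrow> basis js \<in> hcarrier Minf"
  unfolding basis_def by (intro level_closed pre_basis_closed) auto

abbreviation weight :: "('a, 'x) tensor limit \<Rightarrow> nat list \<Rightarrow> 'a" where
  "weight \<xi> js \<equiv> hinner Minf \<xi> (basis js) * hinner Minf (basis js) \<xi>"

lemma psd_weight: "\<xi> \<in> hcarrier Minf \<Longrightarrow> js \<in> reduced \<Longrightarrow> psd (weight \<xi> js)"
  by (intro Minf.psd_inner_mult basis_closed)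

lemma level_parseval_bounded:
  assumes f: "f \<in> hcarrier (pre k)"
  shows "(weight (level k f) has_sum hinner Minf (level k f) (level k f)) {js \<in> reduced. length js \<le> k}"
proof -
  have eq: "weight (level k f) (dropWhile ((=) 0) js)
      = hinner (pre k) f (pre_basis js) * hinner (pre k) (pre_basis js) f" if "js \<in> indices k" for js
    by (simp only: basis_dropWhile[OF that] level_inner pre_basis_closed[OF that] f)
  have "((\<lambda>js. weight (level k f) (dropWhile ((=) 0) js)) has_sum hinner Minf (level k f) (level k f)) (indices k)"
    unfolding level_inner[OF f f] by (subst has_sum_cong[OF eq]) (use pre_parseval[OF f] in simp_all)
  then show ?thesis by (rule has_sum_reindex_bij_betw[OF bij_betw_dropWhile, THEN iffD1])
qed

text \<open>Parseval's identity also holds on every higher level, so longer words contribute nothing.\<close>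

lemma level_parseval:
  assumes f: "f \<in> hcarrier (pre k)"
  shows "(weight (level k f) has_sum hinner Minf (level k f) (level k f)) reduced"
proof -
  let ?\<xi> = "level k f" and ?I = "\<lambda>k. {js \<in> reduced. length js \<le> k}"
  have \<xi>: "?\<xi> \<in> hcarrier Minf" by (rule level_closed[OF f])
  let ?q = "hinner Minf ?\<xi> ?\<xi>"
  note sum_k = level_parseval_bounded[OF f]
  have "weight ?\<xi> js = 0" if js: "js \<in> reduced" "length js > k" for js
  proof -
    obtain g where g: "g \<in> hcarrier (pre (length js))" "level (length js) g = ?\<xi>"
      using level_mono[OF f, of "length js"] js by auto
    have sum_l: "(weight ?\<xi> has_sum ?q) (?I (length js))"
      using level_parseval_bounded[OF g(1)] unfolding g(2) .
    \<comment> \<open>The words of length at most k already exhaust \<open>?q\<close>, while on the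
      level of js the same total must also accommodate \<open>weight ?\<xi> js\<close>. In the limit
      over F nothing is left for it.\<close>
    have "psd (?q - ?q - weight ?\<xi> js)"
    proof (rule psd_tendsto[OF finite_subsets_at_top_neq_bot])
      show "((\<lambda>F. ?q - sum (weight ?\<xi>) F - weight ?\<xi> js) \<longlongrightarrow> ?q - ?q - weight ?\<xi> js)
          (finite_subsets_at_top (?I k))"
        using sum_k unfolding has_sum_def by (intro tendsto_intros)
      have "psd (?q - sum (weight ?\<xi>) F - weight ?\<xi> js)" if F: "finite F" "F \<subseteq> ?I k" for F
      proof -
        have "js \<notin> F" using F js by auto
        moreover have "psd (?q - sum (weight ?\<xi>) (insert js F))"
          by (rule has_sum_psd_minus_sum[OF sum_l]) (use F js psd_weight[OF \<xi>] in auto)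
        ultimately show ?thesis using F by (simp add: algebra_simps)
      qed
      then show "\<forall>\<^sub>F F in finite_subsets_at_top (?I k). psd (?q - sum (weight ?\<xi>) F - weight ?\<xi> js)"
        by (auto simp: eventually_finite_subsets_at_top)
    qed
    then show ?thesis using psd_antisym[OF psd_weight[OF \<xi> js(1)]] by simp
  qed
  then show ?thesis
    using sum_k by (subst has_sum_cong_neutral[where S = reduced and T = "?I k" and g = "weight ?\<xi>"]) auto
qed

lemma parseval_frame_basis: "parseval_frame Minf reduced basis"
  unfolding parseval_frame_def
proof (intro conjI ballI hilbert_module_Lim basis_closed)
  show "countable reduced" by (rule countableI_type)
  let ?D = "{level k f | k f. f \<in> hcarrier (pre k)}"
  show "(weight \<xi> has_sum hinner Minf \<xi> \<xi>) reduced" if "\<xi> \<in> hcarrier Minf" for \<xi>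
  proof (rule Minf.parseval_dense[where D = ?D, OF basis_closed _ _ _ that])
    show "\<exists>y\<in>?D. hdist Minf y x < d" if "x \<in> hcarrier Minf" "d > 0" for x d
      using level_dense[OF that] by blast
    show "?D \<subseteq> hcarrier Minf" using level_closed by blast
    show "(weight y has_sum hinner Minf y y) reduced" if "y \<in> ?D" for y
      using that level_parseval by blast
  qed
qed

section \<open>The orthonormal case\<close>

lemma act_orthonormal:
  assumes on: "\<And>i j. i \<in> J \<Longrightarrow> j \<in> J \<Longrightarrow> hinner M (m i) (m j) = (if i = j then 1 else 0)"
  shows "\<lbrakk>is \<in> indices k; js \<in> indices k\<rbrakk> \<Longrightarrow> act (map m is) 1 (map m js) = (if is = js then 1 else 0)"
proof (induction k arbitrary: "is" js)
  case (Suc k)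
  obtain i is' where [simp]: "is = i # is'" using Suc.prems(1) by (cases "is") auto
  obtain j js' where [simp]: "js = j # js'" using Suc.prems(2) by (cases js) auto
  have ij: "i \<in> J" "j \<in> J" "is' \<in> indices k" "js' \<in> indices k" using Suc.prems by auto
  \<comment> \<open>Distinct leading indices produce the left coefficient 0, which linearity
    propagates through the remaining entries.\<close>
  have "act (map m is') 0 (map m js') = 0"
    using ij frame_closed by (intro linear_0 bounded_linear.linear bounded_linear_act) auto
  then show ?case using Suc.IH[OF ij(3,4)] ij
    by (cases "is' = js'") (simp_all add: lact_one frame_closed on)
qed simp

lemma inner_pre_basis:
  assumes "is \<in> indices k" "js \<in> indices k"
  shows "hinner (pre k) (pre_basis is) (pre_basis js) = act (map m is) 1 (map m js)"
\<comment> \<open>In the zero algebra \<open>Poly_Mapping.single xs 1\<close> is 0 and has no keys,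
  so the key sum is not over the single word; all values agree there anyway.\<close>
proof (cases "(1::'a) = 0")
  case True
  then have "a = 0" for a :: 'a by (metis mult.right_neutral mult_zero_right)
  then show ?thesis by metis
next
  case False
  then show ?thesis
    unfolding inner_pre_basis_left[OF assms(1) pre_basis_closed[OF assms(2)]]
    by (simp add: pre_basis_def)
qed

text \<open>Padding with leading zeros brings both words to a common length without changing their
  vectors, and reduced words are determined by their padded forms.\<close>

lemma basis_orthonormal:
  assumes on: "\<And>i j. i \<in> J \<Longrightarrow> j \<in> J \<Longrightarrow> hinner M (m i) (m j) = (if i = j then 1 else 0)"
    and "is": "is \<in> reduced" and js: "js \<in> reduced"
  shows "hinner Minf (basis is) (basis js) = (if is = js then 1 else 0)"
proof -
  let ?n = "max (length is) (length js)"
  let ?pad = "\<lambda>js. replicate (?n - length js) 0 @ js"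
  have pad: "?pad is \<in> indices ?n" "?pad js \<in> indices ?n" using "is" js zero_in by auto
  have "basis is = level ?n (pre_basis (?pad is))" "basis js = level ?n (pre_basis (?pad js))"
    using basis_dropWhile[OF pad(1)] basis_dropWhile[OF pad(2)]
    unfolding dropWhile_reduced[OF "is"] dropWhile_reduced[OF js] by simp_all
  then have "hinner Minf (basis is) (basis js) = (if ?pad is = ?pad js then 1 else 0)"
    by (simp add: level_inner pre_basis_closed[OF pad(1)] pre_basis_closed[OF pad(2)]
        inner_pre_basis[OF pad] act_orthonormal[OF on pad] del: map_append map_replicate)
  moreover have "?pad is = ?pad js \<longleftrightarrow> is = js"
    using dropWhile_reduced[OF "is"] dropWhile_reduced[OF js] by metis
  ultimately show ?thesis by simp
qed

end

theorem proposition4p2: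
  fixes M :: "('a::unital_cstar_algebra, 'x) corr"
    and J :: "nat set" and m :: "nat \<Rightarrow> 'x"
    and T :: "nat \<Rightarrow> ('a, 'x) tensor \<Rightarrow> ('a, 'x) tensor"
    and M_inf :: "('a, ('a, 'x) tensor limit) hmodule"
    and \<iota> :: "nat \<Rightarrow> ('a, 'x) tensor \<Rightarrow> ('a, 'x) tensor limit"
    and I :: "nat list set" and e :: "nat list \<Rightarrow> ('a, 'x) tensor limit"
  assumes "correspondence M" and "essential_left M"
    and "0 \<in> J" and "parseval_frame M J m"
    and "hinner M (m 0) (m 0) = 1"
    and T_eq: "T = (\<lambda>k n. tensor_cons M k (m 0) n)"
    and M_inf_eq: "M_inf = direct_limit (tensor_power M) T"
    and iota_eq: "\<iota> = limit_map (tensor_power M) T"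
    and I_eq: "I = {js. set js \<subseteq> J \<and> (js = [] \<or> hd js > 0)}"
    and e_eq: "e = (\<lambda>js. if js = [] then \<iota> 0 (tensor_scalar M 1)
                         else \<iota> (length js) (elementary_tensor M (map m js)))"
  shows "parseval_frame M_inf I e \<and>
         (orthonormal_basis M J m \<longrightarrow> orthonormal_basis M_inf I e)"
proof -
  interpret pointed_correspondence M J m
    using assms by (intro pointed_correspondence.intro framed_correspondence.intro
        framed_correspondence_axioms.intro pointed_correspondence_axioms.intro)
  have M_inf: "M_inf = Minf" by (simp add: M_inf_eq T_eq)
  \<comment> \<open>For the empty word \<open>pre_basis []\<close> is the formal scalar 1 at level
    0, so the extra element is covered by the same formula as the other words.\<close>
  have e: "e = basis"
    by (auto simp: fun_eq_iff e_eq iota_eq T_eq basis_def level_def tensor_scalar_def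
        elementary_tensor_def pre_basis_def)
  have frame: "parseval_frame M_inf I e"
    unfolding M_inf e I_eq by (rule parseval_frame_basis)
  moreover have "orthonormal_basis M_inf I e" if "orthonormal_basis M J m"
    using that unfolding M_inf e I_eq orthonormal_basis_def[of M]
    by (intro orthonormal_basisI parseval_frame_basis basis_orthonormal) blast+
  ultimately show ?thesis by blast
qed

end
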